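(* Let $u\in H$ be deterministic. Let $F\in\mathrm{Dom}(\nabla)$ be a $\mathbb{P}$-a.s. positive random variable such that $D_tF\in\mathrm{Dom}(\nabla)$ for all $t\in[0,T]$, $(D_tD_tF)_{t\in[0,T]}\in L^1(\Omega\times[0,T],\mathbb{P}_u\otimes\mu)$ and $\sqrt F\in\mathrm{Dom}(\Delta)$, and sufficiently smooth that $\xi_t:=D_t\log F$ satisfies $\xi\in L^2(\Omega\times[0,T],\mathbb{P}_u\otimes\mu)$, $\xi_t\in\mathrm{Dom}(\nabla)$ for $t\in[0,T]$, and $(D_t\xi_t)_{t\in[0,T]}\in L^1(\Omega\times[0,T],\mathbb{P}_u\otimes\mu)$. Assume that $\Delta\sqrt F\leq0$ $\mathbb{P}$-a.s. and that $\Delta\sqrt F<0$ on a set of strictly positive $\mathbb{P}$-measure. Then $$\mathbb{E}_u\left[\|X+D\log F-u\|^2_{L^2([0,T],d\mu)}\right]<\mathrm{R}(\gamma,\mu,\hat u)=\mathbb{E}_u\left[\|X-u\|^2_{L^2([0,T],d\mu)}\right],$$ i.e. $X+D\log F$ has strictly smaller risk at $u$ than the estimator $\hat u=X$.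
   Context: Let $T>0$ and let $(X_t)_{t\in[0,T]}$ be a real centered Gaussian process with covariance $\gamma(s,t)=\mathbb{E}[X_sX_t]$ on $(\Omega,\mathcal F,\mathbb{P})$, $\mathcal F=\sigma(X)$; let $\mu$ be a finite Borel measure on $[0,T]$ with $\mathrm{R}(\gamma,\mu,\hat u):=\int_0^T\gamma(t,t)\mu(dt)<\infty$. $X$ is represented as an isonormal process $\{X(h):h\in H\}$, i.e. $\mathbb{E}[X(h)X(g)]=\langle h,g\rangle_H$, in one of two ways. (A) (Paley-Wiener) $H$ is the completion of the span of $\chi_t(s)=\min(s,t)$ for $\langle\chi_t,\chi_s\rangle_H=\gamma(s,t)$, $X(\chi_t)=X_t$; $\langle h,g\rangle=\langle\dot h,\dot g\rangle_{L^2([0,T],dt)}$, $\gamma(s,t)=\int_0^{s\wedge t}K(t,r)K(s,r)dr$, $(Kh)(t)=\int_0^tK(t,s)\dot h(s)ds$, $\Gamma=KK^*$ (adjoint for $\langle\cdot,\cdot\rangle$), $\langle h,g\rangle_H=\langle h,\Gamma g\rangle$. (B) (Karhunen-Loève) $\langle h,g\rangle=\langle h,g\rangle_{L^2([0,T],d\mu)}$, $(\Gamma g)(t)=\int_0^Tg(s)\gamma(s,t)\mu(ds)$, $\langle h,g\rangle_H=\langle h,\Gamma g\rangle$, $X(h)=\int_0^TX_sh(s)\mu(ds)$. In both cases $(\Gamma h)(t)=\mathbb{E}[X_tX(h)]$ for $h\in H$. For deterministic $u\in H$ (with $\Gamma^{-1}u\in H$), $\mathbb{P}_u$ is the probability with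 density $\exp\left(X(\Gamma^{-1}u)-\frac12\|\Gamma^{-1}u\|_H^2\right)$ with respect to $\mathbb{P}$. Under $\mathbb{P}_u$, $X^u:=X-u$ (i.e. $X^u_t=X_t-u(t)$, $X^u(g)=X(g)-\langle g,u\rangle$) has the law of $X$ under $\mathbb{P}$. $\mathbb{E}_u$ is expectation under $\mathbb{P}_u$, and $\hat u:=X$. Fix a total subset $(h_n)_{n\ge1}$ of $H$. $\mathcal S$ is the space of functionals $F=f_n(X^u(h_1),\dots,X^u(h_n))$ with $f_n$ smooth and rapidly decreasing on $\mathbb{R}^n$, and $\nabla_tF=\sum_{i=1}^nh_i(t)\,\partial_if_n(X^u(h_1),\dots,X^u(h_n))$. The operator $\nabla:L^2(\Omega,\mathbb{P}_u)\to L^2(\Omega,\mathbb{P}_u;H)$ is closable, with closed domain $\mathrm{Dom}(\nabla)$. For $F\in\mathrm{Dom}(\nabla)$, $D_tF:=(\Gamma\nabla F)(t)$, $t\in[0,T]$; $D_t\log F=D_tF/F$. The Laplacian is $\Delta F=\int_0^TD_tD_tF\,\mu(dt)$, with domain $\mathrm{Dom}(\Delta)$ consisting of all $F\in\mathrm{Dom}(\nabla)$ such that $D_tF\in\mathrm{Dom}(\nabla)$ for $t\in[0,T]$ and $(D_tD_tF)_{t\in[0,T]}\in L^2([0,T],\mu)$ $\mathbb{P}$-a.s. *)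

theory Defs
  imports "HOL-Probability.Probability"
begin

section \<open>Square integrable functions and Gaussian families\<close>

definition sq_integrable :: "'b measure \<Rightarrow> ('b \<Rightarrow> 'c::{banach, second_countable_topology}) \<Rightarrow> bool" where
  "sq_integrable N f \<longleftrightarrow> f \<in> borel_measurable N \<and> integrable N (\<lambda>x. (norm (f x))\<^sup>2)"

text \<open>The degenerate law (variance zero) counts as Gaussian.\<close>

definition centered_gaussian :: "'a measure \<Rightarrow> ('a \<Rightarrow> real) \<Rightarrow> bool" where
  "centered_gaussian M Y \<longleftrightarrow> Y \<in> borel_measurable M \<and>
     ((AE \<omega> in M. Y \<omega> = 0) \<or> (\<exists>\<sigma>>0. distributed M lborel Y (\<lambda>x. ennreal (normal_density 0 \<sigma> x))))"

definition centered_gaussian_family :: "'a measure \<Rightarrow> 'i set \<Rightarrow> ('i \<Rightarrow> 'a \<Rightarrow> real) \<Rightarrow> bool" where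
  "centered_gaussian_family M I Y \<longleftrightarrow>
     (\<forall>J c. finite J \<and> J \<subseteq> I \<longrightarrow> centered_gaussian M (\<lambda>\<omega>. \<Sum>j\<in>J. c j * Y j \<omega>))"

definition generated_sets :: "'a set \<Rightarrow> 'i set \<Rightarrow> ('i \<Rightarrow> 'a \<Rightarrow> real) \<Rightarrow> 'a set set" where
  "generated_sets \<Omega> I Y = sigma_sets \<Omega> {Y i -` A \<inter> \<Omega> | i A. i \<in> I \<and> A \<in> sets borel}"

definition covariance :: "'a measure \<Rightarrow> (real \<Rightarrow> 'a \<Rightarrow> real) \<Rightarrow> real \<Rightarrow> real \<Rightarrow> real" where
  "covariance M X s t = (\<integral>\<omega>. X s \<omega> * X t \<omega> \<partial>M)"


section \<open>Isonormal representations\<close>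

text \<open>The Hilbert space \<open>H\<close> is a type \<open>'h\<close>; in both representations below it is a completion,
  and it is pinned down up to isometry by a total family with prescribed inner products.\<close>

definition isonormal :: "'a measure \<Rightarrow> ('h::real_inner \<Rightarrow> 'a \<Rightarrow> real) \<Rightarrow> bool" where
  "isonormal M W \<longleftrightarrow> centered_gaussian_family M UNIV W \<and>
     (\<forall>h g. (\<integral>\<omega>. W h \<omega> * W g \<omega> \<partial>M) = inner h g)"

text \<open>\<open>(\<Gamma>h)(t) = E[X\<^sub>t X(h)]\<close>. This is the form of \<open>\<Gamma>\<close> common to both representations, and it
  makes sense pointwise in \<open>t\<close> on all of the completion \<open>H\<close>. The two descriptions of \<open>\<Gamma>\<close> by
  formulas appear in \<open>paley_wiener\<close> (where \<open>\<Gamma> = K K*\<close>) and \<open>karhunen_loeve\<close>.\<close>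

definition gam_op :: "'a measure \<Rightarrow> (real \<Rightarrow> 'a \<Rightarrow> real) \<Rightarrow> ('h \<Rightarrow> 'a \<Rightarrow> real) \<Rightarrow> 'h \<Rightarrow> real \<Rightarrow> real" where
  "gam_op M X W h t = (\<integral>\<omega>. X t \<omega> * W h \<omega> \<partial>M)"

text \<open>\<open>(Kh)(t)\<close>, as a function of the derivative \<open>d\<close> of \<open>h\<close>.\<close>

definition kernel_op :: "(real \<Rightarrow> real \<Rightarrow> real) \<Rightarrow> (real \<Rightarrow> real) \<Rightarrow> real \<Rightarrow> real" where
  "kernel_op K d t = (LINT s:{0..t}|lborel. K t s * d s)"

text \<open>\<open>Ks h\<close> is the derivative of \<open>K*h\<close>, for \<open>K*\<close> the adjoint of \<open>K\<close> with respect to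
  \<open>\<langle>h, g\<rangle> = \<langle>h', g'\<rangle>\<close> in \<open>L\<^sup>2([0,T],dt)\<close>, extended to the completion \<open>H\<close> by
  \<open>\<langle>h, g\<rangle>\<^sub>H = \<langle>h, K K* g\<rangle> = \<langle>K* h, K* g\<rangle>\<close>. Since the derivative of \<open>\<chi>\<^sub>t\<close> is the indicator of \<open>[0,t]\<close>,
  we have \<open>\<langle>\<chi>\<^sub>t, Kg\<rangle> = (Kg)(t)\<close>, so the adjoint identity on the generators is
  \<open>\<langle>K* \<chi>\<^sub>t, g\<rangle> = (Kg)(t)\<close>.\<close>

definition kernel_adjoint ::
  "real \<Rightarrow> (real \<Rightarrow> real \<Rightarrow> real) \<Rightarrow> (real \<Rightarrow> 'h::real_inner) \<Rightarrow> ('h \<Rightarrow> real \<Rightarrow> real) \<Rightarrow> bool" where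
  "kernel_adjoint T K chi Ks \<longleftrightarrow>
     (\<forall>h. sq_integrable (restrict_space lborel {0..T}) (Ks h)) \<and>
     (\<forall>h g. inner h g = (LINT r:{0..T}|lborel. Ks h r * Ks g r)) \<and>
     (\<forall>t\<in>{0..T}. \<forall>d. sq_integrable (restrict_space lborel {0..T}) d \<longrightarrow>
        (LINT r:{0..T}|lborel. Ks (chi t) r * d r) = kernel_op K d t)"

text \<open>\<open>chi t\<close> is the element of \<open>H\<close> given by the function \<open>\<chi>\<^sub>t(s) = min s t\<close>.\<close>

definition paley_wiener ::
  "'a measure \<Rightarrow> real \<Rightarrow> (real \<Rightarrow> 'a \<Rightarrow> real) \<Rightarrow> ('h::real_inner \<Rightarrow> 'a \<Rightarrow> real) \<Rightarrow>
   (real \<Rightarrow> real \<Rightarrow> real) \<Rightarrow> (real \<Rightarrow> 'h) \<Rightarrow> bool" where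
  "paley_wiener M T X W K chi \<longleftrightarrow>
     (\<forall>s\<in>{0..T}. \<forall>t\<in>{0..T}. inner (chi t) (chi s) = covariance M X s t) \<and>
     closure (span (chi ` {0..T})) = UNIV \<and>
     (\<forall>t\<in>{0..T}. AE \<omega> in M. W (chi t) \<omega> = X t \<omega>) \<and>
     (\<forall>t\<in>{0..T}. sq_integrable (restrict_space lborel {0..t}) (K t)) \<and>
     (\<forall>s\<in>{0..T}. \<forall>t\<in>{0..T}.
        covariance M X s t = (LINT r:{0..min s t}|lborel. K t r * K s r)) \<and>
     (\<exists>Ks. kernel_adjoint T K chi Ks \<and>
        (\<forall>h. \<forall>t\<in>{0..T}. gam_op M X W h t = kernel_op K (Ks h) t))"

text \<open>A function \<open>w\<close> with derivative \<open>d\<close> in \<open>L\<^sup>2([0,T],dt)\<close> is the element \<open>h\<close> of the completion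
  if some linear combinations of the \<open>\<chi>\<^sub>t\<close> converge both to \<open>w\<close> in the norm of
  \<open>\<langle>h, g\<rangle> = \<langle>h', g'\<rangle>\<close> and to \<open>h\<close> in \<open>H\<close>.\<close>

definition pw_element :: "real \<Rightarrow> (real \<Rightarrow> 'h::real_inner) \<Rightarrow> (real \<Rightarrow> real) \<Rightarrow> 'h \<Rightarrow> bool" where
  "pw_element T chi w h \<longleftrightarrow>
     (\<exists>d. sq_integrable (restrict_space lborel {0..T}) d \<and>
        (\<forall>t\<in>{0..T}. w t = (LINT s:{0..t}|lborel. d s)) \<and>
        (\<exists>(n :: nat \<Rightarrow> nat) c \<tau>. (\<forall>k i. \<tau> k i \<in> {0..T}) \<and>
           (\<lambda>k. LINT s:{0..T}|lborel. ((\<Sum>i<n k. c k i * indicator {0..\<tau> k i} s) - d s)\<^sup>2)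
             \<longlonglongrightarrow> 0 \<and>
           (\<lambda>k. \<Sum>i<n k. c k i *\<^sub>R chi (\<tau> k i)) \<longlonglongrightarrow> h))"

text \<open>\<open>J\<close> is the canonical map of \<open>L\<^sup>2([0,T],d\<mu>)\<close> into its completion \<open>H\<close>.\<close>

definition karhunen_loeve ::
  "'a measure \<Rightarrow> (real \<Rightarrow> 'a \<Rightarrow> real) \<Rightarrow> ('h::real_inner \<Rightarrow> 'a \<Rightarrow> real) \<Rightarrow> real measure \<Rightarrow>
   ((real \<Rightarrow> real) \<Rightarrow> 'h) \<Rightarrow> bool" where
  "karhunen_loeve M X W \<mu> J \<longleftrightarrow>
     closure (J ` {f. sq_integrable \<mu> f}) = UNIV \<and>
     (\<forall>g. sq_integrable \<mu> g \<longrightarrow>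
        (\<forall>t\<in>space \<mu>. gam_op M X W (J g) t = (\<integral>s. g s * covariance M X s t \<partial>\<mu>))) \<and>
     (\<forall>f g. sq_integrable \<mu> f \<and> sq_integrable \<mu> g \<longrightarrow>
        inner (J f) (J g) = (\<integral>t. f t * gam_op M X W (J g) t \<partial>\<mu>)) \<and>
     (\<forall>f. sq_integrable \<mu> f \<longrightarrow> (AE \<omega> in M. W (J f) \<omega> = (\<integral>s. X s \<omega> * f s \<partial>\<mu>)))"

text \<open>\<open>v\<close> stands for \<open>\<Gamma>\<^sup>-\<^sup>1u\<close>; note \<open>\<langle>g, u\<rangle> = \<langle>g, \<Gamma>v\<rangle> = \<langle>g, v\<rangle>\<^sub>H\<close>.\<close>

definition shifted_measure :: "'a measure \<Rightarrow> ('h::real_inner \<Rightarrow> 'a \<Rightarrow> real) \<Rightarrow> 'h \<Rightarrow> 'a measure" where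
  "shifted_measure M W v = density M (\<lambda>\<omega>. ennreal (exp (W v \<omega> - (norm v)\<^sup>2 / 2)))"

definition shifted_process :: "('h::real_inner \<Rightarrow> 'a \<Rightarrow> real) \<Rightarrow> 'h \<Rightarrow> 'h \<Rightarrow> 'a \<Rightarrow> real" where
  "shifted_process W v g \<omega> = W g \<omega> - inner g v"


section \<open>Smooth rapidly decreasing functions of finitely many variables\<close>

text \<open>A function on \<open>R\<^sup>n\<close> is a function of a real sequence that depends on the coordinates
  below \<open>n\<close> only.\<close>

definition pderivative :: "nat \<Rightarrow> ((nat \<Rightarrow> real) \<Rightarrow> real) \<Rightarrow> (nat \<Rightarrow> real) \<Rightarrow> real" where
  "pderivative i f x = deriv (\<lambda>r. f (x(i := r))) (x i)"

definition schwartz :: "nat \<Rightarrow> ((nat \<Rightarrow> real) \<Rightarrow> real) \<Rightarrow> bool" where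
  "schwartz n f \<longleftrightarrow>
     (\<forall>x y. (\<forall>i<n. x i = y i) \<longrightarrow> f x = f y) \<and>
     (\<forall>is. set is \<subseteq> {..<n} \<longrightarrow>
        continuous_on UNIV (foldr pderivative is f) \<and>
        (\<forall>i<n. \<forall>x. (\<lambda>r. foldr pderivative is f (x(i := r))) field_differentiable (at (x i))) \<and>
        (\<forall>m::nat. bounded (range (\<lambda>x. (1 + (\<Sum>i<n. (x i)\<^sup>2)) ^ m * foldr pderivative is f x))))"


section \<open>Gradient, derivative and Laplacian\<close>

text \<open>\<open>is_grad P Y h F G\<close>: the pair \<open>(F, G)\<close> lies in the closure, in \<open>L\<^sup>2(P) \<times> L\<^sup>2(P;H)\<close>, of the graph
  of the gradient on the functionals \<open>f(Y(h\<^sub>0), \<dots>, Y(h\<^bsub>n-1\<^esub>))\<close>.\<close>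

definition is_grad ::
  "'a measure \<Rightarrow> ('h::{real_inner, banach, second_countable_topology} \<Rightarrow> 'a \<Rightarrow> real) \<Rightarrow>
   (nat \<Rightarrow> 'h) \<Rightarrow> ('a \<Rightarrow> real) \<Rightarrow> ('a \<Rightarrow> 'h) \<Rightarrow> bool" where
  "is_grad P Y h F G \<longleftrightarrow> sq_integrable P F \<and> sq_integrable P G \<and>
     (\<exists>n f. (\<forall>k. 1 \<le> n k \<and> schwartz (n k) (f k)) \<and>
        (\<lambda>k::nat. \<integral>\<^sup>+\<omega>. ennreal ((f k (\<lambda>i. Y (h i) \<omega>) - F \<omega>)\<^sup>2) \<partial>P) \<longlonglongrightarrow> 0 \<and>
        (\<lambda>k::nat. \<integral>\<^sup>+\<omega>. ennreal ((norm
            ((\<Sum>i<n k. pderivative i (f k) (\<lambda>j. Y (h j) \<omega>) *\<^sub>R h i) - G \<omega>))\<^sup>2) \<partial>P) \<longlonglongrightarrow> 0)"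

definition Dom_grad ::
  "'a measure \<Rightarrow> ('h::{real_inner, banach, second_countable_topology} \<Rightarrow> 'a \<Rightarrow> real) \<Rightarrow>
   (nat \<Rightarrow> 'h) \<Rightarrow> ('a \<Rightarrow> real) set" where
  "Dom_grad P Y h = {F. \<exists>G. is_grad P Y h F G}"

definition grad ::
  "'a measure \<Rightarrow> ('h::{real_inner, banach, second_countable_topology} \<Rightarrow> 'a \<Rightarrow> real) \<Rightarrow>
   (nat \<Rightarrow> 'h) \<Rightarrow> ('a \<Rightarrow> real) \<Rightarrow> 'a \<Rightarrow> 'h" where
  "grad P Y h F = (SOME G. is_grad P Y h F G)"

definition mderiv ::
  "'a measure \<Rightarrow> ('h::{real_inner, banach, second_countable_topology} \<Rightarrow> 'a \<Rightarrow> real) \<Rightarrow>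
   (nat \<Rightarrow> 'h) \<Rightarrow> ('h \<Rightarrow> real \<Rightarrow> real) \<Rightarrow> ('a \<Rightarrow> real) \<Rightarrow> real \<Rightarrow> 'a \<Rightarrow> real" where
  "mderiv P Y h \<Gamma> F t \<omega> = \<Gamma> (grad P Y h F \<omega>) t"

text \<open>Processes such as \<open>D\<^sub>tD\<^sub>tF\<close> are determined only up to a null set for each fixed \<open>t\<close>. Statements
  about their joint behaviour in \<open>(\<omega>, t)\<close> refer to a jointly measurable version; two such versions
  agree almost everywhere for \<open>P \<otimes> \<mu>\<close>.\<close>

definition is_version ::
  "'a measure \<Rightarrow> real measure \<Rightarrow> (real \<Rightarrow> 'a \<Rightarrow> real) \<Rightarrow> (real \<Rightarrow> 'a \<Rightarrow> real) \<Rightarrow> bool" where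
  "is_version P \<mu> Z V \<longleftrightarrow> (\<lambda>(\<omega>, t). V t \<omega>) \<in> borel_measurable (P \<Otimes>\<^sub>M \<mu>) \<and>
     (\<forall>t\<in>space \<mu>. AE \<omega> in P. V t \<omega> = Z t \<omega>)"

definition process_L1 :: "'a measure \<Rightarrow> real measure \<Rightarrow> (real \<Rightarrow> 'a \<Rightarrow> real) \<Rightarrow> bool" where
  "process_L1 P \<mu> Z \<longleftrightarrow>
     (\<exists>V. is_version P \<mu> Z V \<and> integrable (P \<Otimes>\<^sub>M \<mu>) (\<lambda>(\<omega>, t). V t \<omega>))"

definition Dom_laplacian ::
  "'a measure \<Rightarrow> ('h::{real_inner, banach, second_countable_topology} \<Rightarrow> 'a \<Rightarrow> real) \<Rightarrow>
   (nat \<Rightarrow> 'h) \<Rightarrow> ('h \<Rightarrow> real \<Rightarrow> real) \<Rightarrow> real measure \<Rightarrow> ('a \<Rightarrow> real) set" where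
  "Dom_laplacian P Y h \<Gamma> \<mu> = {F \<in> Dom_grad P Y h.
     (\<forall>t\<in>space \<mu>. mderiv P Y h \<Gamma> F t \<in> Dom_grad P Y h) \<and>
     (\<exists>V. is_version P \<mu> (\<lambda>t. mderiv P Y h \<Gamma> (mderiv P Y h \<Gamma> F t) t) V \<and>
        (AE \<omega> in P. sq_integrable \<mu> (\<lambda>t. V t \<omega>)))}"

definition laplacian ::
  "'a measure \<Rightarrow> ('h::{real_inner, banach, second_countable_topology} \<Rightarrow> 'a \<Rightarrow> real) \<Rightarrow>
   (nat \<Rightarrow> 'h) \<Rightarrow> ('h \<Rightarrow> real \<Rightarrow> real) \<Rightarrow> real measure \<Rightarrow> ('a \<Rightarrow> real) \<Rightarrow> 'a \<Rightarrow> real" where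
  "laplacian P Y h \<Gamma> \<mu> F \<omega> =
     (\<integral>t. (SOME V. is_version P \<mu> (\<lambda>t. mderiv P Y h \<Gamma> (mderiv P Y h \<Gamma> F t) t) V) t \<omega> \<partial>\<mu>)"

definition risk ::
  "'a measure \<Rightarrow> real measure \<Rightarrow> (real \<Rightarrow> 'a \<Rightarrow> real) \<Rightarrow> (real \<Rightarrow> real) \<Rightarrow> ennreal" where
  "risk P \<mu> Z u = (\<integral>\<^sup>+\<omega>. (\<integral>\<^sup>+t. ennreal ((Z t \<omega> - u t)\<^sup>2) \<partial>\<mu>) \<partial>P)"

end

theory Submission
  imports Defs
begin

text \<open>Write \<open>b\<^sub>t = X\<^sub>t - u(t)\<close>. Expanding the square, the risk of \<open>X + \<xi>\<close> exceeds the risk of \<open>X\<close> by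
\<open>2 E\<^sub>u \<integral> b\<^sub>t \<xi>\<^sub>t \<mu>(dt) + E\<^sub>u \<integral> \<xi>\<^sub>t\<^sup>2 \<mu>(dt)\<close>. Under \<open>P\<^sub>u\<close> the shifted field \<open>X\<^sub>u\<close> is again isonormal (Cameron and
Martin, \<open>shifted_gauss_field\<close>), and for almost every \<open>t\<close> the variable \<open>b\<^sub>t\<close> is \<open>X\<^sub>u g\<close> for some
\<open>g\<close> in the Hilbert space with \<open>\<langle>g, k\<rangle> = (\<Gamma>k)(t)\<close>; so Gaussian integration by parts (\<open>sobolev_ibp\<close>) gives
\<open>E\<^sub>u[b\<^sub>t \<xi>\<^sub>t] = E\<^sub>u[D\<^sub>t\<xi>\<^sub>t]\<close>. The excess is therefore \<open>E\<^sub>u \<integral> (2 D\<^sub>t\<xi>\<^sub>t + \<xi>\<^sub>t\<^sup>2) \<mu>(dt)\<close>. With \<open>S = sqrt F\<close> the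
process \<open>\<xi>\<^sub>t\<close> is \<open>2 D\<^sub>tS / S\<close>, and calculus turns the integrand into \<open>4 D\<^sub>tD\<^sub>tS / S\<close>
(\<open>log_derivative_sqrt_identity\<close>). Integrating in \<open>t\<close> first, the excess is \<open>4 E\<^sub>u[\<Delta>S / S]\<close>, which is
negative because \<open>\<Delta>S \<le> 0\<close> with strict inequality on a set of positive probability.

The gradient is known only as an \<open>L\<^sup>2\<close> closure, and quotients of elements of its domain need not be
in the domain. One rule of calculus suffices, \<open>sobolev_product_rule\<close>: if \<open>A\<close>, \<open>B\<close> and \<open>C\<close>
all lie in the domain and \<open>l C = A B\<close>, then \<open>l \<nabla>C = A \<nabla>B + B \<nabla>A\<close>. Applied to \<open>S S = F\<close> and
\<open>\<xi>\<^sub>t S = 2 D\<^sub>tS\<close> it yields the identity above. Both sides of the rule agree when integrated against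
damped trigonometric functions of the coordinates \<open>X\<^sub>u(h\<^sub>j)\<close>, and they are functions of these coordinates;
a weight all of whose trigonometric moments vanish is zero (\<open>weight_eq_0_AE\<close>, from Levy's uniqueness
theorem).

Integration by parts and the Cameron-Martin shift both reduce to one-dimensional normal integrals, since
\<open>Y g\<close> is independent of all \<open>Y k\<close> with \<open>k\<close> orthogonal to \<open>g\<close> (\<open>indep_orthogonal\<close>).

In the Karhunen-Loeve representation the Gaussian space consists of limits of the integrals
\<open>\<integral> X\<^sub>s f(s) \<mu>(ds)\<close>, and the variables \<open>X\<^sub>t\<close> belong to it only for almost every \<open>t\<close>
(\<open>measurable_process_in_range\<close>).\<close>

section \<open>Functions with vanishing trigonometric moments\<close>

lemma integrable_mult_le_1:
  fixes z f :: "'a \<Rightarrow> real"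
  assumes "integrable M z" "f \<in> borel_measurable M" "\<And>x. \<bar>f x\<bar> \<le> 1"
  shows "integrable M (\<lambda>x. z x * f x)"
  by (rule Bochner_Integration.integrable_bound[OF assms(1)])
     (use assms in \<open>auto intro!: AE_I2 mult_left_le simp: abs_mult\<close>)

text \<open>The positive and the negative part of \<open>z\<close>, normalized to probability densities, give \<open>Y\<close> two laws
  with the same characteristic function.\<close>

lemma weighted_trig_moments_unique:
  fixes z Y :: "'a \<Rightarrow> real"
  assumes z: "integrable M z" and Y[measurable]: "Y \<in> borel_measurable M"
    and C: "\<And>c. (\<integral>x. z x * cos (c * Y x) \<partial>M) = 0"
    and S: "\<And>c. (\<integral>x. z x * sin (c * Y x) \<partial>M) = 0"
    and B[measurable]: "B \<in> sets borel"
  shows "(\<integral>x. z x * indicator B (Y x) \<partial>M) = 0"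
proof -
  have [measurable]: "z \<in> borel_measurable M" using z by auto
  define p where "p x = max 0 (z x)" for x
  define q where "q x = max 0 (- z x)" for x
  have [measurable]: "p \<in> borel_measurable M" "q \<in> borel_measurable M"
    unfolding p_def q_def by measurable
  have zpq: "z x = p x - q x" and p0: "0 \<le> p x" and q0: "0 \<le> q x" for x
    by (auto simp: p_def q_def)
  have ip: "integrable M p" and iq: "integrable M q"
    by (auto intro!: Bochner_Integration.integrable_bound[OF z] simp: p_def q_def)
  define m where "m = (\<integral>x. p x \<partial>M)"
  have eq0: "(\<integral>x. p x \<partial>M) = (\<integral>x. q x \<partial>M)"
    using C[of 0] ip iq by (simp add: zpq)
  have ib: "integrable M (\<lambda>x. r x *\<^sub>R f x)" if "integrable M r" "f \<in> borel_measurable M" "\<And>x. norm (f x) \<le> 1"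
    for r :: "'a \<Rightarrow> real" and f :: "'a \<Rightarrow> 'b::{banach,second_countable_topology}"
    by (rule Bochner_Integration.integrable_bound[OF that(1)])
       (use that in \<open>auto intro!: AE_I2 mult_left_le\<close>)
  have ind: "norm (indicator B (Y x) :: real) \<le> 1" for x by (simp add: indicator_def)
  show ?thesis
  proof (cases "m = 0")
    case True
    have "AE x in M. p x = 0" "AE x in M. q x = 0"
      using integral_nonneg_eq_0_iff_AE[OF ip] integral_nonneg_eq_0_iff_AE[OF iq] True eq0 p0 q0
      by (auto simp: m_def)
    then have "AE x in M. z x * indicator B (Y x) = 0" by eventually_elim (simp add: zpq)
    then show ?thesis by (rule integral_eq_zero_AE)
  next
    case False
    have m: "m > 0" using False p0 by (simp add: m_def integral_nonneg order.not_eq_order_implies_strict)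
    define law where "law r = distr (density M (\<lambda>x. ennreal (r x / m))) borel Y" for r :: "'a \<Rightarrow> real"
    have law: "real_distribution (law r)"
       "char (law r) c = (\<integral>x. (r x / m) *\<^sub>R iexp (c * Y x) \<partial>M)"
       "measure (law r) B = (\<integral>x. r x * indicator B (Y x) \<partial>M) / m"
      if r[measurable]: "r \<in> borel_measurable M" "integrable M r" "\<And>x. 0 \<le> r x" "(\<integral>x. r x \<partial>M) = m" for r c
    proof -
      have "emeasure (density M (\<lambda>x. ennreal (r x / m))) (space M) = (\<integral>\<^sup>+x. ennreal (r x / m) \<partial>M)"
        by (subst emeasure_density) (auto intro!: nn_integral_cong)
      also have "\<dots> = ennreal (\<integral>x. r x / m \<partial>M)"
        using r m by (intro nn_integral_eq_integral) auto
      also have "\<dots> = 1" using r m by simp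
      finally interpret D: prob_space "density M (\<lambda>x. ennreal (r x / m))" by (intro prob_spaceI) simp
      show "real_distribution (law r)" unfolding law_def by (rule D.real_distribution_distr) simp
      show "char (law r) c = (\<integral>x. (r x / m) *\<^sub>R iexp (c * Y x) \<partial>M)"
        unfolding char_def law_def using r m by (subst integral_distr) (simp_all add: integral_density)
      have "measure (law r) B = (\<integral>x. indicator B x \<partial>law r)" by (simp add: law_def)
      also have "\<dots> = (\<integral>x. (r x / m) *\<^sub>R indicator B (Y x) \<partial>M)"
        unfolding law_def using r m by (subst integral_distr) (simp_all add: integral_density)
      finally show "measure (law r) B = (\<integral>x. r x * indicator B (Y x) \<partial>M) / m" by simp
    qed
    have ie: "integrable M (\<lambda>x. r x *\<^sub>R iexp (c * Y x))" if "integrable M r" for r c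
      by (rule ib[OF that]) auto
    have "(\<integral>x. z x *\<^sub>R iexp (c * Y x) \<partial>M) = 0" for c
    proof (rule complex_eqI)
      show "Re (\<integral>x. z x *\<^sub>R iexp (c * Y x) \<partial>M) = Re 0"
        using integral_Re[OF ie[OF z, of c]] C[of c] by (simp add: Re_exp)
      show "Im (\<integral>x. z x *\<^sub>R iexp (c * Y x) \<partial>M) = Im 0"
        using integral_Im[OF ie[OF z, of c]] S[of c] by (simp add: Im_exp)
    qed
    moreover have "(\<integral>x. z x *\<^sub>R iexp (c * Y x) \<partial>M) =
        (\<integral>x. p x *\<^sub>R iexp (c * Y x) \<partial>M) - (\<integral>x. q x *\<^sub>R iexp (c * Y x) \<partial>M)" for c
      using ie[OF ip, of c] ie[OF iq, of c] by (simp add: zpq scaleR_diff_left)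
    ultimately have pq: "(\<integral>x. p x *\<^sub>R iexp (c * Y x) \<partial>M) = (\<integral>x. q x *\<^sub>R iexp (c * Y x) \<partial>M)" for c
      by simp
    have div: "(\<integral>x. (r x / m) *\<^sub>R iexp (c * Y x) \<partial>M) = (1/m) *\<^sub>R (\<integral>x. r x *\<^sub>R iexp (c * Y x) \<partial>M)" for r c
      by (subst integral_scaleR_right[symmetric]) (simp add: field_simps)
    have "char (law p) = char (law q)"
    proof
      fix c
      have "char (law p) c = (\<integral>x. (p x / m) *\<^sub>R iexp (c * Y x) \<partial>M)"
        using ip p0 by (intro law(2)) (auto simp: m_def)
      moreover have "char (law q) c = (\<integral>x. (q x / m) *\<^sub>R iexp (c * Y x) \<partial>M)"
        using iq q0 eq0 by (intro law(2)) (auto simp: m_def)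
      ultimately show "char (law p) c = char (law q) c" by (simp only: div pq)
    qed
    then have "law p = law q"
      using law(1)[of p] law(1)[of q] ip iq p0 q0 eq0 by (intro Levy_uniqueness) (auto simp: m_def)
    then have "(\<integral>x. p x * indicator B (Y x) \<partial>M) = (\<integral>x. q x * indicator B (Y x) \<partial>M)"
      using law(3)[of p] law(3)[of q] ip iq p0 q0 eq0 m by (simp add: m_def[symmetric])
    moreover have "(\<integral>x. z x * indicator B (Y x) \<partial>M) =
        (\<integral>x. p x * indicator B (Y x) \<partial>M) - (\<integral>x. q x * indicator B (Y x) \<partial>M)"
      using ib[OF ip, of "\<lambda>x. indicator B (Y x)::real"] ib[OF iq, of "\<lambda>x. indicator B (Y x)::real"] ind
      by (subst Bochner_Integration.integral_diff[symmetric]) (simp_all add: zpq left_diff_distrib)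
    ultimately show ?thesis by simp
  qed
qed

text \<open>One coordinate is treated at a time: for a frozen phase of the remaining ones, the weights
  \<open>z cos\<close> and \<open>z sin\<close> satisfy the one-dimensional hypothesis, so the trigonometric factor in the last
  coordinate may be exchanged for an indicator.\<close>

lemma weighted_trig_moments_cylinder:
  fixes z :: "'a \<Rightarrow> real" and R :: "nat \<Rightarrow> 'a \<Rightarrow> real"
  assumes "integrable M z" and R[measurable]: "\<And>j. R j \<in> borel_measurable M"
    and "\<And>c. (\<integral>x. z x * cos (\<Sum>j<n. c j * R j x) \<partial>M) = 0"
    and "\<And>c. (\<integral>x. z x * sin (\<Sum>j<n. c j * R j x) \<partial>M) = 0"
    and B[measurable]: "\<And>j. B j \<in> sets borel"
  shows "(\<integral>x. z x * (\<Prod>j<n. indicator (B j) (R j x)) \<partial>M) = 0"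
  using assms(1,3,4)
proof (induction n arbitrary: z)
  case 0
  from "0.prems"(2)[of "\<lambda>_. 0"] show ?case by simp
next
  case (Suc n)
  have [measurable]: "z \<in> borel_measurable M" using Suc.prems by auto
  note ib = integrable_mult_le_1[OF Suc.prems(1)]
  have ab: "\<bar>cos a * cos b\<bar> \<le> 1" "\<bar>cos a * sin b\<bar> \<le> 1" "\<bar>sin a * cos b\<bar> \<le> 1" "\<bar>sin a * sin b\<bar> \<le> 1"
    for a b :: real
    by (auto simp: abs_mult intro!: mult_le_one)
  define \<theta> where "\<theta> c x = (\<Sum>j<n. c j * R j x)" for c x
  have [measurable]: "\<theta> c \<in> borel_measurable M" for c unfolding \<theta>_def by measurable
  have iz: "integrable M (\<lambda>x. z x * cos (\<theta> c x))" "integrable M (\<lambda>x. z x * sin (\<theta> c x))" for c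
    by (auto intro!: ib)
  have i1: "integrable M (\<lambda>x. z x * (cos (\<theta> c x) * cos (s * R n x)))"
    "integrable M (\<lambda>x. z x * (cos (\<theta> c x) * sin (s * R n x)))"
    "integrable M (\<lambda>x. z x * (sin (\<theta> c x) * cos (s * R n x)))"
    "integrable M (\<lambda>x. z x * (sin (\<theta> c x) * sin (s * R n x)))" for c s
    by (auto intro!: ib ab)
  have tot: "(\<integral>x. z x * cos (\<theta> c x + s * R n x) \<partial>M) = 0" "(\<integral>x. z x * sin (\<theta> c x + s * R n x) \<partial>M) = 0"
    "(\<integral>x. z x * cos (- \<theta> c x + s * R n x) \<partial>M) = 0" "(\<integral>x. z x * sin (- \<theta> c x + s * R n x) \<partial>M) = 0" for c s
    using Suc.prems(2)[of "c(n := s)"] Suc.prems(3)[of "c(n := s)"]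
      Suc.prems(2)[of "(\<lambda>j. - c j)(n := s)"] Suc.prems(3)[of "(\<lambda>j. - c j)(n := s)"]
    by (simp_all add: \<theta>_def sum_negf)
  \<comment> \<open>Splitting the phase of the first coordinates off gives two weights to which the
    one-dimensional uniqueness applies.\<close>
  have sep: "(\<integral>x. z x * cos (\<theta> c x) * cos (s * R n x) \<partial>M) = 0"
       "(\<integral>x. z x * cos (\<theta> c x) * sin (s * R n x) \<partial>M) = 0"
       "(\<integral>x. z x * sin (\<theta> c x) * cos (s * R n x) \<partial>M) = 0"
       "(\<integral>x. z x * sin (\<theta> c x) * sin (s * R n x) \<partial>M) = 0" for c s
  proof -
    have "(\<integral>x. z x * (cos (\<theta> c x) * cos (s * R n x)) \<partial>M) - (\<integral>x. z x * (sin (\<theta> c x) * sin (s * R n x)) \<partial>M) = 0"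
      "(\<integral>x. z x * (cos (\<theta> c x) * cos (s * R n x)) \<partial>M) + (\<integral>x. z x * (sin (\<theta> c x) * sin (s * R n x)) \<partial>M) = 0"
      "(\<integral>x. z x * (sin (\<theta> c x) * cos (s * R n x)) \<partial>M) + (\<integral>x. z x * (cos (\<theta> c x) * sin (s * R n x)) \<partial>M) = 0"
      "(\<integral>x. z x * (cos (\<theta> c x) * sin (s * R n x)) \<partial>M) - (\<integral>x. z x * (sin (\<theta> c x) * cos (s * R n x)) \<partial>M) = 0"
    proof -
      have e: "z x * cos (\<theta> c x + s * R n x) = z x * (cos (\<theta> c x) * cos (s * R n x)) - z x * (sin (\<theta> c x) * sin (s * R n x))"
        "z x * cos (- \<theta> c x + s * R n x) = z x * (cos (\<theta> c x) * cos (s * R n x)) + z x * (sin (\<theta> c x) * sin (s * R n x))"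
        "z x * sin (\<theta> c x + s * R n x) = z x * (sin (\<theta> c x) * cos (s * R n x)) + z x * (cos (\<theta> c x) * sin (s * R n x))"
        "z x * sin (- \<theta> c x + s * R n x) = z x * (cos (\<theta> c x) * sin (s * R n x)) - z x * (sin (\<theta> c x) * cos (s * R n x))" for x
        by (simp_all only: cos_add sin_add cos_minus sin_minus) (simp_all add: algebra_simps)
      show "(\<integral>x. z x * (cos (\<theta> c x) * cos (s * R n x)) \<partial>M) - (\<integral>x. z x * (sin (\<theta> c x) * sin (s * R n x)) \<partial>M) = 0"
        "(\<integral>x. z x * (cos (\<theta> c x) * cos (s * R n x)) \<partial>M) + (\<integral>x. z x * (sin (\<theta> c x) * sin (s * R n x)) \<partial>M) = 0"
        "(\<integral>x. z x * (sin (\<theta> c x) * cos (s * R n x)) \<partial>M) + (\<integral>x. z x * (cos (\<theta> c x) * sin (s * R n x)) \<partial>M) = 0"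
        "(\<integral>x. z x * (cos (\<theta> c x) * sin (s * R n x)) \<partial>M) - (\<integral>x. z x * (sin (\<theta> c x) * cos (s * R n x)) \<partial>M) = 0"
        using tot[of c s] i1[of c s] by (simp_all only: e Bochner_Integration.integral_diff Bochner_Integration.integral_add)
    qed
    then show "(\<integral>x. z x * cos (\<theta> c x) * cos (s * R n x) \<partial>M) = 0"
       "(\<integral>x. z x * cos (\<theta> c x) * sin (s * R n x) \<partial>M) = 0"
       "(\<integral>x. z x * sin (\<theta> c x) * cos (s * R n x) \<partial>M) = 0"
       "(\<integral>x. z x * sin (\<theta> c x) * sin (s * R n x) \<partial>M) = 0"
      by (simp_all add: mult.assoc)
  qed
  have z1: "(\<integral>x. z x * cos (\<theta> c x) * indicator (B n) (R n x) \<partial>M) = 0"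
       "(\<integral>x. z x * sin (\<theta> c x) * indicator (B n) (R n x) \<partial>M) = 0" for c
    using sep[of c] iz[of c] by (auto intro!: weighted_trig_moments_unique)
  have "(\<integral>x. z x * indicator (B n) (R n x) * (\<Prod>j<n. indicator (B j) (R j x)) \<partial>M) = 0"
  proof (rule Suc.IH)
    show "integrable M (\<lambda>x. z x * indicator (B n) (R n x))" by (intro ib) (auto simp: indicator_def)
    show "(\<integral>x. z x * indicator (B n) (R n x) * cos (\<Sum>j<n. c j * R j x) \<partial>M) = 0" for c
      using z1(1)[of c] by (simp add: \<theta>_def mult_ac)
    show "(\<integral>x. z x * indicator (B n) (R n x) * sin (\<Sum>j<n. c j * R j x) \<partial>M) = 0" for c
      using z1(2)[of c] by (simp add: \<theta>_def mult_ac)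
  qed
  then show ?case by (simp add: mult_ac)
qed

lemma weighted_trig_moments_vanish:
  fixes z :: "'a \<Rightarrow> real" and R :: "'a \<Rightarrow> nat \<Rightarrow> real"
  assumes z: "integrable M z" and R[measurable]: "R \<in> borel_measurable M"
    and C: "\<And>n c. (\<integral>x. z x * cos (\<Sum>j<n. c j * R x j) \<partial>M) = 0"
    and S: "\<And>n c. (\<integral>x. z x * sin (\<Sum>j<n. c j * R x j) \<partial>M) = 0"
    and "A \<in> sets borel"
  shows "(\<integral>x. z x * indicator A (R x) \<partial>M) = 0"
proof -
  have [measurable]: "z \<in> borel_measurable M" using z by auto
  have Rj[measurable]: "(\<lambda>x. R x j) \<in> borel_measurable M" for j
    using measurable_product_coordinates[of j] R by (rule measurable_compose[rotated])
  note ib = integrable_mult_le_1[OF z]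
  let ?G = "prod_algebra (UNIV::nat set) (\<lambda>_. borel :: real measure)"
  have bor: "sets (borel :: (nat \<Rightarrow> real) measure) = sigma_sets UNIV ?G"
    using sets_PiM_equal_borel[where ?'a=nat and ?'b=real] sets_PiM[of UNIV "\<lambda>_::nat. borel::real measure"]
    by (simp add: PiE_UNIV_domain)
  have "Int_stable ?G" by (rule Int_stable_prod_algebra)
  moreover have "?G \<subseteq> Pow UNIV" by simp
  moreover have "A \<in> sigma_sets UNIV ?G" using assms(5) bor by simp
  ultimately show ?thesis
  proof (induction A rule: sigma_sets_induct_disjoint)
    case (basic A)
    then obtain J E where A: "A = prod_emb UNIV (\<lambda>_. borel) J (Pi\<^sub>E J E)" "finite J"
       "\<And>i. i \<in> J \<Longrightarrow> E i \<in> sets borel"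
      by (auto elim!: prod_algebraE)
    obtain n where n: "J \<subseteq> {..<n}" using A(2) finite_nat_bounded by auto
    define B where "B j = (if j \<in> J then E j else UNIV)" for j
    have B: "B j \<in> sets borel" for j using A(3) by (simp add: B_def)
    have mem: "R x \<in> A \<longleftrightarrow> (\<forall>j<n. R x j \<in> B j)" for x
      using n unfolding A(1) B_def prod_emb_def by (auto simp: PiE_iff)
    have "(\<integral>x. z x * indicator A (R x) \<partial>M) = (\<integral>x. z x * (\<Prod>j<n. indicator (B j) (R x j)) \<partial>M)"
    proof (rule Bochner_Integration.integral_cong)
      fix x
      have "indicator A (R x) = (\<Prod>j<n. indicator (B j) (R x j) :: real)"
      proof (cases "R x \<in> A")
        case True with mem show ?thesis by simp
      next
        case False with mem obtain j where "j < n" "R x j \<notin> B j" by auto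
        then have "(\<Prod>j<n. indicator (B j) (R x j) :: real) = 0" by (intro prod_zero bexI[of _ j]) auto
        with False show ?thesis by simp
      qed
      then show "z x * indicator A (R x) = z x * (\<Prod>j<n. indicator (B j) (R x j))" by simp
    qed simp
    also have "\<dots> = 0"
      using z C S B by (intro weighted_trig_moments_cylinder) auto
    finally show ?case .
  next
    case empty then show ?case by simp
  next
    case (compl A)
    then have [measurable]: "A \<in> sets borel" by (simp add: bor)
    have "(\<integral>x. z x * indicator (UNIV - A) (R x) \<partial>M) = (\<integral>x. z x - z x * indicator A (R x) \<partial>M)"
      by (intro Bochner_Integration.integral_cong) (auto simp: indicator_def)
    also have "\<dots> = (\<integral>x. z x \<partial>M) - (\<integral>x. z x * indicator A (R x) \<partial>M)"
      by (intro Bochner_Integration.integral_diff z ib) (auto simp: indicator_def)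
    finally show ?case using compl C[of "\<lambda>_. 0" 0] by simp
  next
    case (union A)
    then have [measurable]: "A i \<in> sets borel" for i by (auto simp: bor)

    have "(\<lambda>n. \<integral>x. z x * indicator (\<Union>i<n. A i) (R x) \<partial>M) \<longlonglongrightarrow> (\<integral>x. z x * indicator (\<Union>i. A i) (R x) \<partial>M)"
    proof (rule integral_dominated_convergence[where w="\<lambda>x. \<bar>z x\<bar>"])
      show "AE x in M. (\<lambda>n. z x * indicator (\<Union>i<n. A i) (R x)) \<longlonglongrightarrow> z x * indicator (\<Union>i. A i) (R x)"
        by (intro AE_I2 tendsto_mult tendsto_const LIMSEQ_indicator_UN)
    qed (use z in \<open>auto simp: indicator_def\<close>)
    moreover have "(\<integral>x. z x * indicator (\<Union>i<n. A i) (R x) \<partial>M) = 0" for n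
    proof -
      have "(\<integral>x. z x * indicator (\<Union>i<n. A i) (R x) \<partial>M) = (\<integral>x. (\<Sum>i<n. z x * indicator (A i) (R x)) \<partial>M)"
        using disjoint_family_on_mono[OF subset_UNIV \<open>disjoint_family A\<close>, of "{..<n}"]
        by (intro Bochner_Integration.integral_cong)
           (auto simp: indicator_UN_disjoint sum_distrib_left)
      also have "\<dots> = (\<Sum>i<n. \<integral>x. z x * indicator (A i) (R x) \<partial>M)"
        by (intro Bochner_Integration.integral_sum ib) (auto simp: indicator_def)
      finally show ?thesis using union by simp
    qed
    ultimately show ?case by (simp add: LIMSEQ_const_iff)
  qed
qed

section \<open>Gaussian fields\<close>

text \<open>A Gaussian field indexed by a Hilbert space. The laws are prescribed by characteristic functions, the
  form that is easiest to verify after a change of measure. Linearity can only be asked for almost surely, with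
  an exceptional set that depends on the relation.\<close>

locale gauss_field = prob_space P for P :: "'a measure" +
  fixes Y :: "'h::real_inner \<Rightarrow> 'a \<Rightarrow> real"
  assumes Y_measurable[measurable]: "\<And>g. Y g \<in> borel_measurable P"
    and Y_linear: "\<And>a b g k. AE x in P. Y (a *\<^sub>R g + b *\<^sub>R k) x = a * Y g x + b * Y k x"
    and expectation_cos: "\<And>g. (\<integral>x. cos (Y g x) \<partial>P) = exp (- (norm g)\<^sup>2 / 2)"
    and expectation_sin: "\<And>g. (\<integral>x. sin (Y g x) \<partial>P) = 0"
begin

lemma Y_zero: "AE x in P. Y 0 x = 0"
  using Y_linear[of 0 0 0 0] by simp

lemma Y_scale: "AE x in P. Y (a *\<^sub>R g) x = a * Y g x"
  using Y_linear[of a g 0 0] by simp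

lemma Y_add: "AE x in P. Y (g + k) x = Y g x + Y k x"
  using Y_linear[of 1 g 1 k] by simp

lemma Y_diff: "AE x in P. Y (g - k) x = Y g x - Y k x"
  using Y_linear[of 1 g "-1" k] by simp

lemma Y_sum: "finite J \<Longrightarrow> AE x in P. Y (\<Sum>j\<in>J. c j *\<^sub>R k j) x = (\<Sum>j\<in>J. c j * Y (k j) x)"
proof (induction J rule: finite_induct)
  case empty then show ?case using Y_zero by simp
next
  case (insert j J)
  have "AE x in P. Y (c j *\<^sub>R k j + 1 *\<^sub>R (\<Sum>j\<in>J. c j *\<^sub>R k j)) x = c j * Y (k j) x + 1 * Y (\<Sum>j\<in>J. c j *\<^sub>R k j) x"
    by (rule Y_linear)
  with insert.IH show ?case by eventually_elim (use insert.hyps in simp)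
qed

lemma trig_integrable:
  assumes [measurable]: "f \<in> borel_measurable P"
  shows "integrable P (\<lambda>x. cos (f x) :: real)" "integrable P (\<lambda>x. sin (f x) :: real)"
  by (auto intro!: integrable_const_bound[where B=1])

lemma std_normal_law:
  assumes g: "norm g = 1"
  shows "distr P borel (Y g) = std_normal_distribution"
proof (rule Levy_uniqueness)
  show "real_distribution (distr P borel (Y g))" by simp
  show "real_distribution std_normal_distribution" by (rule real_dist_normal_dist)
  show "char (distr P borel (Y g)) = char std_normal_distribution"
  proof
    fix t
    have AE: "AE x in P. Y (t *\<^sub>R g) x = t * Y g x" by (rule Y_scale)
    have i: "integrable P (\<lambda>x. iexp (t * Y g x))"
      by (rule integrable_const_bound[where B=1]) auto
    have "(\<integral>x. cos (t * Y g x) \<partial>P) = (\<integral>x. cos (Y (t *\<^sub>R g) x) \<partial>P)"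
      using AE by (intro integral_cong_AE) auto
    also have "\<dots> = exp (- t\<^sup>2 / 2)" using g by (simp add: expectation_cos)
    finally have c: "(\<integral>x. cos (t * Y g x) \<partial>P) = exp (- t\<^sup>2 / 2)" .
    have "(\<integral>x. sin (t * Y g x) \<partial>P) = (\<integral>x. sin (Y (t *\<^sub>R g) x) \<partial>P)"
      using AE by (intro integral_cong_AE) auto
    also have "\<dots> = 0" by (simp add: expectation_sin)
    finally have s: "(\<integral>x. sin (t * Y g x) \<partial>P) = 0" .
    have "(\<integral>x. iexp (t * Y g x) \<partial>P) = complex_of_real (exp (- t\<^sup>2 / 2))"
    proof (rule complex_eqI)
      show "Re (\<integral>x. iexp (t * Y g x) \<partial>P) = Re (complex_of_real (exp (- t\<^sup>2 / 2)))"
        using integral_Re[OF i] c by (simp add: Re_exp)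
      show "Im (\<integral>x. iexp (t * Y g x) \<partial>P) = Im (complex_of_real (exp (- t\<^sup>2 / 2)))"
        using integral_Im[OF i] s by (simp add: Im_exp)
    qed
    then show "char (distr P borel (Y g)) t = char std_normal_distribution t"
      unfolding char_std_normal_distribution by (simp add: char_def integral_distr)
  qed
qed

lemma second_moment: "integrable P (\<lambda>x. (Y g x)\<^sup>2)" "(\<integral>x. (Y g x)\<^sup>2 \<partial>P) = (norm g)\<^sup>2"
proof -
  have "integrable P (\<lambda>x. (Y g x)\<^sup>2) \<and> (\<integral>x. (Y g x)\<^sup>2 \<partial>P) = (norm g)\<^sup>2"
  proof (cases "g = 0")
    case True
    have z: "AE x in P. (Y g x)\<^sup>2 = 0" using Y_zero True by auto
    have "integrable P (\<lambda>x. (Y g x)\<^sup>2) \<longleftrightarrow> integrable P (\<lambda>_. 0::real)"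
      by (rule integrable_cong_AE) (use z in auto)
    with True z show ?thesis by (auto intro: integral_eq_zero_AE)
  next
    case False
    define e where "e = (1 / norm g) *\<^sub>R g"
    have e: "norm e = 1" "norm g *\<^sub>R e = g" using False by (auto simp: e_def)
    have "integrable (distr P borel (Y e)) (\<lambda>x. x\<^sup>2)"
      unfolding std_normal_law[OF e(1)] by (rule integrable_std_normal_distribution_moment)
    then have 1: "integrable P (\<lambda>x. (Y e x)\<^sup>2)" by (simp add: integrable_distr_eq)
    have "(\<integral>x. x\<^sup>2 \<partial>distr P borel (Y e)) = 1"
      unfolding std_normal_law[OF e(1)] using std_normal_distribution_even_moments(1)[of 1] by simp
    then have 2: "(\<integral>x. (Y e x)\<^sup>2 \<partial>P) = 1" by (simp add: integral_distr)
    have AE: "AE x in P. (Y g x)\<^sup>2 = (norm g)\<^sup>2 * (Y e x)\<^sup>2"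
      using Y_scale[of "norm g" e] unfolding e by eventually_elim (simp add: power_mult_distrib)
    have "integrable P (\<lambda>x. (Y g x)\<^sup>2) \<longleftrightarrow> integrable P (\<lambda>x. (norm g)\<^sup>2 * (Y e x)\<^sup>2)"
      by (rule integrable_cong_AE) (use AE in auto)
    moreover have "(\<integral>x. (Y g x)\<^sup>2 \<partial>P) = (\<integral>x. (norm g)\<^sup>2 * (Y e x)\<^sup>2 \<partial>P)"
      by (rule integral_cong_AE) (use AE in auto)
    ultimately show ?thesis using 1 2 by simp
  qed
  then show "integrable P (\<lambda>x. (Y g x)\<^sup>2)" "(\<integral>x. (Y g x)\<^sup>2 \<partial>P) = (norm g)\<^sup>2" by auto
qed

lemma Y_integrable: "integrable P (Y g)"
  by (rule square_integrable_imp_integrable[OF _ second_moment(1)]) simp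

text \<open>The characteristic function of a Gaussian field factorizes along orthogonal vectors. The
  factors are turned into indicators one after the other: first the one of \<open>Y g\<close>, with the phase of the \<open>Y (k j)\<close>
  as a weight; then the phase itself, with the centered indicator of \<open>Y g\<close> as a weight.\<close>

lemma indep_orthogonal:
  fixes k :: "nat \<Rightarrow> 'h"
  assumes orth: "\<And>j. inner g (k j) = 0"
  shows "distr P borel (Y g) \<Otimes>\<^sub>M distr P borel (\<lambda>x j. Y (k j) x) =
    distr P (borel \<Otimes>\<^sub>M borel) (\<lambda>x. (Y g x, \<lambda>j. Y (k j) x))"
proof -
  let ?R = "\<lambda>x j. Y (k j) x"
  have R[measurable]: "?R \<in> borel_measurable P"
    by (rule measurable_coordinatewise_then_product) simp
  have key: "(\<integral>x. (indicator A (Y g x) - prob (Y g -` A \<inter> space P)) * indicator B (?R x) \<partial>P) = 0"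
    if [measurable]: "A \<in> sets borel" and B: "B \<in> sets borel" for A B
  proof -
    define p where "p = prob (Y g -` A \<inter> space P)"
    have iA: "(\<integral>x. indicator A (Y g x) \<partial>P) = p"
    proof -
      have "(\<integral>x. indicator A (Y g x) \<partial>P) = (\<integral>x. indicator (Y g -` A \<inter> space P) x \<partial>P :: real)"
        by (intro Bochner_Integration.integral_cong) (auto simp: indicator_def)
      then show ?thesis by (simp add: p_def)
    qed
    have ib: "integrable P f" if "f \<in> borel_measurable P" "\<And>x. \<bar>f x\<bar> \<le> 1" for f :: "'a \<Rightarrow> real"
      using that by (intro integrable_const_bound[where B=1]) auto
    have le1: "\<bar>cos a * cos b\<bar> \<le> 1" "\<bar>cos a * sin b\<bar> \<le> 1" "\<bar>sin a * cos b\<bar> \<le> 1" "\<bar>sin a * sin b\<bar> \<le> 1"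
       "\<bar>cos a * indicator A b\<bar> \<le> 1" "\<bar>sin a * indicator A b\<bar> \<le> 1"
      for a b :: real
      by (auto simp: abs_mult indicator_def intro!: mult_le_one)
    let ?t = "\<lambda>n c x. \<Sum>j<n. c j * Y (k j) x"
    have trig: "(\<integral>x. indicator A (Y g x) * cos (?t n c x) \<partial>P) = p * (\<integral>x. cos (?t n c x) \<partial>P)"
      "(\<integral>x. indicator A (Y g x) * sin (?t n c x) \<partial>P) = p * (\<integral>x. sin (?t n c x) \<partial>P)"
      for n c
    proof -
      define \<theta> where "\<theta> x = (\<Sum>j<n. c j * Y (k j) x)" for x
      have [measurable]: "\<theta> \<in> borel_measurable P" unfolding \<theta>_def by measurable
      define r where "r = (\<Sum>j<n. c j *\<^sub>R k j)"
      have gr: "inner r g = 0" using orth by (simp add: r_def inner_sum_right inner_commute[of _ g])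
      have nr: "(norm (r + s *\<^sub>R g))\<^sup>2 = (norm r)\<^sup>2 + (s * norm g)\<^sup>2" for s
        using gr by (simp only: power_mult_distrib power2_norm_eq_inner inner_add_left inner_add_right
            inner_scaleR_left inner_scaleR_right inner_commute[of g r]) (simp add: power2_eq_square)
      have Yr: "AE x in P. Y r x = \<theta> x"
        unfolding r_def \<theta>_def by (rule Y_sum) simp
      have Yrs: "AE x in P. Y (r + s *\<^sub>R g) x = \<theta> x + s * Y g x" for s
        using Yr Y_linear[of 1 r s g] by auto
      have c: "(\<integral>x. cos (\<theta> x + s * Y g x) \<partial>P) = exp (- (norm r)\<^sup>2 / 2) * exp (- (s * norm g)\<^sup>2 / 2)" for s
      proof -
        have "(\<integral>x. cos (\<theta> x + s * Y g x) \<partial>P) = (\<integral>x. cos (Y (r + s *\<^sub>R g) x) \<partial>P)"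
          using Yrs[of s] by (intro integral_cong_AE) auto
        then show ?thesis by (simp add: expectation_cos nr exp_add[symmetric] add_divide_distrib)
      qed
      have s: "(\<integral>x. sin (\<theta> x + s * Y g x) \<partial>P) = 0" for s
      proof -
        have "(\<integral>x. sin (\<theta> x + s * Y g x) \<partial>P) = (\<integral>x. sin (Y (r + s *\<^sub>R g) x) \<partial>P)"
          using Yrs[of s] by (intro integral_cong_AE) auto
        then show ?thesis by (simp add: expectation_sin)
      qed
      have i: "integrable P (\<lambda>x. cos (\<theta> x) * cos (s * Y g x))" "integrable P (\<lambda>x. cos (\<theta> x) * sin (s * Y g x))"
        "integrable P (\<lambda>x. sin (\<theta> x) * cos (s * Y g x))" "integrable P (\<lambda>x. sin (\<theta> x) * sin (s * Y g x))" for s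
        by (auto intro!: ib le1)
      have sp: "(\<integral>x. cos (\<theta> x) * cos (s * Y g x) \<partial>P) = exp (- (norm r)\<^sup>2 / 2) * exp (- (s * norm g)\<^sup>2 / 2)"
        "(\<integral>x. sin (\<theta> x) * sin (s * Y g x) \<partial>P) = 0"
        "(\<integral>x. cos (\<theta> x) * sin (s * Y g x) \<partial>P) = 0"
        "(\<integral>x. sin (\<theta> x) * cos (s * Y g x) \<partial>P) = 0" for s
        using c[of s] c[of "-s"] s[of s] s[of "-s"] i[of s] by (simp_all add: cos_add sin_add cos_diff sin_diff)
      have ct: "(\<integral>x. cos (\<theta> x) \<partial>P) = exp (- (norm r)\<^sup>2 / 2)" "(\<integral>x. sin (\<theta> x) \<partial>P) = 0"
        using sp(1)[of 0] sp(4)[of 0] by simp_all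
      have cg: "(\<integral>x. cos (s * Y g x) \<partial>P) = exp (- (s * norm g)\<^sup>2 / 2)" "(\<integral>x. sin (s * Y g x) \<partial>P) = 0" for s
      proof -
        have "(\<integral>x. cos (s * Y g x) \<partial>P) = (\<integral>x. cos (Y (s *\<^sub>R g) x) \<partial>P)"
          "(\<integral>x. sin (s * Y g x) \<partial>P) = (\<integral>x. sin (Y (s *\<^sub>R g) x) \<partial>P)"
          using Y_scale[of s g] by (auto intro!: integral_cong_AE)
        then show "(\<integral>x. cos (s * Y g x) \<partial>P) = exp (- (s * norm g)\<^sup>2 / 2)" "(\<integral>x. sin (s * Y g x) \<partial>P) = 0"
          by (simp_all add: expectation_cos expectation_sin power_mult_distrib)
      qed
      have van: "(\<integral>x. (cos (\<theta> x) - exp (- (norm r)\<^sup>2 / 2)) * indicator A (Y g x) \<partial>P) = 0"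
        using trig_integrable i by (intro weighted_trig_moments_unique) (simp_all add: left_diff_distrib sp cg)
      then show "(\<integral>x. indicator A (Y g x) * cos (?t n c x) \<partial>P) = p * (\<integral>x. cos (?t n c x) \<partial>P)"
      proof -
        have i1: "integrable P (\<lambda>x. cos (\<theta> x) * indicator A (Y g x))" by (rule ib[OF _ le1(5)]) measurable
        have i2: "integrable P (\<lambda>x. exp (- (norm r)\<^sup>2 / 2) * indicator A (Y g x))"
          by (intro integrable_mult_right ib) (auto simp: indicator_def)
        have "(\<integral>x. (cos (\<theta> x) - exp (- (norm r)\<^sup>2 / 2)) * indicator A (Y g x) \<partial>P) =
            (\<integral>x. cos (\<theta> x) * indicator A (Y g x) \<partial>P) - exp (- (norm r)\<^sup>2 / 2) * p"
          unfolding left_diff_distrib Bochner_Integration.integral_diff[OF i1 i2] integral_mult_right_zero iA ..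
        with van show ?thesis unfolding \<theta>_def[symmetric] ct by (simp add: mult.commute)
      qed
      have "(\<integral>x. sin (\<theta> x) * indicator A (Y g x) \<partial>P) = 0"
        using trig_integrable by (intro weighted_trig_moments_unique) (simp_all add: sp)
      then show "(\<integral>x. indicator A (Y g x) * sin (?t n c x) \<partial>P) = p * (\<integral>x. sin (?t n c x) \<partial>P)"
        unfolding \<theta>_def[symmetric] by (simp add: ct mult.commute)
    qed
    have iAt: "integrable P (\<lambda>x. indicator A (Y g x) * cos (?t n c x))"
       "integrable P (\<lambda>x. indicator A (Y g x) * sin (?t n c x))" for n c
      by (auto intro!: ib simp: abs_mult indicator_def)
    show ?thesis
      unfolding p_def[symmetric]
    proof (rule weighted_trig_moments_vanish[OF _ R _ _ B])
      show "integrable P (\<lambda>x. indicator A (Y g x) - p)"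
        by (intro Bochner_Integration.integrable_diff ib) (auto simp: indicator_def p_def)
      show "(\<integral>x. (indicator A (Y g x) - p) * cos (?t n c x) \<partial>P) = 0"
        "(\<integral>x. (indicator A (Y g x) - p) * sin (?t n c x) \<partial>P) = 0" for n c
        unfolding left_diff_distrib using iAt[of c n] trig_integrable[of "\<lambda>x. \<Sum>j<n. c j * Y (k j) x"]
        by (simp_all add: trig)
    qed
  qed
  interpret D1: prob_space "distr P borel (Y g)" by (rule prob_space_distr) simp
  interpret D2: prob_space "distr P borel ?R" by (rule prob_space_distr) simp
  show ?thesis
  proof (rule pair_measure_eqI)
    fix A B assume "A \<in> sets (distr P borel (Y g))" "B \<in> sets (distr P borel ?R)"
    then have [measurable]: "A \<in> sets borel" "B \<in> sets borel" by auto
    let ?a = "Y g -` A \<inter> space P" and ?b = "?R -` B \<inter> space P"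
    have [measurable]: "?a \<in> sets P" "?b \<in> sets P" by measurable
    have "0 = (\<integral>x. indicator (?a \<inter> ?b) x - prob ?a * indicator ?b x \<partial>P)"
      unfolding key[symmetric, OF \<open>A \<in> sets borel\<close> \<open>B \<in> sets borel\<close>]
      by (intro Bochner_Integration.integral_cong) (auto simp: indicator_def)
    also have "\<dots> = prob (?a \<inter> ?b) - prob ?a * prob ?b"
      using integrable_real_indicator[of "?a \<inter> ?b" P] integrable_real_indicator[of ?b P]
      by (subst Bochner_Integration.integral_diff) (auto simp: emeasure_eq_measure)
    finally have "prob (?a \<inter> ?b) = prob ?a * prob ?b" by simp
    moreover have "(\<lambda>x. (Y g x, ?R x)) -` (A \<times> B) \<inter> space P = ?a \<inter> ?b" by auto
    ultimately show "emeasure (distr P borel (Y g)) A * emeasure (distr P borel ?R) B =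
        emeasure (distr P (borel \<Otimes>\<^sub>M borel) (\<lambda>x. (Y g x, ?R x))) (A \<times> B)"
      by (simp add: emeasure_distr emeasure_eq_measure ennreal_mult)
  qed (auto intro: D1.sigma_finite_measure_axioms D2.sigma_finite_measure_axioms)
qed

end

section \<open>Functions of finitely many coordinates\<close>

text \<open>Integration by parts is carried out in this class. It contains the rapidly decreasing functions and the
  damped trigonometric ones. Unlike the former, a member stays in the class when further coordinates are counted
  among its variables, so functions of different numbers of coordinates can be multiplied.\<close>

definition c1_bounded :: "nat \<Rightarrow> ((nat \<Rightarrow> real) \<Rightarrow> real) \<Rightarrow> bool" where
  "c1_bounded n f \<longleftrightarrow>
     (\<forall>x y. (\<forall>i<n. x i = y i) \<longrightarrow> f x = f y) \<and>
     continuous_on UNIV f \<and> bounded (range f) \<and>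
     (\<forall>i. continuous_on UNIV (pderivative i f) \<and> bounded (range (pderivative i f)) \<and>
        (\<forall>x r. ((\<lambda>r. f (x(i := r))) has_real_derivative pderivative i f (x(i := r))) (at r)))"

lemma pderivative_eqI:
  assumes "((\<lambda>r. f (x(i := r))) has_real_derivative d) (at (x i))"
  shows "pderivative i f x = d"
  using assms unfolding pderivative_def by (rule DERIV_imp_deriv)

lemma c1_boundedD:
  assumes "c1_bounded n f"
  shows "\<And>x y. (\<And>i. i < n \<Longrightarrow> x i = y i) \<Longrightarrow> f x = f y"
    "continuous_on UNIV f" "bounded (range f)"
    "continuous_on UNIV (pderivative i f)" "bounded (range (pderivative i f))"
    "((\<lambda>r. f (x(i := r))) has_real_derivative pderivative i f (x(i := r))) (at r)"
  using assms unfolding c1_bounded_def by blast+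

lemma c1_boundedI:
  assumes "\<And>x y. (\<And>i. i < n \<Longrightarrow> x i = y i) \<Longrightarrow> f x = f y"
    and "continuous_on UNIV f" "bounded (range f)"
    and "\<And>i. i < n \<Longrightarrow> continuous_on UNIV (d i)" "\<And>i. i < n \<Longrightarrow> bounded (range (d i))"
    and "\<And>i x. i < n \<Longrightarrow> ((\<lambda>r. f (x(i := r))) has_real_derivative d i x) (at (x i))"
  shows "c1_bounded n f"
proof -
  have d: "pderivative i f = d i" if "i < n" for i
    using assms(6)[OF that] by (intro ext pderivative_eqI)
  have 0: "(\<lambda>r. f (x(i := r))) = (\<lambda>r. f x)" if "\<not> i < n" for i x
    using that by (intro ext assms(1)) auto
  have d0: "pderivative i f = (\<lambda>_. 0)" if "\<not> i < n" for i
    by (intro ext pderivative_eqI) (simp add: 0[OF that])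
  show "c1_bounded n f" unfolding c1_bounded_def
  proof (intro conjI allI impI)
    fix x r i
    show "continuous_on UNIV (pderivative i f)" "bounded (range (pderivative i f))"
      using assms(4,5) d d0 by (cases "i < n"; simp)+
    show "((\<lambda>r. f (x(i := r))) has_real_derivative pderivative i f (x(i := r))) (at r)"
    proof (cases "i < n")
      case True
      from assms(6)[OF True, of "x(i := r)"] d[OF True] show ?thesis by simp
    next
      case False
      then show ?thesis by (simp add: 0[OF False] d0[OF False])
    qed
  next
    fix x y :: "nat \<Rightarrow> real" assume "\<forall>i<n. x i = y i"
    then show "f x = f y" by (intro assms(1)) blast
  qed (rule assms)+
qed

lemma c1_bounded_pderivative_outside:
  assumes "c1_bounded n f" "n \<le> i"
  shows "pderivative i f x = 0"
proof (rule pderivative_eqI)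
  have "(\<lambda>r. f (x(i := r))) = (\<lambda>r. f x)"
    using assms by (intro ext c1_boundedD(1)[OF assms(1)]) auto
  then show "((\<lambda>r. f (x(i := r))) has_real_derivative 0) (at (x i))" by simp
qed

lemma c1_bounded_pderivative_cong:
  assumes f: "c1_bounded n f" and "i < n" and eq: "\<And>j. j < n \<Longrightarrow> x j = y j"
  shows "pderivative i f x = pderivative i f y"
proof -
  have "(\<lambda>r. f (x(i := r))) = (\<lambda>r. f (y(i := r)))"
    using eq by (intro ext c1_boundedD(1)[OF f]) auto
  then show ?thesis using eq[OF \<open>i < n\<close>] by (simp add: pderivative_def)
qed

lemma c1_bounded_mono:
  assumes f: "c1_bounded n f" and "n \<le> m"
  shows "c1_bounded m f"
  using assms unfolding c1_bounded_def by (meson less_le_trans)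

lemma bounded_range_mult:
  fixes f g :: "'a \<Rightarrow> real"
  assumes "bounded (range f)" "bounded (range g)"
  shows "bounded (range (\<lambda>x. f x * g x))"
proof -
  obtain a b where "\<And>x. \<bar>f x\<bar> \<le> a" "\<And>x. \<bar>g x\<bar> \<le> b" using assms by (auto simp: bounded_real)
  then have "\<bar>f x * g x\<bar> \<le> a * b" for x
    by (simp add: abs_mult mult_mono')
  then show ?thesis by (auto simp: bounded_real)
qed

lemma c1_bounded_mult:
  assumes f: "c1_bounded n f" and g: "c1_bounded n g"
  shows "c1_bounded n (\<lambda>x. f x * g x)"
    and "pderivative i (\<lambda>x. f x * g x) x = f x * pderivative i g x + pderivative i f x * g x"
proof -
  note F = c1_boundedD[OF f] and G = c1_boundedD[OF g]
  have der: "((\<lambda>r. f (x(i := r)) * g (x(i := r))) has_real_derivative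
      f x * pderivative i g x + pderivative i f x * g x) (at (x i))" for x i
    using DERIV_mult[OF F(6)[of x i "x i"] G(6)[of x i "x i"]] by (simp add: algebra_simps)
  show "c1_bounded n (\<lambda>x. f x * g x)"
  proof (rule c1_boundedI[OF _ _ _ _ _ der])
    fix x y :: "nat \<Rightarrow> real" assume "\<And>i. i < n \<Longrightarrow> x i = y i"
    then show "f x * g x = f y * g y" using F(1)[of x y] G(1)[of x y] by simp
  next
    show "continuous_on UNIV (\<lambda>x. f x * g x)" by (intro continuous_intros F G)
    show "bounded (range (\<lambda>x. f x * g x))" by (intro bounded_range_mult F G)
    show "continuous_on UNIV (\<lambda>x. f x * pderivative i g x + pderivative i f x * g x)" for i
      by (intro continuous_intros F G)
    show "bounded (range (\<lambda>x. f x * pderivative i g x + pderivative i f x * g x))" for i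
      by (intro bounded_plus_comp bounded_range_mult F G)
  qed
  show "pderivative i (\<lambda>x. f x * g x) x = f x * pderivative i g x + pderivative i f x * g x"
    by (rule pderivative_eqI[OF der])
qed

lemma schwartz_c1_bounded:
  assumes f: "schwartz n f"
  shows "c1_bounded n f"
proof (rule c1_boundedI[where d="\<lambda>i. pderivative i f"])
  have D: "continuous_on UNIV (foldr pderivative is f)"
    "i < n \<Longrightarrow> (\<lambda>r. foldr pderivative is f (x(i := r))) field_differentiable (at (x i))"
    "bounded (range (\<lambda>x. (1 + (\<Sum>i<n. (x i)\<^sup>2)) ^ m * foldr pderivative is f x))"
    if "set is \<subseteq> {..<n}" for "is" i x m
    using f that unfolding schwartz_def by blast+
  show "\<And>x y. (\<And>i. i < n \<Longrightarrow> x i = y i) \<Longrightarrow> f x = f y" using f unfolding schwartz_def by blast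
  show "continuous_on UNIV f" using D(1)[of "[]"] by simp
  show "bounded (range f)" using D(3)[of "[]" 0] by simp
  show "continuous_on UNIV (pderivative i f)" if "i < n" for i using D(1)[of "[i]"] that by simp
  show "bounded (range (pderivative i f))" if "i < n" for i using D(3)[of "[i]" 0] that by simp
  show "((\<lambda>r. f (x(i := r))) has_real_derivative pderivative i f x) (at (x i))" if "i < n" for i x
    using D(2)[of "[]" i x] that unfolding pderivative_def
    by (simp add: DERIV_deriv_iff_field_differentiable)
qed

text \<open>The chain rule, by induction on the number of moving coordinates: each new coordinate
  enters through the theorem that a function with one derivative and one continuous partial derivative is
  differentiable in both variables.\<close>

lemma c1_bounded_line_derivative:
  assumes f: "c1_bounded n f"
  shows "((\<lambda>x. f (\<lambda>j. a j * x + r j)) has_real_derivative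
      (\<Sum>j<n. a j * pderivative j f (\<lambda>j. a j * x + r j))) (at x)"
proof -
  note F = c1_boundedD[OF f]
  define p where "p k c x = (\<lambda>j. if j < k then a j * x + r j else c j)" for k c and x :: real
  have "((\<lambda>x. f (p k c x)) has_real_derivative (\<Sum>j<k. a j * pderivative j f (p k c x))) (at x)" for k c x
  proof (induction k arbitrary: c x)
    case 0
    have "p 0 c = (\<lambda>_. c)" for c by (auto simp: p_def)
    then show ?case by simp
  next
    case (Suc k)
    define G where "G x y = f ((p k c x)(k := y))" for x y :: real
    have pk: "(p k c x)(k := y) = p k (c(k := y)) x" for x y by (auto simp: p_def)
    have ps: "p (Suc k) c x = (p k c x)(k := a k * x + r k)" for x
      by (auto simp: p_def less_Suc_eq)
    define y where "y = a k * x + r k"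
    let ?d = "\<Sum>j<k. a j * pderivative j f (p (Suc k) c x)"
    let ?e = "\<lambda>x y. pderivative k f ((p k c x)(k := y))"
    have fx: "((\<lambda>x. G x y) has_derivative (\<lambda>t. t * ?d)) (at x within UNIV)"
      using Suc.IH[of "c(k := y)" x] unfolding has_field_derivative_def G_def pk
      by (simp add: ps pk[symmetric] y_def mult_commute_abs)
    have fy: "((\<lambda>y. G x y) has_derivative blinfun_apply (blinfun_scaleR_left (?e x y))) (at y within UNIV)" for x y
      using F(6)[of "p k c x" k y] unfolding has_field_derivative_def G_def
      by (simp add: mult_commute_abs)
    have cont: "continuous_on UNIV (\<lambda>z::real\<times>real. (p k c (fst z))(k := snd z))"
    proof (rule continuous_on_coordinatewise_then_product)
      fix i
      show "continuous_on UNIV (\<lambda>z::real\<times>real. ((p k c (fst z))(k := snd z)) i)"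
        by (cases "i = k"; cases "i < k") (auto simp: p_def intro!: continuous_intros)
    qed
    have "continuous_on UNIV (\<lambda>z::real\<times>real. pderivative k f ((p k c (fst z))(k := snd z)))"
      by (rule continuous_on_compose2[OF F(4) cont]) auto
    then have "continuous_on UNIV (\<lambda>z::real\<times>real. blinfun_scaleR_left (?e (fst z) (snd z)) :: real \<Rightarrow>\<^sub>L real)"
      by (intro continuous_intros)
    then have fc: "continuous (at (x, y) within UNIV \<times> UNIV) (\<lambda>(x, y). blinfun_scaleR_left (?e x y) :: real \<Rightarrow>\<^sub>L real)"
      by (simp add: continuous_on_eq_continuous_at case_prod_unfold)
    have "((\<lambda>(x, y). G x y) has_derivative (\<lambda>(tx, ty). tx * ?d + blinfun_scaleR_left (?e x y) ty)) (at (x, y) within UNIV \<times> UNIV)"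
      by (rule has_derivative_partialsI[OF fx fy fc]) auto
    then have h: "((\<lambda>(x, y). G x y) has_derivative (\<lambda>(tx, ty). tx * ?d + ty * ?e x y)) (at (x, a k * x + r k))"
      by (simp add: y_def case_prod_unfold)
    have l: "((\<lambda>x. (x, a k * x + r k)) has_derivative (\<lambda>t. (t, a k * t))) (at x)"
      by (auto intro!: derivative_eq_intros)
    have "((\<lambda>x. G x (a k * x + r k)) has_derivative (\<lambda>t. t * ?d + (a k * t) * ?e x y)) (at x)"
      using has_derivative_compose[OF l h] by simp
    moreover have "(\<lambda>t. t * ?d + (a k * t) * ?e x y) = (*) (\<Sum>j<Suc k. a j * pderivative j f (p (Suc k) c x))"
      by (auto simp: fun_eq_iff ps y_def algebra_simps)
    ultimately show ?case
      unfolding has_field_derivative_def G_def ps by simp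
  qed
  note D = this[of n r x]
  let ?l = "\<lambda>x j. a j * x + r j"
  have "f (p n r x) = f (?l x)" for x by (rule F(1)) (simp add: p_def)
  moreover have "pderivative j f (p n r x) = pderivative j f (?l x)" if "j < n" for j
    by (rule c1_bounded_pderivative_cong[OF f]) (use that in \<open>simp_all add: p_def\<close>)
  ultimately show ?thesis using D by simp
qed

section \<open>Gaussian integration by parts\<close>

lemma std_normal_density_derivative:
  "(std_normal_density has_real_derivative - (x * std_normal_density x)) (at x)"
proof -
  have "((\<lambda>x. c * exp (- x\<^sup>2 / 2)) has_real_derivative - (x * (c * exp (- x\<^sup>2 / 2)))) (at x)" for c :: real
    by (auto intro!: derivative_eq_intros)
  then show ?thesis unfolding std_normal_density_def .
qed

lemma std_normal_density_tendsto_0: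
  "(std_normal_density \<longlongrightarrow> 0) at_top" "(std_normal_density \<longlongrightarrow> 0) at_bot"
proof -
  have lim: "(std_normal_density \<longlongrightarrow> 0) F" if "filterlim (\<lambda>x::real. x\<^sup>2) at_top F" for F
  proof -
    have "filterlim (\<lambda>x::real. x\<^sup>2 * (1/2)) at_top F"
      by (rule filterlim_at_top_mult_tendsto_pos[OF tendsto_const _ that]) simp
    then have "((\<lambda>x::real. exp (- (x\<^sup>2 / 2))) \<longlongrightarrow> 0) F"
      by (intro filterlim_compose[OF exp_at_bot]) (simp add: filterlim_uminus_at_bot)
    then show ?thesis
      unfolding std_normal_density_def[abs_def] by (intro tendsto_mult_right_zero) simp
  qed
  show "(std_normal_density \<longlongrightarrow> 0) at_top" "(std_normal_density \<longlongrightarrow> 0) at_bot"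
    by (intro lim filterlim_pow_at_top filterlim_ident, simp)
       (intro lim filterlim_pow_at_bot_even filterlim_ident, auto)
qed

lemma std_normal_ibp:
  fixes f f' :: "real \<Rightarrow> real"
  assumes der: "\<And>x. (f has_real_derivative f' x) (at x)" and cont: "continuous_on UNIV f'"
    and "bounded (range f)" "bounded (range f')"
  shows "(\<integral>x. x * f x \<partial>std_normal_distribution) = (\<integral>x. f' x \<partial>std_normal_distribution)"
proof -
  obtain C where C: "\<And>x. \<bar>f x\<bar> \<le> C" using assms(3) by (auto simp: bounded_real)
  obtain C' where C': "\<And>x. \<bar>f' x\<bar> \<le> C'" using assms(4) by (auto simp: bounded_real)
  have cf: "continuous_on UNIV f" using der by (meson DERIV_isCont continuous_at_imp_continuous_on)
  have [measurable]: "f \<in> borel_measurable borel" "f' \<in> borel_measurable borel"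
    using cf cont by (auto intro: borel_measurable_continuous_onI)
  interpret N: prob_space std_normal_distribution using real_dist_normal_dist by (simp add: real_distribution_def)
  have i1: "integrable std_normal_distribution (\<lambda>x. x * f x)"
  proof (rule Bochner_Integration.integrable_bound)
    show "integrable std_normal_distribution (\<lambda>x. C * x)"
      using integrable_std_normal_distribution_moment[of 1] by simp
    show "AE x in std_normal_distribution. norm (x * f x) \<le> norm (C * x)"
      using C by (intro AE_I2) (simp add: abs_mult, metis abs_ge_self abs_ge_zero mult.commute mult_left_mono order_trans)
  qed simp
  have i2: "integrable std_normal_distribution f'"
    by (rule N.integrable_const_bound[where B=C']) (use C' in auto)
  define G where "G x = std_normal_density x * f' x - std_normal_density x * (x * f x)" for x
  have j: "integrable lborel (\<lambda>x. std_normal_density x * (x * f x))" "integrable lborel (\<lambda>x. std_normal_density x * f' x)"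
    using i1 i2 by (simp_all add: integrable_density)
  have "(LBINT x=-\<infinity>..\<infinity>. G x) = 0 - 0"
  proof (rule interval_integral_FTC_integrable[where F="\<lambda>x. std_normal_density x * f x"])
    show "((\<lambda>x. std_normal_density x * f x) has_vector_derivative G x) (at x)" for x
      unfolding has_real_derivative_iff_has_vector_derivative[symmetric] G_def
      by (rule DERIV_cong[OF DERIV_mult[OF std_normal_density_derivative der]]) (simp add: algebra_simps)
    have "continuous_on UNIV std_normal_density"
      using std_normal_density_derivative by (meson DERIV_isCont continuous_at_imp_continuous_on)
    then have "continuous_on UNIV G" unfolding G_def by (intro continuous_intros cf cont)
    then show "isCont G x" for x by (simp add: continuous_on_eq_continuous_at)
    show "set_integrable lborel (einterval (- \<infinity>) \<infinity>) G"
      using j unfolding G_def by (simp add: set_integrable_def)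
    have B: "((\<lambda>x. std_normal_density x * f x) \<longlongrightarrow> 0) F" if "(std_normal_density \<longlongrightarrow> 0) F" for F
    proof (rule Lim_null_comparison)
      show "((\<lambda>x. std_normal_density x * C) \<longlongrightarrow> 0) F" using that by (rule tendsto_mult_left_zero)
      show "\<forall>\<^sub>F x in F. norm (std_normal_density x * f x) \<le> std_normal_density x * C"
        using C by (intro always_eventually allI) (simp add: abs_mult mult_left_mono)
    qed
    show "(((\<lambda>x. std_normal_density x * f x) \<circ> real_of_ereal) \<longlongrightarrow> 0) (at_right (- \<infinity>))"
      "(((\<lambda>x. std_normal_density x * f x) \<circ> real_of_ereal) \<longlongrightarrow> 0) (at_left \<infinity>)"
      unfolding ereal_tendsto_simps1 by (intro B std_normal_density_tendsto_0)+
  qed simp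
  then have "(\<integral>x. G x \<partial>lborel) = 0"
    by (simp add: interval_lebesgue_integral_def set_lebesgue_integral_def)
  then show ?thesis
    using j unfolding G_def by (simp add: integral_density)
qed

lemma bounded_borel_integrable:
  fixes f :: "'a \<Rightarrow> real"
  assumes "finite_measure M" "f \<in> borel_measurable M" "bounded (range f)"
  shows "integrable M f"
proof -
  obtain C where "\<And>x. \<bar>f x\<bar> \<le> C" using assms(3) by (auto simp: bounded_real)
  then show ?thesis using assms by (intro finite_measure.integrable_const_bound[where B=C]) auto
qed

lemma c1_bounded_measurable:
  assumes "c1_bounded n f"
  shows "f \<in> borel_measurable borel" "pderivative i f \<in> borel_measurable borel"
  using c1_boundedD(2,4)[OF assms] by (auto intro: borel_measurable_continuous_onI)

lemma bounded_range_compose: "bounded (range f) \<Longrightarrow> bounded (range (\<lambda>x. f (g x)))"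
  by (rule bounded_subset) auto

lemma bounded_range_sum:
  fixes f :: "nat \<Rightarrow> 'a \<Rightarrow> real"
  assumes "\<And>j. bounded (range (f j))"
  shows "bounded (range (\<lambda>x. \<Sum>j<n. f j x))"
proof (induction n)
  case (Suc n)
  show ?case using bounded_plus_comp[OF Suc.IH assms[of n]] by simp
qed (auto simp: bounded_real)

context gauss_field begin

lemma vector_measurable[measurable]: "(\<lambda>x i. Y (h i) x) \<in> borel_measurable P" for h :: "nat \<Rightarrow> 'h"
  by (rule measurable_coordinatewise_then_product) simp

text \<open>Splitting \<open>h j\<close> into its component along \<open>g\<close> and the orthogonal rest makes the argument of \<open>f\<close>
  an affine function of the standard normal variable \<open>Y g\<close>, with an offset that is independent of it. So
  one-dimensional integration by parts applies for each value of the offset.\<close>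

lemma ibp_unit:
  fixes h :: "nat \<Rightarrow> 'h"
  assumes f: "c1_bounded n f" and g: "norm g = 1"
  shows "(\<integral>x. Y g x * f (\<lambda>i. Y (h i) x) \<partial>P) =
    (\<integral>x. (\<Sum>j<n. inner g (h j) * pderivative j f (\<lambda>i. Y (h i) x)) \<partial>P)"
proof -
  note F = c1_boundedD[OF f]
  note [measurable] = c1_bounded_measurable[OF f]
  define a where "a j = inner g (h j)" for j
  define k where "k j = h j - a j *\<^sub>R g" for j
  let ?R = "\<lambda>x j. Y (k j) x" and ?V = "\<lambda>x i. Y (h i) x"
  define L where "L = (\<lambda>(s::real, r::nat \<Rightarrow> real) j. a j * s + r j)"
  have [measurable]: "(\<lambda>r. r j) \<in> borel_measurable (borel :: (nat \<Rightarrow> real) measure)" for j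
    by (rule measurable_product_coordinates)
  have L[measurable]: "L \<in> borel_measurable (borel \<Otimes>\<^sub>M borel)"
    unfolding L_def case_prod_unfold by (rule measurable_coordinatewise_then_product) simp
  have "inner g (k j) = 0" for j
    using g by (simp add: k_def a_def inner_diff_right dot_square_norm)
  then have law: "distr P (borel \<Otimes>\<^sub>M borel) (\<lambda>x. (Y g x, ?R x)) = std_normal_distribution \<Otimes>\<^sub>M distr P borel ?R"
    using indep_orthogonal[of g k] std_normal_law[OF g] by simp
  let ?N = "std_normal_distribution" and ?Q = "distr P borel ?R"
  interpret N: prob_space ?N using real_dist_normal_dist by (simp add: real_distribution_def)
  interpret Q: prob_space ?Q by (rule prob_space_distr) simp
  interpret NQ: pair_prob_space ?N ?Q ..
  have sets[measurable_cong]: "sets (?N \<Otimes>\<^sub>M ?Q) = sets (borel \<Otimes>\<^sub>M borel)" by (rule sets_pair_measure_cong) simp_all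
  have "AE x in P. \<forall>j. Y (h j) x = a j * Y g x + Y (k j) x"
    unfolding AE_all_countable
  proof
    fix j
    have "1 *\<^sub>R k j + a j *\<^sub>R g = h j" by (simp add: k_def)
    then show "AE x in P. Y (h j) x = a j * Y g x + Y (k j) x"
      using Y_linear[of 1 "k j" "a j" g] by (simp add: add.commute)
  qed
  then have AE: "AE x in P. ?V x = L (Y g x, ?R x)"
    by eventually_elim (auto simp: L_def)
  define \<psi> where "\<psi> z = (\<Sum>j<n. a j * pderivative j f (L z))" for z
  have [measurable]: "\<psi> \<in> borel_measurable (borel \<Otimes>\<^sub>M borel)"
    unfolding \<psi>_def by measurable
  have "bounded (range \<psi>)"
  proof -
    have "bounded (range (\<lambda>z. pderivative j f (L z)))" for j by (rule bounded_range_compose[OF F(5)])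
    moreover have "bounded (range (\<lambda>_. a j))" for j by simp
    ultimately show ?thesis unfolding \<psi>_def by (intro bounded_range_sum bounded_range_mult)
  qed
  then have i\<psi>: "integrable (?N \<Otimes>\<^sub>M ?Q) \<psi>"
    by (intro bounded_borel_integrable) (auto intro: NQ.finite_measure_axioms)
  obtain C where C: "\<And>x. \<bar>f x\<bar> \<le> C" using F(3) by (auto simp: bounded_real)
  have "integrable P (\<lambda>x. Y g x * f (L (Y g x, ?R x)))"
  proof (rule Bochner_Integration.integrable_bound)
    show "integrable P (\<lambda>x. C * Y g x)" using Y_integrable by simp
    show "AE x in P. norm (Y g x * f (L (Y g x, ?R x))) \<le> norm (C * Y g x)"
      unfolding real_norm_def abs_mult mult.commute[of "\<bar>Y g _\<bar>"]
      by (intro AE_I2 mult_right_mono order_trans[OF C abs_ge_self]) simp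
  qed simp
  then have i1: "integrable (?N \<Otimes>\<^sub>M ?Q) (\<lambda>(s, r). s * f (L (s, r)))"
    unfolding law[symmetric] by (subst integrable_distr_eq) simp_all
  have inner_ibp: "(\<integral>s. s * f (L (s, r)) \<partial>?N) = (\<integral>s. \<psi> (s, r) \<partial>?N)" for r :: "nat \<Rightarrow> real"
  proof (rule std_normal_ibp)
    fix s :: real
    show "((\<lambda>s. f (L (s, r))) has_real_derivative \<psi> (s, r)) (at s)"
      unfolding \<psi>_def L_def prod.case by (rule c1_bounded_line_derivative[OF f])
    show "bounded (range (\<lambda>s. f (L (s, r))))" by (rule bounded_range_compose[OF F(3)])
    show "bounded (range (\<lambda>s. \<psi> (s, r)))" by (rule bounded_range_compose[OF \<open>bounded (range \<psi>)\<close>])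
    have "continuous_on UNIV (\<lambda>s. L (s, r))"
      unfolding L_def prod.case
      by (rule continuous_on_coordinatewise_then_product) (intro continuous_intros)
    then show "continuous_on UNIV (\<lambda>s. \<psi> (s, r))"
      unfolding \<psi>_def
      by (intro continuous_on_sum continuous_on_mult continuous_on_const continuous_on_compose2[OF F(4)]) simp_all
  qed
  have "(\<integral>x. Y g x * f (?V x) \<partial>P) = (\<integral>x. Y g x * f (L (Y g x, ?R x)) \<partial>P)"
    by (rule integral_cong_AE) (use AE in auto)
  also have "\<dots> = (\<integral>z. (case z of (s, r) \<Rightarrow> s * f (L (s, r))) \<partial>(?N \<Otimes>\<^sub>M ?Q))"
    unfolding law[symmetric] by (subst integral_distr) simp_all
  also have "\<dots> = (\<integral>r. (\<integral>s. s * f (L (s, r)) \<partial>?N) \<partial>?Q)"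
    by (rule NQ.integral_snd[symmetric, OF i1])
  also have "\<dots> = (\<integral>r. (\<integral>s. \<psi> (s, r) \<partial>?N) \<partial>?Q)" by (simp only: inner_ibp)
  also have "\<dots> = (\<integral>z. \<psi> z \<partial>(?N \<Otimes>\<^sub>M ?Q))"
    using NQ.integral_snd[of "\<lambda>s r. \<psi> (s, r)"] i\<psi> by simp
  also have "\<dots> = (\<integral>x. \<psi> (Y g x, ?R x) \<partial>P)"
    unfolding law[symmetric] by (subst integral_distr) simp_all
  also have "\<dots> = (\<integral>x. (\<Sum>j<n. inner g (h j) * pderivative j f (?V x)) \<partial>P)"
    by (rule integral_cong_AE) (use AE in \<open>auto simp: \<psi>_def a_def\<close>)
  finally show ?thesis .
qed

lemma ibp:
  fixes h :: "nat \<Rightarrow> 'h"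
  assumes f: "c1_bounded n f"
  shows "(\<integral>x. Y g x * f (\<lambda>i. Y (h i) x) \<partial>P) =
    (\<integral>x. (\<Sum>j<n. inner g (h j) * pderivative j f (\<lambda>i. Y (h i) x)) \<partial>P)"
proof (cases "g = 0")
  case True
  have "(\<integral>x. Y g x * f (\<lambda>i. Y (h i) x) \<partial>P) = 0"
    by (rule integral_eq_zero_AE) (use Y_zero True in auto)
  then show ?thesis using True by simp
next
  case False
  note [measurable] = c1_bounded_measurable[OF f]
  define e where "e = (1 / norm g) *\<^sub>R g"
  have e: "norm e = 1" "norm g *\<^sub>R e = g" using False by (auto simp: e_def)
  have "(\<integral>x. Y g x * f (\<lambda>i. Y (h i) x) \<partial>P) = (\<integral>x. norm g * (Y e x * f (\<lambda>i. Y (h i) x)) \<partial>P)"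
    using Y_scale[of "norm g" e] unfolding e by (intro integral_cong_AE) auto
  also have "\<dots> = norm g * (\<integral>x. (\<Sum>j<n. inner e (h j) * pderivative j f (\<lambda>i. Y (h i) x)) \<partial>P)"
    by (simp add: ibp_unit[OF f e(1)])
  also have "\<dots> = (\<integral>x. (\<Sum>j<n. inner (norm g *\<^sub>R e) (h j) * pderivative j f (\<lambda>i. Y (h i) x)) \<partial>P)"
    by (subst integral_mult_right_zero[symmetric]) (simp add: sum_distrib_left mult.assoc)
  finally show ?thesis unfolding e(2) .
qed

end

section \<open>Convergence in mean square\<close>

lemma L2_integrable_mult:
  fixes f g :: "'a \<Rightarrow> real"
  assumes [measurable]: "f \<in> borel_measurable M" "g \<in> borel_measurable M"
    and f: "integrable M (\<lambda>x. (f x)\<^sup>2)" and g: "integrable M (\<lambda>x. (g x)\<^sup>2)"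
  shows "integrable M (\<lambda>x. f x * g x)"
proof (rule Bochner_Integration.integrable_bound)
  show "integrable M (\<lambda>x. (f x)\<^sup>2 + (g x)\<^sup>2)" using f g by simp
  show "AE x in M. norm (f x * g x) \<le> norm ((f x)\<^sup>2 + (g x)\<^sup>2)"
  proof (rule AE_I2)
    fix x
    have "2 * (\<bar>f x\<bar> * \<bar>g x\<bar>) \<le> (f x)\<^sup>2 + (g x)\<^sup>2"
      using zero_le_power2[of "\<bar>f x\<bar> - \<bar>g x\<bar>"] by (simp add: power2_diff)
    moreover have "0 \<le> \<bar>f x\<bar> * \<bar>g x\<bar>" by simp
    ultimately show "norm (f x * g x) \<le> norm ((f x)\<^sup>2 + (g x)\<^sup>2)" by (simp only: real_norm_def abs_mult)
  qed
qed simp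

lemma L2_Cauchy_Schwarz:
  fixes f g :: "'a \<Rightarrow> real"
  assumes [measurable]: "f \<in> borel_measurable M" "g \<in> borel_measurable M"
    and f: "integrable M (\<lambda>x. (f x)\<^sup>2)" and g: "integrable M (\<lambda>x. (g x)\<^sup>2)"
  shows "(\<integral>x. \<bar>f x * g x\<bar> \<partial>M)\<^sup>2 \<le> (\<integral>x. (f x)\<^sup>2 \<partial>M) * (\<integral>x. (g x)\<^sup>2 \<partial>M)"
proof -
  have i: "integrable M (\<lambda>x. \<bar>f x * g x\<bar>)" using L2_integrable_mult[OF assms] by (rule integrable_abs)
  have "(\<integral>\<^sup>+x. ennreal \<bar>f x\<bar> * ennreal \<bar>g x\<bar> \<partial>M)\<^sup>2 \<le> (\<integral>\<^sup>+x. (ennreal \<bar>f x\<bar>)\<^sup>2 \<partial>M) * (\<integral>\<^sup>+x. (ennreal \<bar>g x\<bar>)\<^sup>2 \<partial>M)"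
    by (rule Cauchy_Schwarz_nn_integral) auto
  also have "(\<integral>\<^sup>+x. ennreal \<bar>f x\<bar> * ennreal \<bar>g x\<bar> \<partial>M) = ennreal (\<integral>x. \<bar>f x * g x\<bar> \<partial>M)"
    using i by (subst nn_integral_eq_integral[symmetric]) (auto simp: abs_mult ennreal_mult)
  also have "(\<integral>\<^sup>+x. (ennreal \<bar>f x\<bar>)\<^sup>2 \<partial>M) = ennreal (\<integral>x. (f x)\<^sup>2 \<partial>M)"
    using f by (subst nn_integral_eq_integral[symmetric]) (auto simp: ennreal_power)
  also have "(\<integral>\<^sup>+x. (ennreal \<bar>g x\<bar>)\<^sup>2 \<partial>M) = ennreal (\<integral>x. (g x)\<^sup>2 \<partial>M)"
    using g by (subst nn_integral_eq_integral[symmetric]) (auto simp: ennreal_power)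
  finally show ?thesis
    by (simp add: ennreal_power ennreal_mult[symmetric] integral_nonneg)
qed

lemma sq_integrable_diff:
  assumes "sq_integrable M f" "sq_integrable M g"
  shows "sq_integrable M (\<lambda>x. f x - g x)"
proof -
  have [measurable]: "f \<in> borel_measurable M" "g \<in> borel_measurable M"
    using assms by (auto simp: sq_integrable_def)
  have "integrable M (\<lambda>x. (norm (f x - g x))\<^sup>2)"
  proof (rule Bochner_Integration.integrable_bound)
    show "integrable M (\<lambda>x. 2 * (norm (f x))\<^sup>2 + 2 * (norm (g x))\<^sup>2)" using assms by (simp add: sq_integrable_def)
    show "AE x in M. norm ((norm (f x - g x))\<^sup>2) \<le> norm (2 * (norm (f x))\<^sup>2 + 2 * (norm (g x))\<^sup>2)"
    proof (rule AE_I2)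
      fix x
      have "(norm (f x - g x))\<^sup>2 \<le> (norm (f x) + norm (g x))\<^sup>2"
        by (intro power_mono norm_triangle_ineq4) simp
      also have "\<dots> \<le> 2 * (norm (f x))\<^sup>2 + 2 * (norm (g x))\<^sup>2"
        using zero_le_power2[of "norm (f x) - norm (g x)"] by (simp add: power2_diff power2_sum)
      finally show "norm ((norm (f x - g x))\<^sup>2) \<le> norm (2 * (norm (f x))\<^sup>2 + 2 * (norm (g x))\<^sup>2)" by simp
    qed
  qed simp
  then show ?thesis by (simp add: sq_integrable_def)
qed

lemma bounded_sq_integrable:
  assumes "finite_measure M" "f \<in> borel_measurable M" "\<And>x. norm (f x) \<le> C"
  shows "sq_integrable M f"
  unfolding sq_integrable_def
proof
  show "integrable M (\<lambda>x. (norm (f x))\<^sup>2)"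
    by (rule finite_measure.integrable_const_bound[OF assms(1), where B="C\<^sup>2"])
       (use assms in \<open>auto intro!: AE_I2 power_mono\<close>)
qed fact

lemma sq_integrable_indicator:
  assumes "finite_measure M" "A \<in> sets M"
  shows "sq_integrable M (indicator A :: 'a \<Rightarrow> real)"
  using assms by (intro bounded_sq_integrable[where C=1]) (auto simp: indicator_def)

lemma sq_integrable_mult_integrable:
  fixes f g :: "'a \<Rightarrow> real"
  assumes "sq_integrable M f" "sq_integrable M g"
  shows "integrable M (\<lambda>x. f x * g x)"
  using assms by (auto intro!: L2_integrable_mult simp: sq_integrable_def)

definition L2_tendsto ::
  "'a measure \<Rightarrow> (nat \<Rightarrow> 'a \<Rightarrow> 'b::{banach, second_countable_topology}) \<Rightarrow> ('a \<Rightarrow> 'b) \<Rightarrow> bool" where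
  "L2_tendsto M fs f \<longleftrightarrow> (\<forall>k. sq_integrable M (fs k)) \<and> sq_integrable M f \<and>
     (\<lambda>k. \<integral>x. (norm (fs k x - f x))\<^sup>2 \<partial>M) \<longlonglongrightarrow> 0"

lemma L2_tendsto_const: "sq_integrable M f \<Longrightarrow> L2_tendsto M (\<lambda>_. f) f"
  by (simp add: L2_tendsto_def)

lemma L2_tendsto_nn:
  assumes "\<And>k. sq_integrable M (fs k)" "sq_integrable M f"
    and "(\<lambda>k. \<integral>\<^sup>+x. ennreal ((norm (fs k x - f x))\<^sup>2) \<partial>M) \<longlonglongrightarrow> 0"
  shows "L2_tendsto M fs f"
proof -
  have i: "integrable M (\<lambda>x. (norm (fs k x - f x))\<^sup>2)" for k
    using sq_integrable_diff[OF assms(1,2)] by (simp add: sq_integrable_def)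
  have "(\<integral>\<^sup>+x. ennreal ((norm (fs k x - f x))\<^sup>2) \<partial>M) = ennreal (\<integral>x. (norm (fs k x - f x))\<^sup>2 \<partial>M)" for k
    by (rule nn_integral_eq_integral[OF i]) simp
  with assms(3) have "(\<lambda>k. ennreal (\<integral>x. (norm (fs k x - f x))\<^sup>2 \<partial>M)) \<longlonglongrightarrow> ennreal 0" by simp
  then have "(\<lambda>k. \<integral>x. (norm (fs k x - f x))\<^sup>2 \<partial>M) \<longlonglongrightarrow> 0"
    by (subst (asm) tendsto_ennreal_iff) auto
  with assms show ?thesis by (simp add: L2_tendsto_def)
qed

lemma inner_square_le:
  fixes a w :: "'h::real_inner"
  shows "(inner a w)\<^sup>2 \<le> (norm w)\<^sup>2 * (norm a)\<^sup>2"
  using power_mono[OF Cauchy_Schwarz_ineq2[of a w], of 2] by (simp add: power_mult_distrib mult.commute)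

lemma sq_integrable_inner:
  fixes f :: "'a \<Rightarrow> 'h::{real_inner, banach, second_countable_topology}"
  assumes "sq_integrable M f"
  shows "sq_integrable M (\<lambda>x. inner (f x) w)"
proof -
  have [measurable]: "f \<in> borel_measurable M" using assms by (simp add: sq_integrable_def)
  have "integrable M (\<lambda>x. (norm (inner (f x) w))\<^sup>2)"
  proof (rule Bochner_Integration.integrable_bound)
    show "integrable M (\<lambda>x. (norm w)\<^sup>2 * (norm (f x))\<^sup>2)" using assms by (simp add: sq_integrable_def)
    show "AE x in M. norm ((norm (inner (f x) w))\<^sup>2) \<le> norm ((norm w)\<^sup>2 * (norm (f x))\<^sup>2)"
      by (intro AE_I2) (simp add: inner_square_le)
  qed simp
  then show ?thesis by (simp add: sq_integrable_def)
qed

lemma L2_tendsto_inner: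
  fixes f :: "'a \<Rightarrow> 'h::{real_inner, banach, second_countable_topology}"
  assumes L: "L2_tendsto M fs f"
  shows "L2_tendsto M (\<lambda>k x. inner (fs k x) w) (\<lambda>x. inner (f x) w)"
  unfolding L2_tendsto_def
proof (intro conjI allI)
  have S: "sq_integrable M (fs k)" "sq_integrable M f" for k using L by (auto simp: L2_tendsto_def)
  show "sq_integrable M (\<lambda>x. inner (fs k x) w)" "sq_integrable M (\<lambda>x. inner (f x) w)" for k
    using S by (auto intro: sq_integrable_inner)
  show "(\<lambda>k. \<integral>x. (norm (inner (fs k x) w - inner (f x) w))\<^sup>2 \<partial>M) \<longlonglongrightarrow> 0"
  proof (rule tendsto_sandwich[where f="\<lambda>_. 0" and h="\<lambda>k. (norm w)\<^sup>2 * (\<integral>x. (norm (fs k x - f x))\<^sup>2 \<partial>M)"])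
    show "\<forall>\<^sub>F k in sequentially. (\<integral>x. (norm (inner (fs k x) w - inner (f x) w))\<^sup>2 \<partial>M) \<le>
        (norm w)\<^sup>2 * (\<integral>x. (norm (fs k x - f x))\<^sup>2 \<partial>M)"
    proof (intro always_eventually allI)
      fix k
      have D: "sq_integrable M (\<lambda>x. fs k x - f x)" using S by (intro sq_integrable_diff)
      have "(\<integral>x. (norm (inner (fs k x) w - inner (f x) w))\<^sup>2 \<partial>M) \<le> (\<integral>x. (norm w)\<^sup>2 * (norm (fs k x - f x))\<^sup>2 \<partial>M)"
      proof (rule integral_mono)
        show "integrable M (\<lambda>x. (norm (inner (fs k x) w - inner (f x) w))\<^sup>2)"
          using sq_integrable_inner[OF D, of w] by (simp add: sq_integrable_def inner_diff_left)
        show "integrable M (\<lambda>x. (norm w)\<^sup>2 * (norm (fs k x - f x))\<^sup>2)"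
          using D by (simp add: sq_integrable_def)
        show "(norm (inner (fs k x) w - inner (f x) w))\<^sup>2 \<le> (norm w)\<^sup>2 * (norm (fs k x - f x))\<^sup>2" for x
          using inner_square_le[of "fs k x - f x" w] by (simp add: inner_diff_left)
      qed
      then show "(\<integral>x. (norm (inner (fs k x) w - inner (f x) w))\<^sup>2 \<partial>M) \<le>
        (norm w)\<^sup>2 * (\<integral>x. (norm (fs k x - f x))\<^sup>2 \<partial>M)" by simp
    qed
    show "(\<lambda>k. (norm w)\<^sup>2 * (\<integral>x. (norm (fs k x - f x))\<^sup>2 \<partial>M)) \<longlonglongrightarrow> 0"
      using L by (intro tendsto_mult_right_zero) (simp add: L2_tendsto_def)
  qed (auto intro: integral_nonneg)
qed

lemma L2_tendsto_integral_mult: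
  fixes f g T :: "'a \<Rightarrow> real"
  assumes f: "L2_tendsto M fs f" and g: "L2_tendsto M gs g"
    and T[measurable]: "T \<in> borel_measurable M" and TC: "\<And>x. \<bar>T x\<bar> \<le> C"
  shows "integrable M (\<lambda>x. fs k x * gs k x * T x)" "integrable M (\<lambda>x. f x * g x * T x)"
    "(\<lambda>k. \<integral>x. fs k x * gs k x * T x \<partial>M) \<longlonglongrightarrow> (\<integral>x. f x * g x * T x \<partial>M)"
proof -
  have S: "sq_integrable M (fs k)" "sq_integrable M (gs k)" "sq_integrable M f" "sq_integrable M g" for k
    using f g by (auto simp: L2_tendsto_def)
  have C0: "0 \<le> C" using TC[of undefined] by linarith
  have mult: "integrable M (\<lambda>x. a x * b x * T x)" "\<bar>\<integral>x. a x * b x * T x \<partial>M\<bar> \<le> C * sqrt ((\<integral>x. (norm (a x))\<^sup>2 \<partial>M) * (\<integral>x. (norm (b x))\<^sup>2 \<partial>M))"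
    if "sq_integrable M a" "sq_integrable M b" for a b :: "'a \<Rightarrow> real"
  proof -
    have [measurable]: "a \<in> borel_measurable M" "b \<in> borel_measurable M"
      and ab: "integrable M (\<lambda>x. (a x)\<^sup>2)" "integrable M (\<lambda>x. (b x)\<^sup>2)"
      using that by (auto simp: sq_integrable_def)
    have i: "integrable M (\<lambda>x. a x * b x)" by (rule sq_integrable_mult_integrable[OF that])
    have le: "\<bar>a x * b x * T x\<bar> \<le> C * \<bar>a x * b x\<bar>" for x
      unfolding abs_mult[of "a x * b x"] mult.commute[of C] by (intro mult_left_mono TC) simp
    show i2: "integrable M (\<lambda>x. a x * b x * T x)"
    proof (rule Bochner_Integration.integrable_bound)
      show "integrable M (\<lambda>x. C * \<bar>a x * b x\<bar>)" using i by simp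
      show "AE x in M. norm (a x * b x * T x) \<le> norm (C * \<bar>a x * b x\<bar>)"
        using le C0 by (intro AE_I2) simp
    qed simp
    have "\<bar>\<integral>x. a x * b x * T x \<partial>M\<bar> \<le> (\<integral>x. \<bar>a x * b x * T x\<bar> \<partial>M)" by (rule integral_abs_bound)
    also have "\<dots> \<le> (\<integral>x. C * \<bar>a x * b x\<bar> \<partial>M)"
      by (rule integral_mono) (use i i2 le in auto)
    also have "\<dots> = C * (\<integral>x. \<bar>a x * b x\<bar> \<partial>M)" by simp
    also have "\<dots> \<le> C * sqrt ((\<integral>x. (norm (a x))\<^sup>2 \<partial>M) * (\<integral>x. (norm (b x))\<^sup>2 \<partial>M))"
      using L2_Cauchy_Schwarz[OF _ _ ab] C0 by (intro mult_left_mono real_le_rsqrt) auto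
    finally show "\<bar>\<integral>x. a x * b x * T x \<partial>M\<bar> \<le> C * sqrt ((\<integral>x. (norm (a x))\<^sup>2 \<partial>M) * (\<integral>x. (norm (b x))\<^sup>2 \<partial>M))" .
  qed
  show "integrable M (\<lambda>x. fs k x * gs k x * T x)" "integrable M (\<lambda>x. f x * g x * T x)" for k
    by (intro mult S)+
  define p where "p k x = fs k x - f x" for k x
  define q where "q k x = gs k x - g x" for k x
  have pq: "sq_integrable M (p k)" "sq_integrable M (q k)" for k
    unfolding p_def q_def by (intro sq_integrable_diff S)+
  have z: "(\<lambda>k. \<integral>x. (norm (p k x))\<^sup>2 \<partial>M) \<longlonglongrightarrow> 0" "(\<lambda>k. \<integral>x. (norm (q k x))\<^sup>2 \<partial>M) \<longlonglongrightarrow> 0"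
    using f g by (auto simp: L2_tendsto_def p_def q_def)
  have e: "(\<integral>x. fs k x * gs k x * T x \<partial>M) = (\<integral>x. f x * g x * T x \<partial>M) + ((\<integral>x. p k x * g x * T x \<partial>M) +
      (\<integral>x. f x * q k x * T x \<partial>M) + (\<integral>x. p k x * q k x * T x \<partial>M))" for k
  proof -
    have "(\<integral>x. fs k x * gs k x * T x \<partial>M) = (\<integral>x. f x * g x * T x + (p k x * g x * T x + f x * q k x * T x + p k x * q k x * T x) \<partial>M)"
      by (intro Bochner_Integration.integral_cong) (auto simp: p_def q_def algebra_simps)
    also have "\<dots> = (\<integral>x. f x * g x * T x \<partial>M) + ((\<integral>x. p k x * g x * T x \<partial>M) +
      (\<integral>x. f x * q k x * T x \<partial>M) + (\<integral>x. p k x * q k x * T x \<partial>M))"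
      using mult(1)[OF S(3,4)] mult(1)[OF pq(1) S(4), of k] mult(1)[OF S(3) pq(2), of k] mult(1)[OF pq(1) pq(2), of k k]
      by simp
    finally show ?thesis .
  qed
  have null: "(\<lambda>k. \<integral>x. a k x * b k x * T x \<partial>M) \<longlonglongrightarrow> 0"
    if "\<And>k. sq_integrable M (a k)" "\<And>k. sq_integrable M (b k)"
      "(\<lambda>k. (\<integral>x. (norm (a k x))\<^sup>2 \<partial>M) * (\<integral>x. (norm (b k x))\<^sup>2 \<partial>M)) \<longlonglongrightarrow> 0" for a b :: "nat \<Rightarrow> 'a \<Rightarrow> real"
  proof (rule Lim_null_comparison)
    show "(\<lambda>k. C * sqrt ((\<integral>x. (norm (a k x))\<^sup>2 \<partial>M) * (\<integral>x. (norm (b k x))\<^sup>2 \<partial>M))) \<longlonglongrightarrow> 0"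
      using tendsto_real_sqrt[OF that(3)] by (intro tendsto_mult_right_zero) simp
  qed (use mult(2)[OF that(1,2)] in simp)
  note t1 = null[of p "\<lambda>_. g", OF pq(1) S(4) tendsto_mult_left_zero[OF z(1)]]
    and t2 = null[of "\<lambda>_. f" q, OF S(3) pq(2) tendsto_mult_right_zero[OF z(2)]]
    and t3 = null[of p q, OF pq tendsto_mult_zero[OF z]]
  show "(\<lambda>k. \<integral>x. fs k x * gs k x * T x \<partial>M) \<longlonglongrightarrow> (\<integral>x. f x * g x * T x \<partial>M)"
    unfolding e using tendsto_add[OF tendsto_const tendsto_add[OF tendsto_add[OF t1 t2] t3]] by simp
qed

lemma L2_tendsto_AE_subseq:
  assumes L: "L2_tendsto M fs f"
  shows "\<exists>r::nat \<Rightarrow> nat. strict_mono r \<and> (AE x in M. (\<lambda>k. fs (r k) x) \<longlonglongrightarrow> f x)"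
proof -
  have "sq_integrable M (\<lambda>x. fs k x - f x)" for k
    using L by (intro sq_integrable_diff) (auto simp: L2_tendsto_def)
  then have "\<exists>r::nat \<Rightarrow> nat. strict_mono r \<and> (AE x in M. (\<lambda>k. (norm (fs (r k) x - f x))\<^sup>2) \<longlonglongrightarrow> 0)"
    using L by (intro tendsto_L1_AE_subseq) (auto simp: sq_integrable_def L2_tendsto_def)
  then obtain r :: "nat \<Rightarrow> nat" where r: "strict_mono r" "AE x in M. (\<lambda>k. (norm (fs (r k) x - f x))\<^sup>2) \<longlonglongrightarrow> 0" by auto
  from r(2) have "AE x in M. (\<lambda>k. fs (r k) x) \<longlonglongrightarrow> f x"
  proof eventually_elim
    case (elim x)
    from tendsto_real_sqrt[OF this] have "(\<lambda>k. norm (fs (r k) x - f x)) \<longlonglongrightarrow> 0" by simp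
    then show ?case by (metis LIM_zero_cancel tendsto_norm_zero_cancel)
  qed
  with r(1) show ?thesis by auto
qed

text \<open>A limit of functions of \<open>V\<close> is again a function of \<open>V\<close>, because a subsequence converges almost
  everywhere.\<close>

lemma L2_limit_factorizes:
  fixes fs :: "nat \<Rightarrow> 'b::topological_space \<Rightarrow> 'c::{banach, second_countable_topology}"
  assumes "L2_tendsto M (\<lambda>k x. fs k (V x)) f" and [measurable]: "\<And>k. fs k \<in> borel_measurable borel"
  obtains \<alpha> where "\<alpha> \<in> borel_measurable borel" "AE x in M. f x = \<alpha> (V x)"
proof -
  from L2_tendsto_AE_subseq[OF assms(1)] obtain r :: "nat \<Rightarrow> nat"
    where "AE x in M. (\<lambda>k. fs (r k) (V x)) \<longlonglongrightarrow> f x" by auto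
  then have "AE x in M. f x = lim (\<lambda>k. fs (r k) (V x))" by eventually_elim (simp add: limI)
  then show ?thesis by (intro that[of "\<lambda>y. lim (\<lambda>k. fs (r k) y)"]) auto
qed

text \<open>Since the weight is a function of \<open>V\<close>, the events that it is positive or negative are among those
  on which its integral is known to vanish.\<close>

lemma weight_eq_0_AE:
  fixes z :: "'a \<Rightarrow> real" and V :: "'a \<Rightarrow> nat \<Rightarrow> real"
  assumes z: "integrable M z" and V[measurable]: "V \<in> borel_measurable M"
    and \<zeta>[measurable]: "\<zeta> \<in> borel_measurable borel" and AE: "AE x in M. z x = \<zeta> (V x)"
    and C: "\<And>n c. (\<integral>x. z x * cos (\<Sum>j<n. c j * V x j) \<partial>M) = 0"
    and S: "\<And>n c. (\<integral>x. z x * sin (\<Sum>j<n. c j * V x j) \<partial>M) = 0"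
  shows "AE x in M. z x = 0"
proof -
  have [measurable]: "z \<in> borel_measurable M" using z by auto
  have i: "integrable M (\<lambda>x. z x * indicator A (V x))" if [measurable]: "A \<in> sets borel" for A :: "(nat \<Rightarrow> real) set"
    by (rule integrable_mult_le_1[OF z]) (auto simp: indicator_def)
  let ?p = "{y. \<zeta> y > 0}" and ?n = "{y. \<zeta> y < 0}"
  have "(\<integral>x. z x * indicator ?p (V x) \<partial>M) = 0" by (rule weighted_trig_moments_vanish[OF z V C S]) simp
  moreover have "AE x in M. 0 \<le> z x * indicator ?p (V x)" using AE by eventually_elim (auto simp: indicator_def)
  ultimately have 1: "AE x in M. z x * indicator ?p (V x) = 0"
    using integral_nonneg_eq_0_iff_AE[OF i[of ?p]] by simp
  have "(\<integral>x. z x * indicator ?n (V x) \<partial>M) = 0" by (rule weighted_trig_moments_vanish[OF z V C S]) simp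
  moreover have "AE x in M. 0 \<le> - (z x * indicator ?n (V x))" using AE by eventually_elim (auto simp: indicator_def)
  ultimately have 2: "AE x in M. - (z x * indicator ?n (V x)) = 0"
    using integral_nonneg_eq_0_iff_AE[OF Bochner_Integration.integrable_minus[OF i[of ?n]]] by simp
  from 1 2 AE show ?thesis by eventually_elim (auto simp: indicator_def split: if_splits)
qed

section \<open>Closed gradients\<close>

text \<open>The closure of the gradient on \<open>c1_bounded\<close> functions of the field. It contains the constants,
  which lie in the domain of the gradient on rapidly decreasing functionals only after a cutoff, and so lets
  \<open>test_ibp_product\<close> with \<open>B = 1\<close> be the weak definition of a gradient.\<close>

definition sobolev_pair ::
  "'a measure \<Rightarrow> ('h::{real_inner, banach, second_countable_topology} \<Rightarrow> 'a \<Rightarrow> real) \<Rightarrow>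
   (nat \<Rightarrow> 'h) \<Rightarrow> ('a \<Rightarrow> real) \<Rightarrow> ('a \<Rightarrow> 'h) \<Rightarrow> bool" where
  "sobolev_pair P Y h F G \<longleftrightarrow> (\<exists>n f. (\<forall>k. c1_bounded (n k) (f k)) \<and>
     L2_tendsto P (\<lambda>k x. f k (\<lambda>i. Y (h i) x)) F \<and>
     L2_tendsto P (\<lambda>k x. \<Sum>j<n k. pderivative j (f k) (\<lambda>i. Y (h i) x) *\<^sub>R h j) G)"

lemma sobolev_pair_const:
  assumes "finite_measure P"
  shows "sobolev_pair P Y h (\<lambda>_. c) (\<lambda>_. 0)"
proof -
  interpret finite_measure P by fact
  have "c1_bounded 0 (\<lambda>_. c)" by (rule c1_boundedI) auto
  then show ?thesis unfolding sobolev_pair_def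
    by (intro exI[of _ "\<lambda>_. 0"] exI[of _ "\<lambda>_ _. c"]) (simp add: L2_tendsto_def sq_integrable_def)
qed

lemma is_grad_sobolev_pair:
  fixes Y :: "'h::{real_inner, banach, second_countable_topology} \<Rightarrow> 'a \<Rightarrow> real"
  assumes "gauss_field P Y" and G: "is_grad P Y h F G"
  shows "sobolev_pair P Y h F G"
proof -
  interpret gauss_field P Y by fact
  from G obtain n f where S: "\<And>k. schwartz (n k) (f k)"
    and 1: "(\<lambda>k::nat. \<integral>\<^sup>+\<omega>. ennreal ((f k (\<lambda>i. Y (h i) \<omega>) - F \<omega>)\<^sup>2) \<partial>P) \<longlonglongrightarrow> 0"
    and 2: "(\<lambda>k::nat. \<integral>\<^sup>+\<omega>. ennreal ((norm
            ((\<Sum>i<n k. pderivative i (f k) (\<lambda>j. Y (h j) \<omega>) *\<^sub>R h i) - G \<omega>))\<^sup>2) \<partial>P) \<longlonglongrightarrow> 0"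
    and FG: "sq_integrable P F" "sq_integrable P G"
    unfolding is_grad_def by blast
  have c: "c1_bounded (n k) (f k)" for k by (rule schwartz_c1_bounded[OF S])
  note [measurable] = c1_bounded_measurable[OF c]
  have f: "sq_integrable P (\<lambda>x. f k (\<lambda>i. Y (h i) x))" for k
  proof -
    obtain C where "\<And>x. \<bar>f k x\<bar> \<le> C" using c1_boundedD(3)[OF c] by (auto simp: bounded_real)
    then show ?thesis by (intro bounded_sq_integrable[where C=C]) (auto intro: finite_measure_axioms)
  qed
  have d: "sq_integrable P (\<lambda>x. \<Sum>j<n k. pderivative j (f k) (\<lambda>i. Y (h i) x) *\<^sub>R h j)" for k
  proof -
    have "\<exists>C. \<forall>x. \<bar>pderivative j (f k) x\<bar> \<le> C" for j
      using c1_boundedD(5)[OF c] by (auto simp: bounded_real)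
    then obtain C where C: "\<And>j x. \<bar>pderivative j (f k) x\<bar> \<le> C j" by metis
    show ?thesis
    proof (rule bounded_sq_integrable[where C="\<Sum>j<n k. C j * norm (h j)"])
      show "norm (\<Sum>j<n k. pderivative j (f k) (\<lambda>i. Y (h i) x) *\<^sub>R h j) \<le> (\<Sum>j<n k. C j * norm (h j))" for x
        by (rule order_trans[OF norm_sum]) (auto intro!: sum_mono mult_right_mono C)
    qed (auto intro: finite_measure_axioms)
  qed
  show ?thesis
    unfolding sobolev_pair_def
  proof (intro exI conjI allI)
    show "c1_bounded (n k) (f k)" for k by (rule c)
    show "L2_tendsto P (\<lambda>k x. f k (\<lambda>i. Y (h i) x)) F"
      using 1 by (intro L2_tendsto_nn f FG) simp
    show "L2_tendsto P (\<lambda>k x. \<Sum>j<n k. pderivative j (f k) (\<lambda>i. Y (h i) x) *\<^sub>R h j) G"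
      using 2 by (intro L2_tendsto_nn d FG) simp
  qed
qed

lemma inner_cylinder_gradient:
  fixes h :: "nat \<Rightarrow> 'h::real_inner"
  shows "inner (\<Sum>j<n. d j *\<^sub>R h j) w = (\<Sum>j<n. inner w (h j) * d j)"
  by (simp add: inner_sum_left inner_commute[of w] mult.commute)

lemma sobolev_ibp:
  fixes Y :: "'h::{real_inner, banach, second_countable_topology} \<Rightarrow> 'a \<Rightarrow> real"
  assumes "gauss_field P Y" and G: "sobolev_pair P Y h F G"
  shows "(\<integral>x. Y g x * F x \<partial>P) = (\<integral>x. inner (G x) g \<partial>P)"
proof -
  interpret gauss_field P Y by fact
  obtain n f where c: "\<And>k. c1_bounded (n k) (f k)"
    and F: "L2_tendsto P (\<lambda>k x. f k (\<lambda>i. Y (h i) x)) F"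
    and G: "L2_tendsto P (\<lambda>k x. \<Sum>j<n k. pderivative j (f k) (\<lambda>i. Y (h i) x) *\<^sub>R h j) G"
    using G unfolding sobolev_pair_def by blast
  have Yg: "L2_tendsto P (\<lambda>_. Y g) (Y g)"
    by (rule L2_tendsto_const) (simp add: sq_integrable_def second_moment)
  have one: "L2_tendsto P (\<lambda>_ _. 1::real) (\<lambda>_. 1)"
    by (rule L2_tendsto_const) (simp add: sq_integrable_def)
  have "(\<lambda>k. \<integral>x. Y g x * f k (\<lambda>i. Y (h i) x) * 1 \<partial>P) \<longlonglongrightarrow> (\<integral>x. Y g x * F x * 1 \<partial>P)"
    by (rule L2_tendsto_integral_mult(3)[OF Yg F]) auto
  moreover have "(\<lambda>k. \<integral>x. inner (\<Sum>j<n k. pderivative j (f k) (\<lambda>i. Y (h i) x) *\<^sub>R h j) g * 1 * 1 \<partial>P)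
       \<longlonglongrightarrow> (\<integral>x. inner (G x) g * 1 * 1 \<partial>P)"
    by (rule L2_tendsto_integral_mult(3)[OF L2_tendsto_inner[OF G] one]) auto
  moreover have "(\<integral>x. Y g x * f k (\<lambda>i. Y (h i) x) \<partial>P) = (\<integral>x. inner (\<Sum>j<n k. pderivative j (f k) (\<lambda>i. Y (h i) x) *\<^sub>R h j) g \<partial>P)" for k
    by (simp add: ibp[OF c] inner_cylinder_gradient)
  ultimately show ?thesis by (simp add: LIMSEQ_unique)
qed

text \<open>The growth condition makes both terms that integration by parts in the direction \<open>h i\<close> moves to the
  test function bounded.\<close>

definition test_function :: "nat \<Rightarrow> nat \<Rightarrow> ((nat \<Rightarrow> real) \<Rightarrow> real) \<Rightarrow> bool" where
  "test_function i n S \<longleftrightarrow> c1_bounded n S \<and> bounded (range (\<lambda>y. y i * S y))"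

text \<open>For cylinder functions this is integration by parts for the product of \<open>A\<close>, \<open>B\<close> and \<open>S\<close>. The product
  of the approximants converges only in \<open>L\<^sup>1\<close>, which suffices because the factor \<open>T\<close> is bounded.\<close>

lemma test_ibp_product:
  fixes Y :: "'h::{real_inner, banach, second_countable_topology} \<Rightarrow> 'a \<Rightarrow> real"
  assumes "gauss_field P Y" and A: "sobolev_pair P Y h A A'" and B: "sobolev_pair P Y h B B'"
    and S: "test_function i n S"
  defines "T \<equiv> \<lambda>x. Y (h i) x * S (\<lambda>j. Y (h j) x) - (\<Sum>j<n. inner (h i) (h j) * pderivative j S (\<lambda>j. Y (h j) x))"
  shows "(\<integral>x. A x * B x * T x \<partial>P) =
      (\<integral>x. (A x * inner (B' x) (h i) + B x * inner (A' x) (h i)) * S (\<lambda>j. Y (h j) x) \<partial>P)" (is "_ = ?r")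
proof -
  interpret gauss_field P Y by fact
  let ?V = "\<lambda>x j. Y (h j) x"
  have Sc: "c1_bounded n S" using S by (simp add: test_function_def)
  note [measurable] = c1_bounded_measurable[OF Sc]
  obtain na a where a: "\<And>k. c1_bounded (na k) (a k)"
    and LA: "L2_tendsto P (\<lambda>k x. a k (?V x)) A"
    and LA': "L2_tendsto P (\<lambda>k x. \<Sum>j<na k. pderivative j (a k) (?V x) *\<^sub>R h j) A'"
    using A unfolding sobolev_pair_def by blast
  obtain nb b where b: "\<And>k. c1_bounded (nb k) (b k)"
    and LB: "L2_tendsto P (\<lambda>k x. b k (?V x)) B"
    and LB': "L2_tendsto P (\<lambda>k x. \<Sum>j<nb k. pderivative j (b k) (?V x) *\<^sub>R h j) B'"
    using B unfolding sobolev_pair_def by blast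
  define da where "da k x = inner (\<Sum>j<na k. pderivative j (a k) (?V x) *\<^sub>R h j) (h i)" for k x
  define db where "db k x = inner (\<Sum>j<nb k. pderivative j (b k) (?V x) *\<^sub>R h j) (h i)" for k x
  have Lda: "L2_tendsto P da (\<lambda>x. inner (A' x) (h i))" unfolding da_def by (rule L2_tendsto_inner[OF LA'])
  have Ldb: "L2_tendsto P db (\<lambda>x. inner (B' x) (h i))" unfolding db_def by (rule L2_tendsto_inner[OF LB'])
  have [measurable]: "T \<in> borel_measurable P" unfolding T_def by measurable
  have "bounded (range (\<lambda>y. y i * S y - (\<Sum>j<n. inner (h i) (h j) * pderivative j S y)))"
  proof (rule bounded_minus_comp)
    show "bounded (range (\<lambda>y. \<Sum>j<n. inner (h i) (h j) * pderivative j S y))"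
      using c1_boundedD(5)[OF Sc] by (intro bounded_range_sum bounded_range_mult) auto
  qed (use S in \<open>simp add: test_function_def\<close>)
  then obtain C where C0: "\<And>y. \<bar>y i * S y - (\<Sum>j<n. inner (h i) (h j) * pderivative j S y)\<bar> \<le> C"
    by (auto simp: bounded_real)
  have C: "\<And>x. \<bar>T x\<bar> \<le> C" unfolding T_def by (rule C0)
  obtain D where D: "\<And>y. \<bar>S y\<bar> \<le> D" using c1_boundedD(3)[OF Sc] by (auto simp: bounded_real)
  have lim: "(\<lambda>k. \<integral>x. a k (?V x) * b k (?V x) * T x \<partial>P) \<longlonglongrightarrow> (\<integral>x. A x * B x * T x \<partial>P)"
    by (rule L2_tendsto_integral_mult(3)[OF LA LB _ C]) simp
  note 1 = L2_tendsto_integral_mult[OF LA Ldb, of "\<lambda>x. S (?V x)", OF _ D]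
  note 2 = L2_tendsto_integral_mult[OF LB Lda, of "\<lambda>x. S (?V x)", OF _ D]
  have eq: "(\<integral>x. a k (?V x) * b k (?V x) * T x \<partial>P) =
      (\<integral>x. a k (?V x) * db k x * S (?V x) \<partial>P) + (\<integral>x. b k (?V x) * da k x * S (?V x) \<partial>P)" for k
  proof -
    define m where "m = max n (max (na k) (nb k))"
    have am: "c1_bounded m (a k)" and bm: "c1_bounded m (b k)" and Sm: "c1_bounded m S"
      using c1_bounded_mono[OF a[of k]] c1_bounded_mono[OF b[of k]] c1_bounded_mono[OF Sc] by (auto simp: m_def)
    note abm = c1_bounded_mult(1)[OF am bm]
    have ext: "(\<Sum>j<n'. inner w (h j) * pderivative j f y) = (\<Sum>j<m. inner w (h j) * pderivative j f y)"
      if "c1_bounded n' f" "n' \<le> m" for f n' w y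
      using c1_bounded_pderivative_outside[OF that(1)] that(2) by (intro sum.mono_neutral_left) auto
    let ?D = "\<lambda>f y. \<Sum>j<m. inner (h i) (h j) * pderivative j f y"
    have da: "da k x = ?D (a k) (?V x)" and db: "db k x = ?D (b k) (?V x)" for x
      using ext[OF a[of k]] ext[OF b[of k]] by (simp_all add: da_def db_def inner_cylinder_gradient m_def)
    have T: "T x = Y (h i) x * S (?V x) - ?D S (?V x)" for x
      using ext[OF Sc] by (simp add: T_def m_def)
    let ?f = "\<lambda>y. a k y * b k y * S y"
    note fm = c1_bounded_mult(1)[OF abm Sm]
    have Df: "?D ?f y = (a k y * ?D (b k) y * S y + b k y * ?D (a k) y * S y) + a k y * b k y * ?D S y" for y
      unfolding c1_bounded_mult(2)[OF abm Sm] c1_bounded_mult(2)[OF am bm]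
      by (simp add: sum_distrib_left sum_distrib_right sum.distrib algebra_simps)
    have iT: "integrable P (\<lambda>x. a k (?V x) * b k (?V x) * T x)"
      by (rule L2_tendsto_integral_mult(1)[OF LA LB _ C]) simp
    have bd: "integrable P (\<lambda>x. a k (?V x) * b k (?V x) * ?D S (?V x))"
    proof -
      note [measurable] = c1_bounded_measurable[OF am] c1_bounded_measurable[OF bm]
      have "bounded (range (\<lambda>y. a k y * b k y * ?D S y))"
        using c1_boundedD(3)[OF am] c1_boundedD(3)[OF bm] c1_boundedD(5)[OF Sc]
        by (intro bounded_range_sum bounded_range_mult) auto
      from bounded_range_compose[OF this, of ?V] show ?thesis
        by (intro bounded_borel_integrable) (auto intro: finite_measure_axioms)
    qed
    have "(\<integral>x. a k (?V x) * b k (?V x) * T x \<partial>P) + (\<integral>x. a k (?V x) * b k (?V x) * ?D S (?V x) \<partial>P)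
        = (\<integral>x. a k (?V x) * b k (?V x) * T x + a k (?V x) * b k (?V x) * ?D S (?V x) \<partial>P)"
      using iT bd by simp
    also have "\<dots> = (\<integral>x. Y (h i) x * ?f (?V x) \<partial>P)"
      by (intro Bochner_Integration.integral_cong) (auto simp: T algebra_simps)
    also have "\<dots> = (\<integral>x. ?D ?f (?V x) \<partial>P)" by (rule ibp[OF fm])
    also have "\<dots> = (\<integral>x. (a k (?V x) * db k x * S (?V x) + b k (?V x) * da k x * S (?V x)) + a k (?V x) * b k (?V x) * ?D S (?V x) \<partial>P)"
      unfolding Df da db ..
    also have "\<dots> = (\<integral>x. a k (?V x) * db k x * S (?V x) \<partial>P) + (\<integral>x. b k (?V x) * da k x * S (?V x) \<partial>P)
        + (\<integral>x. a k (?V x) * b k (?V x) * ?D S (?V x) \<partial>P)"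
      using 1(1)[of k] 2(1)[of k] bd by simp
    finally show ?thesis by simp
  qed
  have "(\<lambda>k. \<integral>x. a k (?V x) * b k (?V x) * T x \<partial>P) \<longlonglongrightarrow>
     (\<integral>x. A x * inner (B' x) (h i) * S (?V x) \<partial>P) + (\<integral>x. B x * inner (A' x) (h i) * S (?V x) \<partial>P)"
    unfolding eq using 1(3) 2(3) by (intro tendsto_add) simp_all
  also have "(\<integral>x. A x * inner (B' x) (h i) * S (?V x) \<partial>P) + (\<integral>x. B x * inner (A' x) (h i) * S (?V x) \<partial>P) = ?r"
    using 1(2) 2(2) by (simp add: distrib_right)
  finally show ?thesis using lim by (blast intro: LIMSEQ_unique)
qed

section \<open>The product rule\<close>

lemma c1_bounded_linear_comp:
  fixes \<phi> \<phi>' :: "real \<Rightarrow> real" and c :: "nat \<Rightarrow> real"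
  assumes der: "\<And>r. (\<phi> has_real_derivative \<phi>' r) (at r)" and cont: "continuous_on UNIV \<phi>'"
    and "bounded (range \<phi>)" "bounded (range \<phi>')"
  shows "c1_bounded n (\<lambda>y. \<phi> (\<Sum>j<n. c j * y j))"
proof (rule c1_boundedI)
  let ?l = "\<lambda>y. \<Sum>j<n. c j * y j"
  have cl: "continuous_on UNIV ?l"
    by (intro continuous_intros continuous_on_product_then_coordinatewise continuous_on_id)
  have cphi: "continuous_on UNIV \<phi>" using der by (meson DERIV_isCont continuous_at_imp_continuous_on)
  show "\<phi> (?l x) = \<phi> (?l y)" if "\<And>i. i < n \<Longrightarrow> x i = y i" for x y
  proof -
    have "?l x = ?l y" by (rule sum.cong) (use that in auto)
    then show ?thesis by simp
  qed
  show "continuous_on UNIV (\<lambda>y. \<phi> (?l y))" by (rule continuous_on_compose2[OF cphi cl]) auto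
  show "bounded (range (\<lambda>y. \<phi> (?l y)))" by (rule bounded_range_compose[OF assms(3)])
  fix i assume i: "i < n"
  show "continuous_on UNIV (\<lambda>y. \<phi>' (?l y) * c i)"
    by (intro continuous_on_mult continuous_on_const continuous_on_compose2[OF cont cl]) auto
  show "bounded (range (\<lambda>y. \<phi>' (?l y) * c i))"
    by (rule bounded_range_mult[OF bounded_range_compose[OF assms(4)]]) simp
  fix x :: "nat \<Rightarrow> real"
  have "((\<lambda>r. \<Sum>j<n. c j * (x(i := r)) j) has_real_derivative (\<Sum>j<n. if j = i then c i else 0)) (at (x i))"
    by (rule DERIV_sum) (auto intro!: derivative_eq_intros)
  then have "((\<lambda>r. ?l (x(i := r))) has_real_derivative c i) (at (x i))"
    using i by (simp add: sum.delta)
  then show "((\<lambda>r. \<phi> (?l (x(i := r)))) has_real_derivative \<phi>' (?l x) * c i) (at (x i))"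
    using DERIV_chain2[OF der] by fastforce
qed

lemma abs_mult_exp_neg_square_le: "\<bar>r * exp (- r\<^sup>2)\<bar> \<le> (1::real)"
proof -
  have "2 * \<bar>r\<bar> \<le> 1 + r\<^sup>2" using zero_le_power2[of "\<bar>r\<bar> - 1"] by (simp add: power2_diff)
  then have "\<bar>r\<bar> \<le> exp (r\<^sup>2)" using exp_ge_add_one_self[of "r\<^sup>2"] by linarith
  then show ?thesis by (simp add: abs_mult exp_minus field_simps)
qed

lemma c1_bounded_gaussian: "c1_bounded (Suc i) (\<lambda>y. exp (- (y i)\<^sup>2))"
proof -
  let ?d = "\<lambda>j. if j = i then 1 else 0 :: real"
  have "c1_bounded (Suc i) (\<lambda>y. exp (- (\<Sum>j<Suc i. ?d j * y j)\<^sup>2))"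
  proof (rule c1_bounded_linear_comp)
    show "((\<lambda>r. exp (- r\<^sup>2)) has_real_derivative - 2 * (r * exp (- r\<^sup>2))) (at r)" for r :: real
      by (auto intro!: derivative_eq_intros)
    show "continuous_on UNIV (\<lambda>r::real. - 2 * (r * exp (- r\<^sup>2)))" by (intro continuous_intros)
    show "bounded (range (\<lambda>r::real. exp (- r\<^sup>2)))" by (auto simp: bounded_real intro!: exI[of _ 1])
    have "bounded (range (\<lambda>r::real. r * exp (- r\<^sup>2)))"
      using abs_mult_exp_neg_square_le unfolding bounded_real by blast
    then show "bounded (range (\<lambda>r::real. - 2 * (r * exp (- r\<^sup>2))))"
      by (rule bounded_range_mult[rotated]) auto
  qed
  moreover have "(\<Sum>j<Suc i. ?d j * y j) = y i" for y :: "nat \<Rightarrow> real"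
    by (simp add: if_distrib[of "\<lambda>a. a * _"] sum.delta cong: if_cong)
  ultimately show ?thesis by simp
qed

lemma test_function_trig:
  fixes \<phi> :: "real \<Rightarrow> real"
  assumes "\<phi> = cos \<or> \<phi> = sin"
  shows "test_function i (max n (Suc i)) (\<lambda>y. exp (- (y i)\<^sup>2) * \<phi> (\<Sum>j<n. c j * y j))"
proof -
  have b: "bounded (range \<phi>)" using assms by (auto simp: bounded_real intro!: exI[of _ 1])
  have "c1_bounded n (\<lambda>y. \<phi> (\<Sum>j<n. c j * y j))"
    using assms
  proof
    assume "\<phi> = cos" then show ?thesis
      using b by (auto intro!: c1_bounded_linear_comp[where \<phi>'="\<lambda>x. - sin x"] continuous_intros
          derivative_eq_intros exI[of _ 1] simp: bounded_real)
  next
    assume "\<phi> = sin" then show ?thesis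
      using b by (auto intro!: c1_bounded_linear_comp[where \<phi>'=cos] continuous_intros
          derivative_eq_intros exI[of _ 1] simp: bounded_real)
  qed
  from c1_bounded_mult(1)[OF c1_bounded_mono[OF c1_bounded_gaussian[of i], of "max n (Suc i)"] c1_bounded_mono[OF this, of "max n (Suc i)"]]
  have "c1_bounded (max n (Suc i)) (\<lambda>y. exp (- (y i)\<^sup>2) * \<phi> (\<Sum>j<n. c j * y j))" by simp
  moreover have "bounded (range (\<lambda>y. y i * (exp (- (y i)\<^sup>2) * \<phi> (\<Sum>j<n. c j * y j))))"
  proof -
    have "bounded (range (\<lambda>y::nat \<Rightarrow> real. y i * exp (- (y i)\<^sup>2)))"
      using abs_mult_exp_neg_square_le unfolding bounded_real by blast
    from bounded_range_mult[OF this bounded_range_compose[OF b, of "\<lambda>y. \<Sum>j<n. c j * y j"]]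
    show ?thesis by (simp add: mult.assoc)
  qed
  ultimately show ?thesis by (simp add: test_function_def)
qed

lemma sobolev_pair_factorizes:
  fixes Y :: "'h::{real_inner, banach, second_countable_topology} \<Rightarrow> 'a \<Rightarrow> real"
  assumes "sobolev_pair P Y h A A'"
  obtains \<alpha> \<beta> where "\<alpha> \<in> borel_measurable borel" "AE x in P. A x = \<alpha> (\<lambda>j. Y (h j) x)"
    "\<beta> \<in> borel_measurable borel" "AE x in P. inner (A' x) w = \<beta> (\<lambda>j. Y (h j) x)"
proof -
  from assms obtain n a where a: "\<And>k. c1_bounded (n k) (a k)"
    and LA: "L2_tendsto P (\<lambda>k x. a k (\<lambda>j. Y (h j) x)) A"
    and LA': "L2_tendsto P (\<lambda>k x. \<Sum>j<n k. pderivative j (a k) (\<lambda>j. Y (h j) x) *\<^sub>R h j) A'"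
    unfolding sobolev_pair_def by blast
  note [measurable] = c1_bounded_measurable[OF a]
  obtain \<alpha> where \<alpha>: "\<alpha> \<in> borel_measurable borel" "AE x in P. A x = \<alpha> (\<lambda>j. Y (h j) x)"
    by (rule L2_limit_factorizes[of P a "\<lambda>x j. Y (h j) x" A]) (use LA in auto)
  obtain \<beta> where \<beta>: "\<beta> \<in> borel_measurable borel" "AE x in P. inner (A' x) w = \<beta> (\<lambda>j. Y (h j) x)"
    by (rule L2_limit_factorizes[of P "\<lambda>k y. inner (\<Sum>j<n k. pderivative j (a k) y *\<^sub>R h j) w" "\<lambda>x j. Y (h j) x" "\<lambda>x. inner (A' x) w"])
       (use L2_tendsto_inner[OF LA', of w] in auto)
  from \<alpha> \<beta> show ?thesis by (rule that)
qed

lemma sobolev_pair_sq_integrable: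
  assumes "sobolev_pair P Y h A A'"
  shows "sq_integrable P A" "sq_integrable P A'"
  using assms unfolding sobolev_pair_def L2_tendsto_def by auto

lemma orthogonal_to_dense_eq_0:
  fixes z :: "'h::real_inner"
  assumes "closure (span (range h)) = UNIV" and "\<And>i. inner z (h i) = 0"
  shows "z = 0"
proof -
  have "span (range h) \<subseteq> {w. inner z w = 0}"
    by (rule span_minimal) (auto simp: assms(2) subspace_def inner_add_right)
  moreover have "closed {w. inner z w = 0}"
    by (intro closed_Collect_eq continuous_intros)
  ultimately have "closure (span (range h)) \<subseteq> {w. inner z w = 0}" by (rule closure_minimal)
  then have "z \<in> {w. inner z w = 0}" unfolding assms(1) by blast
  then show ?thesis by simp
qed

text \<open>The difference of the two sides is only integrable, so it is tested against bounded functions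
  of the coordinates: in the direction \<open>h i\<close>, against trigonometric functions damped by
  \<open>exp (- (Y (h i))\<^sup>2)\<close>.\<close>

theorem sobolev_product_rule:
  fixes Y :: "'h::{real_inner, banach, second_countable_topology} \<Rightarrow> 'a \<Rightarrow> real"
  assumes Y: "gauss_field P Y" and dense: "closure (span (range h)) = UNIV"
    and A: "sobolev_pair P Y h A A'" and B: "sobolev_pair P Y h B B'" and C: "sobolev_pair P Y h C C'"
    and eq: "AE x in P. l * C x = A x * B x"
  shows "AE x in P. l *\<^sub>R C' x = A x *\<^sub>R B' x + B x *\<^sub>R A' x"
proof -
  interpret gauss_field P Y by fact
  let ?V = "\<lambda>x j. Y (h j) x"
  have sq: "sq_integrable P A" "sq_integrable P A'" "sq_integrable P B" "sq_integrable P B'" "sq_integrable P C" "sq_integrable P C'"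
    using A B C by (auto dest: sobolev_pair_sq_integrable)
  then have [measurable]: "A \<in> borel_measurable P" "A' \<in> borel_measurable P" "B \<in> borel_measurable P" "B' \<in> borel_measurable P"
     "C \<in> borel_measurable P" "C' \<in> borel_measurable P"
    by (auto simp: sq_integrable_def)
  have "AE x in P. A x * inner (B' x) (h i) + B x * inner (A' x) (h i) - l * inner (C' x) (h i) = 0" for i
  proof -
    define z where "z x = A x * inner (B' x) (h i) + B x * inner (A' x) (h i) - l * inner (C' x) (h i)" for x
    have sqi: "sq_integrable P (\<lambda>x. inner (A' x) (h i))" "sq_integrable P (\<lambda>x. inner (B' x) (h i))" "sq_integrable P (\<lambda>x. inner (C' x) (h i))"
      using sq by (auto intro: sq_integrable_inner)
    have i1: "integrable P (\<lambda>x. A x * inner (B' x) (h i))" "integrable P (\<lambda>x. B x * inner (A' x) (h i))"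
      using sq sqi by (auto intro!: L2_integrable_mult simp: sq_integrable_def)
    have i2: "integrable P (\<lambda>x. inner (C' x) (h i))"
      by (rule square_integrable_imp_integrable) (use sqi in \<open>auto simp: sq_integrable_def\<close>)
    have iz: "integrable P z" unfolding z_def using i1 i2 by simp
    have [measurable]: "z \<in> borel_measurable P" using iz by auto
    have test: "(\<integral>x. z x * S (?V x) \<partial>P) = 0" if S: "test_function i n S" for n S
    proof -
      have c: "c1_bounded n S" using S by (simp add: test_function_def)
      note [measurable] = c1_bounded_measurable[OF c]
      obtain D where D: "\<And>y. \<bar>S y\<bar> \<le> D" using c1_boundedD(3)[OF c] by (auto simp: bounded_real)
      have D': "\<bar>S y\<bar> \<le> \<bar>D\<bar>" for y using D[of y] by linarith
      have iS: "integrable P (\<lambda>x. w x * S (?V x))" if w: "integrable P w" for w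
      proof (rule Bochner_Integration.integrable_bound)
        show "integrable P (\<lambda>x. \<bar>D\<bar> * w x)" using w by simp
        show "AE x in P. norm (w x * S (?V x)) \<le> norm (\<bar>D\<bar> * w x)"
          unfolding real_norm_def abs_mult abs_abs mult.commute[of "\<bar>D\<bar>"] by (intro AE_I2 mult_left_mono D') simp
      qed (use w in measurable)
      define T where "T x = Y (h i) x * S (?V x) - (\<Sum>j<n. inner (h i) (h j) * pderivative j S (?V x))" for x
      have [measurable]: "T \<in> borel_measurable P" unfolding T_def by measurable
      have "(\<integral>x. z x * S (?V x) \<partial>P) =
         (\<integral>x. (A x * inner (B' x) (h i) + B x * inner (A' x) (h i)) * S (?V x) - l * ((C x * inner 0 (h i) + 1 * inner (C' x) (h i)) * S (?V x)) \<partial>P)"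
        by (intro Bochner_Integration.integral_cong) (auto simp: z_def algebra_simps)
      also have "\<dots> = (\<integral>x. (A x * inner (B' x) (h i) + B x * inner (A' x) (h i)) * S (?V x) \<partial>P)
          - l * (\<integral>x. (C x * inner 0 (h i) + 1 * inner (C' x) (h i)) * S (?V x) \<partial>P)"
        using i1 i2 by (subst Bochner_Integration.integral_diff) (auto intro!: iS)
      also have "(\<integral>x. (A x * inner (B' x) (h i) + B x * inner (A' x) (h i)) * S (?V x) \<partial>P) = (\<integral>x. A x * B x * T x \<partial>P)"
        unfolding T_def by (rule test_ibp_product[OF Y A B S, symmetric])
      also have "(\<integral>x. (C x * inner 0 (h i) + 1 * inner (C' x) (h i)) * S (?V x) \<partial>P) = (\<integral>x. C x * 1 * T x \<partial>P)"
        unfolding T_def by (rule test_ibp_product[OF Y C sobolev_pair_const[OF finite_measure_axioms] S, symmetric])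
      also have "(\<integral>x. A x * B x * T x \<partial>P) = (\<integral>x. l * (C x * 1 * T x) \<partial>P)"
        by (rule integral_cong_AE) (use eq in auto)
      finally show ?thesis by simp
    qed
    let ?G = "\<lambda>y::nat \<Rightarrow> real. exp (- (y i)\<^sup>2)"
    have [measurable]: "?G \<in> borel_measurable borel"
      by (rule c1_bounded_measurable(1)[OF c1_bounded_gaussian])
    obtain \<alpha> \<alpha>' where a: "\<alpha> \<in> borel_measurable borel" "AE x in P. A x = \<alpha> (?V x)"
      "\<alpha>' \<in> borel_measurable borel" "AE x in P. inner (A' x) (h i) = \<alpha>' (?V x)"
      by (rule sobolev_pair_factorizes[OF A])
    obtain \<beta> \<beta>' where b: "\<beta> \<in> borel_measurable borel" "AE x in P. B x = \<beta> (?V x)"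
      "\<beta>' \<in> borel_measurable borel" "AE x in P. inner (B' x) (h i) = \<beta>' (?V x)"
      by (rule sobolev_pair_factorizes[OF B])
    obtain \<gamma> \<gamma>' where c: "\<gamma> \<in> borel_measurable borel" "AE x in P. C x = \<gamma> (?V x)"
      "\<gamma>' \<in> borel_measurable borel" "AE x in P. inner (C' x) (h i) = \<gamma>' (?V x)"
      by (rule sobolev_pair_factorizes[OF C])
    note [measurable] = a(1,3) b(1,3) c(1,3)
    have "AE x in P. z x * ?G (?V x) = 0"
    proof (rule weight_eq_0_AE)
      show "integrable P (\<lambda>x. z x * ?G (?V x))"
        by (rule integrable_mult_le_1[OF iz]) auto
      show "?V \<in> borel_measurable P" by simp
      show "(\<lambda>y. (\<alpha> y * \<beta>' y + \<beta> y * \<alpha>' y - l * \<gamma>' y) * ?G y) \<in> borel_measurable borel" by measurable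
      show "AE x in P. z x * ?G (?V x) = (\<alpha> (?V x) * \<beta>' (?V x) + \<beta> (?V x) * \<alpha>' (?V x) - l * \<gamma>' (?V x)) * ?G (?V x)"
        using a(2,4) b(2,4) c(4) by eventually_elim (simp add: z_def)
      show "(\<integral>x. z x * ?G (?V x) * cos (\<Sum>j<n. c j * ?V x j) \<partial>P) = 0" for n c
        using test[OF test_function_trig[of cos i n c]] by (simp add: mult.assoc)
      show "(\<integral>x. z x * ?G (?V x) * sin (\<Sum>j<n. c j * ?V x j) \<partial>P) = 0" for n c
        using test[OF test_function_trig[of sin i n c]] by (simp add: mult.assoc)
    qed
    then show ?thesis by eventually_elim (simp add: z_def)
  qed
  then have "AE x in P. \<forall>i. A x * inner (B' x) (h i) + B x * inner (A' x) (h i) - l * inner (C' x) (h i) = 0"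
    by (simp add: AE_all_countable)
  then show ?thesis
  proof eventually_elim
    case (elim x)
    have "A x *\<^sub>R B' x + B x *\<^sub>R A' x - l *\<^sub>R C' x = 0"
      by (rule orthogonal_to_dense_eq_0[OF dense]) (use elim in \<open>simp add: inner_diff_left inner_add_left\<close>)
    then show ?case by simp
  qed
qed

section \<open>Isonormal fields and the Cameron-Martin shift\<close>

lemma (in prob_space) centered_gaussian_moments:
  assumes G: "centered_gaussian M Y"
  shows "integrable M (\<lambda>x. (Y x)\<^sup>2)"
    and "(\<integral>x. cos (Y x) \<partial>M) = exp (- (\<integral>x. (Y x)\<^sup>2 \<partial>M) / 2)"
    and "(\<integral>x. sin (Y x) \<partial>M) = 0"
proof -
  have [measurable]: "Y \<in> borel_measurable M" using G by (simp add: centered_gaussian_def)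
  have "integrable M (\<lambda>x. (Y x)\<^sup>2) \<and> (\<integral>x. cos (Y x) \<partial>M) = exp (- (\<integral>x. (Y x)\<^sup>2 \<partial>M) / 2) \<and> (\<integral>x. sin (Y x) \<partial>M) = 0"
    using G unfolding centered_gaussian_def
  proof (elim conjE disjE exE)
    assume z: "AE x in M. Y x = 0"
    have "integrable M (\<lambda>x. (Y x)\<^sup>2) \<longleftrightarrow> integrable M (\<lambda>_. 0::real)"
      by (rule integrable_cong_AE) (use z in auto)
    moreover have "(\<integral>x. (Y x)\<^sup>2 \<partial>M) = (\<integral>x. 0 \<partial>M)" by (rule integral_cong_AE) (use z in auto)
    moreover have "(\<integral>x. cos (Y x) \<partial>M) = (\<integral>x. 1 \<partial>M)" by (rule integral_cong_AE) (use z in auto)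
    moreover have "(\<integral>x. sin (Y x) \<partial>M) = (\<integral>x. 0 \<partial>M)" by (rule integral_cong_AE) (use z in auto)
    ultimately show ?thesis by (simp add: prob_space)
  next
    fix \<sigma> :: real assume s: "0 < \<sigma>" and D: "distributed M lborel Y (\<lambda>x. ennreal (normal_density 0 \<sigma> x))"
    define Z where "Z x = Y x / \<sigma>" for x
    have [measurable]: "Z \<in> borel_measurable M" unfolding Z_def by measurable
    have YZ: "Y x = \<sigma> * Z x" for x using s by (simp add: Z_def)
    have "distributed M lborel Z (\<lambda>x. ennreal (std_normal_density x))"
      using D normal_standard_normal_convert[OF s, of Y 0] by (simp add: Z_def[abs_def])
    then have "distr M lborel Z = std_normal_distribution" by (simp add: distributed_distr_eq_density)
    then have law: "distr M borel Z = std_normal_distribution" by (metis distr_cong sets_lborel)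
    have "integrable (distr M borel Z) (\<lambda>x. x\<^sup>2)"
      unfolding law by (rule integrable_std_normal_distribution_moment)
    then have i: "integrable M (\<lambda>x. (Z x)\<^sup>2)" by (simp add: integrable_distr_eq)
    have "(\<integral>x. x\<^sup>2 \<partial>distr M borel Z) = 1"
      unfolding law using std_normal_distribution_even_moments(1)[of 1] by simp
    then have Z2: "(\<integral>x. (Z x)\<^sup>2 \<partial>M) = 1" by (simp add: integral_distr)
    have Y2: "(\<integral>x. (Y x)\<^sup>2 \<partial>M) = \<sigma>\<^sup>2" by (simp add: YZ power_mult_distrib Z2)
    have ie: "integrable M (\<lambda>x. iexp (\<sigma> * Z x))"
      by (rule integrable_const_bound[where B=1]) auto
    have "char (distr M borel Z) \<sigma> = complex_of_real (exp (- \<sigma>\<^sup>2 / 2))"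
      unfolding law by (simp add: char_std_normal_distribution)
    then have c: "(\<integral>x. iexp (\<sigma> * Z x) \<partial>M) = complex_of_real (exp (- \<sigma>\<^sup>2 / 2))"
      by (simp add: char_def integral_distr)
    have "(\<integral>x. cos (Y x) \<partial>M) = Re (\<integral>x. iexp (\<sigma> * Z x) \<partial>M)" "(\<integral>x. sin (Y x) \<partial>M) = Im (\<integral>x. iexp (\<sigma> * Z x) \<partial>M)"
      unfolding integral_Re[OF ie, symmetric] integral_Im[OF ie, symmetric]
      by (simp_all add: Re_exp Im_exp YZ)
    then have "(\<integral>x. cos (Y x) \<partial>M) = exp (- \<sigma>\<^sup>2 / 2)" "(\<integral>x. sin (Y x) \<partial>M) = 0"
      unfolding c by simp_all
    then show ?thesis using i Y2 by (simp add: YZ power_mult_distrib)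
  qed
  then show "integrable M (\<lambda>x. (Y x)\<^sup>2)" "(\<integral>x. cos (Y x) \<partial>M) = exp (- (\<integral>x. (Y x)\<^sup>2 \<partial>M) / 2)"
    "(\<integral>x. sin (Y x) \<partial>M) = 0" by auto
qed

text \<open>Linearity holds almost surely because the covariance determines the second moment of
  \<open>W (a g + b k) - a W g - b W k\<close>, which is zero.\<close>

lemma isonormal_gauss_field:
  fixes W :: "'h::real_inner \<Rightarrow> 'a \<Rightarrow> real"
  assumes "prob_space M" and W: "isonormal M W"
  shows "gauss_field M W"
proof -
  interpret prob_space M by fact
  have G: "centered_gaussian M (W g)" for g
    using W[unfolded isonormal_def centered_gaussian_family_def, THEN conjunct1, rule_format, of "{g}" "\<lambda>_. 1"] by simp
  have cov: "(\<integral>x. W g x * W k x \<partial>M) = inner g k" for g k using W by (simp add: isonormal_def)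
  have [measurable]: "W g \<in> borel_measurable M" for g using G by (simp add: centered_gaussian_def)
  have var: "(\<integral>x. (W g x)\<^sup>2 \<partial>M) = (norm g)\<^sup>2" for g
    using cov[of g g] by (simp add: power2_eq_square power2_norm_eq_inner[symmetric])
  have im: "integrable M (\<lambda>x. W g x * W k x)" for g k
    by (rule L2_integrable_mult) (auto intro: centered_gaussian_moments[OF G])
  show ?thesis
  proof
    show "(\<integral>x. cos (W g x) \<partial>M) = exp (- (norm g)\<^sup>2 / 2)" "(\<integral>x. sin (W g x) \<partial>M) = 0" for g
      using centered_gaussian_moments[OF G[of g]] by (simp_all add: var)
    fix a b :: real and g k :: 'h
    define m where "m = a *\<^sub>R g + b *\<^sub>R k"
    have e: "(W m x - a * W g x - b * W k x)\<^sup>2 = W m x * W m x + a * a * (W g x * W g x) + b * b * (W k x * W k x)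
        - 2 * a * (W m x * W g x) - 2 * b * (W m x * W k x) + 2 * a * b * (W g x * W k x)" for x
      by (simp add: power2_eq_square algebra_simps)
    have i: "integrable M (\<lambda>x. (W m x - a * W g x - b * W k x)\<^sup>2)"
      unfolding e by (intro Bochner_Integration.integrable_add Bochner_Integration.integrable_diff integrable_mult_right im)
    have "(\<integral>x. (W m x - a * W g x - b * W k x)\<^sup>2 \<partial>M) = inner m m + a * a * inner g g + b * b * inner k k
        - 2 * a * inner m g - 2 * b * inner m k + 2 * a * b * inner g k"
      unfolding e using im by (simp add: cov)
    also have "\<dots> = 0" by (simp add: m_def inner_add_left inner_add_right inner_commute[of k g] algebra_simps)
    finally have "AE x in M. (W m x - a * W g x - b * W k x)\<^sup>2 = 0"
      using integral_nonneg_eq_0_iff_AE[OF i] by simp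
    then show "AE x in M. W (a *\<^sub>R g + b *\<^sub>R k) x = a * W g x + b * W k x"
      unfolding m_def[symmetric] by eventually_elim simp
  qed simp
qed

context gauss_field begin

definition cm_density :: "'h \<Rightarrow> 'a \<Rightarrow> real" where
  "cm_density v x = exp (Y v x - (norm v)\<^sup>2 / 2)"

lemma cm_density_measurable[measurable]: "cm_density v \<in> borel_measurable P"
  unfolding cm_density_def by measurable

text \<open>Along \<open>v\<close> the density turns the standard normal density into its translate; the part of \<open>g\<close>
  orthogonal to \<open>v\<close> is independent of the density.\<close>

lemma cameron_martin:
  fixes \<psi> :: "real \<Rightarrow> ennreal"
  assumes [measurable]: "\<psi> \<in> borel_measurable borel"
  shows "(\<integral>\<^sup>+x. ennreal (cm_density v x) * \<psi> (Y g x - inner g v) \<partial>P) = (\<integral>\<^sup>+x. \<psi> (Y g x) \<partial>P)"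
proof (cases "v = 0")
  case True
  show ?thesis
    by (rule nn_integral_cong_AE) (use Y_zero True in \<open>auto simp: cm_density_def\<close>)
next
  case False
  define s where "s = norm v"
  define e where "e = (1 / s) *\<^sub>R v"
  have s: "0 < s" and e: "norm e = 1" "s *\<^sub>R e = v" using False by (auto simp: s_def e_def)
  define b where "b = inner g e"
  define r where "r = g - b *\<^sub>R e"
  have orth: "inner e r = 0" using e(1) by (simp add: r_def b_def inner_diff_right inner_commute dot_square_norm)
  let ?R = "\<lambda>x (j::nat). Y r x"
  have law: "distr P (borel \<Otimes>\<^sub>M borel) (\<lambda>x. (Y e x, ?R x)) = std_normal_distribution \<Otimes>\<^sub>M distr P borel ?R"
    using indep_orthogonal[of e "\<lambda>_. r"] std_normal_law[OF e(1)] orth by simp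
  let ?N = "std_normal_distribution" and ?Q = "distr P borel ?R"
  interpret N: prob_space ?N using real_dist_normal_dist by (simp add: real_distribution_def)
  interpret Q: prob_space ?Q by (rule prob_space_distr) simp
  interpret NQ: pair_prob_space ?N ?Q ..
  have sets[measurable_cong]: "sets (?N \<Otimes>\<^sub>M ?Q) = sets (borel \<Otimes>\<^sub>M borel)" by (rule sets_pair_measure_cong) simp_all
  have [measurable]: "(\<lambda>r. r j) \<in> borel_measurable (borel :: (nat \<Rightarrow> real) measure)" for j
    by (rule measurable_product_coordinates)
  have gv: "inner g v = b * s" using e(2) by (metis b_def inner_scaleR_right mult.commute)
  have 1: "AE x in P. Y g x = Y r x + b * Y e x"
    using Y_linear[of 1 r b e] by (simp add: r_def)
  have 2: "AE x in P. Y v x = s * Y e x" using Y_scale[of s e] by (simp add: e(2))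
  define F where "F = (\<lambda>(t, \<rho>::nat \<Rightarrow> real). ennreal (exp (s * t - s\<^sup>2 / 2)) * \<psi> (\<rho> 0 + b * (t - s)))"
  define G where "G = (\<lambda>(t, \<rho>::nat \<Rightarrow> real). \<psi> (\<rho> 0 + b * t))"
  have [measurable]: "F \<in> borel_measurable (borel \<Otimes>\<^sub>M borel)" "G \<in> borel_measurable (borel \<Otimes>\<^sub>M borel)"
    unfolding F_def G_def by measurable
  have inner: "(\<integral>\<^sup>+t. F (t, \<rho>) \<partial>?N) = (\<integral>\<^sup>+t. G (t, \<rho>) \<partial>?N)" for \<rho>
  proof -
    have d: "std_normal_density t * exp (s * t - s\<^sup>2 / 2) = std_normal_density (t - s)" for t
      by (simp add: std_normal_density_def exp_add[symmetric] field_simps power2_eq_square)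
    have "(\<integral>\<^sup>+t. F (t, \<rho>) \<partial>?N) = (\<integral>\<^sup>+t. ennreal (std_normal_density t) * (ennreal (exp (s * t - s\<^sup>2 / 2)) * \<psi> (\<rho> 0 + b * (t - s))) \<partial>lborel)"
      unfolding F_def by (subst nn_integral_density) auto
    also have "\<dots> = (\<integral>\<^sup>+t. ennreal (std_normal_density (t - s)) * \<psi> (\<rho> 0 + b * (t - s)) \<partial>lborel)"
      unfolding d[symmetric] by (simp add: ennreal_mult mult.assoc)
    also have "\<dots> = (\<integral>\<^sup>+t. ennreal (std_normal_density t) * \<psi> (\<rho> 0 + b * t) \<partial>lborel)"
      by (subst nn_integral_real_affine[where c=1 and t=s]) auto
    also have "\<dots> = (\<integral>\<^sup>+t. G (t, \<rho>) \<partial>?N)"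
      unfolding G_def by (subst nn_integral_density) auto
    finally show ?thesis .
  qed
  have "(\<integral>\<^sup>+x. ennreal (cm_density v x) * \<psi> (Y g x - inner g v) \<partial>P) = (\<integral>\<^sup>+x. F (Y e x, ?R x) \<partial>P)"
    by (rule nn_integral_cong_AE)
       (use 1 2 in \<open>eventually_elim, simp add: F_def cm_density_def gv s_def[symmetric] algebra_simps\<close>)
  also have "\<dots> = (\<integral>\<^sup>+z. F z \<partial>(?N \<Otimes>\<^sub>M ?Q))"
    unfolding law[symmetric] by (subst nn_integral_distr) simp_all
  also have "\<dots> = (\<integral>\<^sup>+\<rho>. (\<integral>\<^sup>+t. F (t, \<rho>) \<partial>?N) \<partial>?Q)"
    by (rule NQ.nn_integral_snd[symmetric]) simp
  also have "\<dots> = (\<integral>\<^sup>+\<rho>. (\<integral>\<^sup>+t. G (t, \<rho>) \<partial>?N) \<partial>?Q)" by (simp only: inner)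
  also have "\<dots> = (\<integral>\<^sup>+z. G z \<partial>(?N \<Otimes>\<^sub>M ?Q))"
    by (rule NQ.nn_integral_snd) simp
  also have "\<dots> = (\<integral>\<^sup>+x. G (Y e x, ?R x) \<partial>P)"
    unfolding law[symmetric] by (subst nn_integral_distr) simp_all
  also have "\<dots> = (\<integral>\<^sup>+x. \<psi> (Y g x) \<partial>P)"
    by (rule nn_integral_cong_AE) (use 1 in \<open>eventually_elim, simp add: G_def\<close>)
  finally show ?thesis .
qed

lemma shifted_measure_eq: "shifted_measure P Y v = density P (\<lambda>x. ennreal (cm_density v x))"
  by (simp add: shifted_measure_def cm_density_def)

lemma AE_shifted_measure: "(AE x in shifted_measure P Y v. Q x) \<longleftrightarrow> (AE x in P. Q x)"
  unfolding shifted_measure_eq by (subst AE_density) (auto simp: cm_density_def)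

lemma shifted_gauss_field: "gauss_field (shifted_measure P Y v) (shifted_process Y v)"
proof -
  let ?S = "shifted_measure P Y v" and ?Z = "shifted_process Y v"
  have sets[measurable_cong]: "sets ?S = sets P" by (simp add: shifted_measure_eq)
  have Z: "?Z g = (\<lambda>x. Y g x - inner g v)" for g by (auto simp: shifted_process_def)
  interpret S: prob_space ?S
  proof
    have "emeasure ?S (space ?S) = (\<integral>\<^sup>+x. ennreal (cm_density v x) \<partial>P)"
      unfolding shifted_measure_eq by (subst emeasure_density) (auto intro!: nn_integral_cong)
    also have "\<dots> = 1" using cameron_martin[of "\<lambda>_. 1" v 0] by (simp add: emeasure_space_1)
    finally show "emeasure ?S (space ?S) = 1" .
  qed
  have [measurable]: "?Z g \<in> borel_measurable P" for g unfolding Z by measurable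
  have law: "distr ?S borel (?Z g) = distr P borel (Y g)" for g
  proof (rule measure_eqI)
    fix A assume "A \<in> sets (distr ?S borel (?Z g))"
    then have [measurable]: "A \<in> sets borel" by simp
    have "emeasure (distr ?S borel (?Z g)) A = (\<integral>\<^sup>+t. indicator A t \<partial>distr ?S borel (?Z g))" by simp
    also have "\<dots> = (\<integral>\<^sup>+x. indicator A (?Z g x) \<partial>?S)" by (subst nn_integral_distr) simp_all
    also have "\<dots> = (\<integral>\<^sup>+x. ennreal (cm_density v x) * indicator A (Y g x - inner g v) \<partial>P)"
      unfolding shifted_measure_eq Z by (subst nn_integral_density) auto
    also have "\<dots> = (\<integral>\<^sup>+x. indicator A (Y g x) \<partial>P)"
      by (rule cameron_martin) simp
    also have "\<dots> = (\<integral>\<^sup>+t. indicator A t \<partial>distr P borel (Y g))" by (subst nn_integral_distr) simp_all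
    also have "\<dots> = emeasure (distr P borel (Y g)) A" by simp
    finally show "emeasure (distr ?S borel (?Z g)) A = emeasure (distr P borel (Y g)) A" .
  qed simp
  show ?thesis
  proof
    show "?Z g \<in> borel_measurable ?S" for g by simp
    show "AE x in ?S. ?Z (a *\<^sub>R g + b *\<^sub>R k) x = a * ?Z g x + b * ?Z k x" for a b g k
      unfolding AE_shifted_measure using Y_linear[of a g b k]
      by eventually_elim (simp add: Z inner_add_left algebra_simps)
    fix g
    have "(\<integral>x. cos (?Z g x) \<partial>?S) = (\<integral>t. cos t \<partial>distr ?S borel (?Z g))" by (simp add: integral_distr)
    also have "\<dots> = (\<integral>x. cos (Y g x) \<partial>P)" unfolding law by (simp add: integral_distr)
    finally show "(\<integral>x. cos (?Z g x) \<partial>?S) = exp (- (norm g)\<^sup>2 / 2)" by (simp add: expectation_cos)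
    have "(\<integral>x. sin (?Z g x) \<partial>?S) = (\<integral>t. sin t \<partial>distr ?S borel (?Z g))" by (simp add: integral_distr)
    also have "\<dots> = (\<integral>x. sin (Y g x) \<partial>P)" unfolding law by (simp add: integral_distr)
    finally show "(\<integral>x. sin (?Z g x) \<partial>?S) = 0" by (simp add: expectation_sin)
  qed
qed

end

section \<open>Processes with values in a Gaussian space\<close>

lemma sq_integrable_add:
  assumes "sq_integrable M f" "sq_integrable M g"
  shows "sq_integrable M (\<lambda>x. f x + g x)"
proof -
  have "sq_integrable M (\<lambda>x. - g x)" using assms(2) by (simp add: sq_integrable_def)
  from sq_integrable_diff[OF assms(1) this] show ?thesis by simp
qed

lemma sq_integrable_sum:
  assumes "\<And>c. c \<in> C \<Longrightarrow> sq_integrable M (f c)"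
  shows "sq_integrable M (\<lambda>x. \<Sum>c\<in>C. f c x)"
  using assms
proof (induction C rule: infinite_finite_induct)
  case (insert c C)
  then show ?case using sq_integrable_add[of M "f c" "\<lambda>x. \<Sum>c\<in>C. f c x"] by simp
qed (simp_all add: sq_integrable_def)

lemma sq_integrable_Cauchy_Schwarz:
  fixes f g :: "'a \<Rightarrow> real"
  assumes "sq_integrable M f" "sq_integrable M g"
  shows "\<bar>\<integral>x. f x * g x \<partial>M\<bar> \<le> sqrt (\<integral>x. (f x)\<^sup>2 \<partial>M) * sqrt (\<integral>x. (g x)\<^sup>2 \<partial>M)"
proof -
  have "\<bar>\<integral>x. f x * g x \<partial>M\<bar> \<le> (\<integral>x. \<bar>f x * g x\<bar> \<partial>M)" by (rule integral_abs_bound)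
  also have "\<dots> \<le> sqrt ((\<integral>x. (f x)\<^sup>2 \<partial>M) * (\<integral>x. (g x)\<^sup>2 \<partial>M))"
    using assms by (intro real_le_rsqrt L2_Cauchy_Schwarz) (auto simp: sq_integrable_def)
  finally show ?thesis by (simp add: real_sqrt_mult)
qed

lemma weak_null_closed:
  fixes R :: "nat \<Rightarrow> 'a \<Rightarrow> real"
  assumes R: "\<And>n. sq_integrable N (R n)" and K: "\<And>n. (\<integral>x. (R n x)\<^sup>2 \<partial>N) \<le> K"
    and Z: "L2_tendsto N Zs Z" and null: "\<And>m. (\<lambda>n. \<integral>x. R n x * Zs m x \<partial>N) \<longlonglongrightarrow> 0"
  shows "(\<lambda>n. \<integral>x. R n x * Z x \<partial>N) \<longlonglongrightarrow> 0"
proof (rule LIMSEQ_I)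
  fix e :: real assume e: "0 < e"
  have S: "sq_integrable N (Zs m)" "sq_integrable N Z" for m using Z by (auto simp: L2_tendsto_def)
  have "(\<lambda>m. sqrt K * sqrt (\<integral>x. (norm (Zs m x - Z x))\<^sup>2 \<partial>N)) \<longlonglongrightarrow> sqrt K * sqrt 0"
    using Z by (intro tendsto_intros) (simp add: L2_tendsto_def)
  then have "(\<lambda>m. sqrt K * sqrt (\<integral>x. (norm (Zs m x - Z x))\<^sup>2 \<partial>N)) \<longlonglongrightarrow> 0" by simp
  from order_tendstoD(2)[OF this, of "e/2"] e obtain m where m: "sqrt K * sqrt (\<integral>x. (norm (Zs m x - Z x))\<^sup>2 \<partial>N) < e / 2"
    by (auto simp: eventually_sequentially)
  from LIMSEQ_D[OF null[of m], of "e/2"] e obtain n0 where n0: "\<And>n. n \<ge> n0 \<Longrightarrow> \<bar>\<integral>x. R n x * Zs m x \<partial>N\<bar> < e / 2"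
    by auto
  show "\<exists>no. \<forall>n\<ge>no. norm ((\<integral>x. R n x * Z x \<partial>N) - 0) < e"
  proof (intro exI allI impI)
    fix n assume n: "n \<ge> n0"
    have D: "sq_integrable N (\<lambda>x. Zs m x - Z x)" by (intro sq_integrable_diff S)
    have "(\<integral>x. R n x * Z x \<partial>N) = (\<integral>x. R n x * Zs m x - R n x * (Zs m x - Z x) \<partial>N)"
      by (intro Bochner_Integration.integral_cong) (auto simp: algebra_simps)
    also have "\<dots> = (\<integral>x. R n x * Zs m x \<partial>N) - (\<integral>x. R n x * (Zs m x - Z x) \<partial>N)"
      using sq_integrable_mult_integrable[OF R S(1)] sq_integrable_mult_integrable[OF R D]
      by (intro Bochner_Integration.integral_diff) auto
    finally have 1: "\<bar>\<integral>x. R n x * Z x \<partial>N\<bar> \<le> \<bar>\<integral>x. R n x * Zs m x \<partial>N\<bar> + \<bar>\<integral>x. R n x * (Zs m x - Z x) \<partial>N\<bar>"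
      by linarith
    have "\<bar>\<integral>x. R n x * (Zs m x - Z x) \<partial>N\<bar> \<le> sqrt (\<integral>x. (R n x)\<^sup>2 \<partial>N) * sqrt (\<integral>x. (Zs m x - Z x)\<^sup>2 \<partial>N)"
      by (rule sq_integrable_Cauchy_Schwarz[OF R D])
    also have "\<dots> \<le> sqrt K * sqrt (\<integral>x. (norm (Zs m x - Z x))\<^sup>2 \<partial>N)"
      using K[of n] order_trans[OF Bochner_Integration.integral_nonneg K[of n]] by (intro mult_mono) (auto intro: integral_nonneg)
    finally show "norm ((\<integral>x. R n x * Z x \<partial>N) - 0) < e" using 1 m n0[OF n] by simp
  qed
qed

text \<open>Because the sequence is bounded, the test functions \<open>Z\<close> with this property form a space closed under
  \<open>L\<^sup>2\<close> limits; starting from the generator it contains all indicators, and simple functions are dense.\<close>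

lemma weak_null_from_generator:
  fixes R :: "nat \<Rightarrow> 'a \<Rightarrow> real"
  assumes "finite_measure N" and gen: "sets N = sigma_sets (space N) G" "Int_stable G" "G \<subseteq> Pow (space N)" "space N \<in> G"
    and R: "\<And>n. sq_integrable N (R n)" and K: "\<And>n. (\<integral>x. (R n x)\<^sup>2 \<partial>N) \<le> K"
    and G: "\<And>A. A \<in> G \<Longrightarrow> (\<lambda>n. \<integral>x. R n x * indicator A x \<partial>N) \<longlonglongrightarrow> 0"
    and Z: "sq_integrable N Z"
  shows "(\<lambda>n. \<integral>x. R n x * Z x \<partial>N) \<longlonglongrightarrow> 0"
proof -
  interpret finite_measure N by fact
  note ind = sq_integrable_indicator[OF finite_measure_axioms]
  have iR: "integrable N (\<lambda>x. R n x * indicator A x)" if "A \<in> sets N" for A n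
    by (rule sq_integrable_mult_integrable[OF R ind[OF that]])
  have sets: "(\<lambda>n. \<integral>x. R n x * indicator A x \<partial>N) \<longlonglongrightarrow> 0" if "A \<in> sets N" for A
  proof -
    have "A \<in> sigma_sets (space N) G" using that gen(1) by simp
    with gen(2,3) show ?thesis
    proof (induction A rule: sigma_sets_induct_disjoint)
      case (basic A) then show ?case by (rule G)
    next
      case empty then show ?case by simp
    next
      case (compl A)
      then have A: "A \<in> sets N" by (simp add: gen(1))
      have "(\<integral>x. R n x * indicator (space N - A) x \<partial>N) =
          (\<integral>x. R n x * indicator (space N) x \<partial>N) - (\<integral>x. R n x * indicator A x \<partial>N)" for n
      proof -
        have "(\<integral>x. R n x * indicator (space N - A) x \<partial>N) = (\<integral>x. R n x * indicator (space N) x - R n x * indicator A x \<partial>N)"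
          by (intro Bochner_Integration.integral_cong) (auto simp: indicator_def)
        then show ?thesis using iR[OF A, of n] iR[of "space N" n] by simp
      qed
      then show ?case using tendsto_diff[OF G[OF gen(4)] compl.IH] by simp
    next
      case (union A)
      then have A[measurable]: "A i \<in> sets N" for i by (auto simp: gen(1))
      show ?case
      proof (rule weak_null_closed[OF R K])
        show "L2_tendsto N (\<lambda>m. indicator (\<Union>i<m. A i)) (indicator (\<Union>i. A i) :: _ \<Rightarrow> real)"
          unfolding L2_tendsto_def
        proof (intro conjI allI ind)
          let ?d = "\<lambda>m x. (norm (indicator (\<Union>i<m. A i) x - indicator (\<Union>i. A i) x :: real))\<^sup>2"
          have "(\<lambda>m. \<integral>x. ?d m x \<partial>N) \<longlonglongrightarrow> (\<integral>x. 0 \<partial>N)"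
          proof (rule integral_dominated_convergence[where w="\<lambda>_. 1"])
            have "(\<lambda>m. ?d m x) \<longlonglongrightarrow> (norm (indicator (\<Union>i. A i) x - indicator (\<Union>i. A i) x :: real))\<^sup>2" for x
              by (intro tendsto_intros LIMSEQ_indicator_UN)
            then show "AE x in N. (\<lambda>m. ?d m x) \<longlonglongrightarrow> 0"
              by simp
            show "AE x in N. norm (?d m x) \<le> 1" for m
              by (auto simp: indicator_def)
          qed auto
          then show "(\<lambda>m. \<integral>x. ?d m x \<partial>N) \<longlonglongrightarrow> 0" by simp
        qed auto
        fix m
        have "(\<integral>x. R n x * indicator (\<Union>i<m. A i) x \<partial>N) = (\<Sum>i<m. \<integral>x. R n x * indicator (A i) x \<partial>N)" for n
          using disjoint_family_on_mono[OF subset_UNIV \<open>disjoint_family A\<close>, of "{..<m}"] iR[OF A]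
          by (subst Bochner_Integration.integral_sum[symmetric])
             (auto simp: indicator_UN_disjoint sum_distrib_left)
        moreover have "(\<lambda>n. \<Sum>i<m. \<integral>x. R n x * indicator (A i) x \<partial>N) \<longlonglongrightarrow> (\<Sum>i<m. 0)"
          by (intro tendsto_sum union.IH)
        ultimately show "(\<lambda>n. \<integral>x. R n x * indicator (\<Union>i<m. A i) x \<partial>N) \<longlonglongrightarrow> 0" by simp
      qed
    qed
  qed
  have [measurable]: "Z \<in> borel_measurable N" using Z by (simp add: sq_integrable_def)
  obtain F where F0: "\<forall>i. simple_function N (F i)" "\<forall>x\<in>space N. (\<lambda>i. F i x) \<longlonglongrightarrow> Z x"
      "\<forall>i. \<forall>x\<in>space N. dist (F i x) 0 \<le> 2 * dist (Z x) 0"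
    using borel_measurable_implies_sequence_metric[OF \<open>Z \<in> borel_measurable N\<close>, of 0] by (elim exE conjE) (rule that)
  note F = F0(1)[rule_format] F0(2)[rule_format] F0(3)[rule_format]
  have [measurable]: "F i \<in> borel_measurable N" for i using F(1) by (rule borel_measurable_simple_function)
  have FZ: "\<bar>F i x\<bar> \<le> 2 * \<bar>Z x\<bar>" if "x \<in> space N" for i x using F(3)[OF that, of i] by (simp add: dist_real_def)
  have iZ: "integrable N (\<lambda>x. (Z x)\<^sup>2)" using Z by (simp add: sq_integrable_def)
  have SF: "sq_integrable N (F i)" for i
    unfolding sq_integrable_def
  proof
    show "integrable N (\<lambda>x. (norm (F i x))\<^sup>2)"
    proof (rule Bochner_Integration.integrable_bound)
      show "integrable N (\<lambda>x. 4 * (Z x)\<^sup>2)" using iZ by simp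
      have "(F i x)\<^sup>2 \<le> 4 * (Z x)\<^sup>2" if "x \<in> space N" for x
        using power_mono[OF FZ[OF that, of i], of 2] by (simp add: power_mult_distrib)
      then show "AE x in N. norm ((norm (F i x))\<^sup>2) \<le> norm (4 * (Z x)\<^sup>2)" by (intro AE_I2) simp
    qed simp
  qed simp
  show ?thesis
  proof (rule weak_null_closed[OF R K])
    show "L2_tendsto N F Z" unfolding L2_tendsto_def
    proof (intro conjI allI SF Z)
      have "(\<lambda>m. \<integral>x. (norm (F m x - Z x))\<^sup>2 \<partial>N) \<longlonglongrightarrow> (\<integral>x. 0 \<partial>N)"
      proof (rule integral_dominated_convergence[where w="\<lambda>x. 9 * (Z x)\<^sup>2"])
        have "(\<lambda>m. (norm (F m x - Z x))\<^sup>2) \<longlonglongrightarrow> (norm (Z x - Z x))\<^sup>2" if "x \<in> space N" for x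
          by (intro tendsto_intros F(2)[OF that])
        then show "AE x in N. (\<lambda>m. (norm (F m x - Z x))\<^sup>2) \<longlonglongrightarrow> 0" by (intro AE_I2) simp
        have "(F m x - Z x)\<^sup>2 \<le> 9 * (Z x)\<^sup>2" if "x \<in> space N" for m x
        proof -
          have "\<bar>F m x - Z x\<bar> \<le> 3 * \<bar>Z x\<bar>" using FZ[OF that, of m] by linarith
          from power_mono[OF this, of 2] show ?thesis by (simp add: power_mult_distrib)
        qed
        then show "AE x in N. norm ((norm (F m x - Z x))\<^sup>2) \<le> 9 * (Z x)\<^sup>2" for m by (intro AE_I2) simp
      qed (use iZ in auto)
      then show "(\<lambda>m. \<integral>x. (norm (F m x - Z x))\<^sup>2 \<partial>N) \<longlonglongrightarrow> 0" by simp
    qed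
    fix m
    let ?A = "\<lambda>y. F m -` {y} \<inter> space N"
    have fin: "finite (F m ` space N)" using F(1) by (rule simple_functionD)
    have A: "?A y \<in> sets N" for y using F(1) by (rule simple_functionD)
    have "(\<integral>x. R n x * F m x \<partial>N) = (\<Sum>y\<in>F m ` space N. y * (\<integral>x. R n x * indicator (?A y) x \<partial>N))" for n
    proof -
      have "(\<integral>x. R n x * F m x \<partial>N) = (\<integral>x. (\<Sum>y\<in>F m ` space N. y * (R n x * indicator (?A y) x)) \<partial>N)"
      proof (rule Bochner_Integration.integral_cong)
        fix x assume x: "x \<in> space N"
        have "(\<Sum>y\<in>F m ` space N. y * (R n x * indicator (?A y) x)) = (\<Sum>y\<in>F m ` space N. if y = F m x then R n x * y else 0)"
          using x by (intro sum.cong) (auto simp: indicator_def)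
        also have "\<dots> = R n x * F m x" using fin x by (simp add: sum.delta)
        finally show "R n x * F m x = (\<Sum>y\<in>F m ` space N. y * (R n x * indicator (?A y) x))" by simp
      qed simp
      also have "\<dots> = (\<Sum>y\<in>F m ` space N. y * (\<integral>x. R n x * indicator (?A y) x \<partial>N))"
        using iR[OF A] by (subst Bochner_Integration.integral_sum) auto
      finally show ?thesis .
    qed
    moreover have "(\<lambda>n. \<Sum>y\<in>F m ` space N. y * (\<integral>x. R n x * indicator (?A y) x \<partial>N)) \<longlonglongrightarrow> (\<Sum>y\<in>F m ` space N. y * 0)"
      by (intro tendsto_sum tendsto_mult tendsto_const sets A)
    ultimately show "(\<lambda>n. \<integral>x. R n x * F m x \<partial>N) \<longlonglongrightarrow> 0" by simp
  qed
qed

context gauss_field begin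

lemma Y_sq_integrable: "sq_integrable P (Y g)"
  by (simp add: sq_integrable_def second_moment)

lemma covariance_inner: "(\<integral>x. Y g x * Y k x \<partial>P) = inner g k"
proof -
  have i: "integrable P (\<lambda>x. Y g x * Y k x)" by (intro sq_integrable_mult_integrable Y_sq_integrable)
  have "(norm (g + k))\<^sup>2 = (\<integral>x. (Y (g + k) x)\<^sup>2 \<partial>P)" by (simp add: second_moment)
  also have "\<dots> = (\<integral>x. (Y g x)\<^sup>2 + 2 * (Y g x * Y k x) + (Y k x)\<^sup>2 \<partial>P)"
  proof (rule integral_cong_AE)
    show "AE x in P. (Y (g + k) x)\<^sup>2 = (Y g x)\<^sup>2 + 2 * (Y g x * Y k x) + (Y k x)\<^sup>2"
      using Y_add[of g k] by eventually_elim (simp add: power2_sum)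
  qed simp_all
  also have "\<dots> = (norm g)\<^sup>2 + 2 * (\<integral>x. Y g x * Y k x \<partial>P) + (norm k)\<^sup>2"
    using i second_moment by simp
  finally show ?thesis by (simp add: power2_norm_eq_inner inner_add_left inner_add_right inner_commute[of k g])
qed

end

text \<open>The field is an isometry into \<open>L\<^sup>2\<close>, so a sequence whose image converges is Cauchy.\<close>

lemma range_closed_L2:
  fixes Y :: "'h::{real_inner, banach, second_countable_topology} \<Rightarrow> 'a \<Rightarrow> real"
  assumes "gauss_field P Y" and f: "sq_integrable P f"
    and lim: "(\<lambda>n. \<integral>x. (f x - Y (w n) x)\<^sup>2 \<partial>P) \<longlonglongrightarrow> 0"
  shows "\<exists>g. AE x in P. f x = Y g x"
proof -
  interpret gauss_field P Y by fact
  let ?d = "\<lambda>n. \<integral>x. (f x - Y (w n) x)\<^sup>2 \<partial>P"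
  have sd: "sq_integrable P (\<lambda>x. f x - Y (w n) x)" for n by (intro sq_integrable_diff f Y_sq_integrable)
  then have i: "integrable P (\<lambda>x. (f x - Y (w n) x)\<^sup>2)" for n by (simp add: sq_integrable_def)
  have [measurable]: "f \<in> borel_measurable P" using f by (simp add: sq_integrable_def)
  have le: "(norm (w n - w m))\<^sup>2 \<le> 2 * ?d n + 2 * ?d m" for n m
  proof -
    have "(norm (w n - w m))\<^sup>2 = (\<integral>x. (Y (w n - w m) x)\<^sup>2 \<partial>P)" by (simp add: second_moment)
    also have "\<dots> \<le> (\<integral>x. 2 * (f x - Y (w n) x)\<^sup>2 + 2 * (f x - Y (w m) x)\<^sup>2 \<partial>P)"
    proof (rule integral_mono_AE)
      show "AE x in P. (Y (w n - w m) x)\<^sup>2 \<le> 2 * (f x - Y (w n) x)\<^sup>2 + 2 * (f x - Y (w m) x)\<^sup>2"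
        using Y_diff[of "w n" "w m"]
      proof eventually_elim
        case (elim x)
        have "0 \<le> ((f x - Y (w n) x) + (f x - Y (w m) x))\<^sup>2" by simp
        then show ?case unfolding elim by (simp add: power2_eq_square algebra_simps)
      qed
    qed (use i second_moment in auto)
    also have "\<dots> = 2 * ?d n + 2 * ?d m" using i by simp
    finally show ?thesis .
  qed
  have "Cauchy w"
  proof (rule CauchyI)
    fix e :: real assume e: "0 < e"
    then have "0 < e\<^sup>2 / 4" by simp
    from order_tendstoD(2)[OF lim this] obtain n0 where n0: "\<And>n. n \<ge> n0 \<Longrightarrow> ?d n < e\<^sup>2 / 4"
      by (auto simp: eventually_sequentially)
    have "norm (w m - w n) < e" if "m \<ge> n0" "n \<ge> n0" for m n
    proof (rule power_less_imp_less_base)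
      show "(norm (w m - w n))\<^sup>2 < e\<^sup>2" using le[of m n] n0[OF that(1)] n0[OF that(2)] by linarith
    qed (use e in simp)
    then show "\<exists>M. \<forall>m\<ge>M. \<forall>n\<ge>M. norm (w m - w n) < e" by blast
  qed
  then obtain g where g: "w \<longlonglongrightarrow> g" using convergent_eq_Cauchy by blast
  have sg: "integrable P (\<lambda>x. (f x - Y g x)\<^sup>2)"
    using sq_integrable_diff[OF f Y_sq_integrable[of g]] by (simp add: sq_integrable_def)
  have le2: "(\<integral>x. (f x - Y g x)\<^sup>2 \<partial>P) \<le> 2 * ?d n + 2 * (norm (w n - g))\<^sup>2" for n
  proof -
    have "(\<integral>x. (f x - Y g x)\<^sup>2 \<partial>P) \<le> (\<integral>x. 2 * (f x - Y (w n) x)\<^sup>2 + 2 * (Y (w n - g) x)\<^sup>2 \<partial>P)"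
    proof (rule integral_mono_AE)
      show "AE x in P. (f x - Y g x)\<^sup>2 \<le> 2 * (f x - Y (w n) x)\<^sup>2 + 2 * (Y (w n - g) x)\<^sup>2"
        using Y_diff[of "w n" g]
      proof eventually_elim
        case (elim x)
        have "0 \<le> ((f x - Y (w n) x) - (Y (w n) x - Y g x))\<^sup>2" by simp
        then show ?case unfolding elim by (simp add: power2_eq_square algebra_simps)
      qed
    qed (use i sg second_moment in auto)
    also have "\<dots> = 2 * ?d n + 2 * (norm (w n - g))\<^sup>2" using i second_moment by simp
    finally show ?thesis .
  qed
  have "(\<lambda>n. 2 * ?d n + 2 * (norm (w n - g))\<^sup>2) \<longlonglongrightarrow> 2 * 0 + 2 * (norm (g - g))\<^sup>2"
    by (intro tendsto_intros lim g)
  then have "(\<integral>x. (f x - Y g x)\<^sup>2 \<partial>P) \<le> 2 * 0 + 2 * (norm (g - g))\<^sup>2"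
    using le2 by (intro LIMSEQ_le_const) auto
  moreover have "0 \<le> (\<integral>x. (f x - Y g x)\<^sup>2 \<partial>P)" by simp
  ultimately have "(\<integral>x. (f x - Y g x)\<^sup>2 \<partial>P) = 0" by simp
  then have "AE x in P. (f x - Y g x)\<^sup>2 = 0"
    using integral_nonneg_eq_0_iff_AE[OF sg] by simp
  then show ?thesis by (intro exI[of _ g]) (auto elim: eventually_mono)
qed

lemma finite_orthogonal_projection:
  fixes C :: "'h::real_inner set"
  assumes C: "finite C" "pairwise orthogonal C" "0 \<notin> C"
  defines "p \<equiv> \<lambda>x. \<Sum>c\<in>C. (inner x c / inner c c) *\<^sub>R c"
  shows "c \<in> C \<Longrightarrow> inner (x - p x) c = 0"
    and "y \<in> span C \<Longrightarrow> norm (x - p x) \<le> norm (x - y)"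
proof -
  have o: "inner (x - p x) c = 0" if c: "c \<in> C" for c
  proof -
    have "inner (p x) c = (\<Sum>b\<in>C. if b = c then inner x c else 0)"
      unfolding p_def inner_sum_left
      using C c by (intro sum.cong refl) (auto simp: pairwise_def orthogonal_def)
    then show ?thesis using C c by (simp add: inner_diff_left sum.delta)
  qed
  show "c \<in> C \<Longrightarrow> inner (x - p x) c = 0" by (rule o)
  assume y: "y \<in> span C"
  have "p x \<in> span C" unfolding p_def by (intro span_sum span_scale span_base)
  then have "p x - y \<in> span C" using y by (rule span_diff)
  moreover have "orthogonal (x - p x) z" if "z \<in> span C" for z
    using that by (rule orthogonal_to_span) (simp add: o orthogonal_def)
  ultimately have "inner (x - p x) (p x - y) = 0" by (auto simp: orthogonal_def)
  moreover have "(norm a)\<^sup>2 \<le> (norm (a + b))\<^sup>2" if "inner a b = 0" for a b :: 'h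
    using that by (simp add: power2_norm_eq_inner inner_add_left inner_add_right inner_commute[of b a])
  ultimately have "(norm (x - p x))\<^sup>2 \<le> (norm ((x - p x) + (p x - y)))\<^sup>2" by blast
  then show "norm (x - p x) \<le> norm (x - y)" by (simp add: power2_le_iff_abs_le)
qed

lemma (in pair_sigma_finite) sq_integrable_tensor:
  fixes f :: "'a \<Rightarrow> real" and b :: "'b \<Rightarrow> real"
  assumes f: "sq_integrable M1 f" and b: "sq_integrable M2 b"
  shows "sq_integrable (M1 \<Otimes>\<^sub>M M2) (\<lambda>(x, t). b t * f x)"
proof -
  have [measurable]: "f \<in> borel_measurable M1" "b \<in> borel_measurable M2"
    using f b by (auto simp: sq_integrable_def)
  have "integrable (M1 \<Otimes>\<^sub>M M2) (\<lambda>(x, t). (b t)\<^sup>2 * (f x)\<^sup>2)"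
    by (rule Fubini_integrable) (use f b in \<open>auto simp: sq_integrable_def\<close>)
  then show ?thesis
    by (simp add: sq_integrable_def case_prod_unfold power_mult_distrib)
qed

text \<open>Let \<open>R n\<close> be the process minus its projection, at each time, to the field over the span of the
  first \<open>n\<close> elements of a dense sequence. Its integral over a rectangle \<open>A \<times> B\<close> is the integral of
  \<open>Y (k - p n k)\<close> over \<open>A\<close>, where \<open>Y k\<close> is the integral of the process over \<open>B\<close>; this tends to
  zero. Hence \<open>R n\<close> tends to zero weakly in \<open>L\<^sup>2\<close>. As \<open>R n\<close> is a projection of the process, its squared norm
  is its inner product with the process, so the convergence is strong. This gives no information about single
  times, but a subsequence converges in \<open>L\<^sup>2(P)\<close> at almost every time.\<close>

lemma measurable_process_in_range:
  fixes Y :: "'h::{real_inner, banach, second_countable_topology} \<Rightarrow> 'a \<Rightarrow> real"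
    and X :: "'t \<Rightarrow> 'a \<Rightarrow> real"
  assumes Y: "gauss_field P Y" and "finite_measure \<mu>"
    and Xm: "(\<lambda>(x, t). X t x) \<in> borel_measurable (P \<Otimes>\<^sub>M \<mu>)"
    and fin: "(\<integral>\<^sup>+t. (\<integral>\<^sup>+x. ennreal ((X t x)\<^sup>2) \<partial>P) \<partial>\<mu>) < \<infinity>"
    and Xt: "\<And>t. t \<in> space \<mu> \<Longrightarrow> sq_integrable P (X t)"
    and rep: "\<And>B. B \<in> sets \<mu> \<Longrightarrow> \<exists>k. AE x in P. (\<integral>t. X t x * indicator B t \<partial>\<mu>) = Y k x"
  shows "AE t in \<mu>. \<exists>g. AE x in P. X t x = Y g x"
proof -
  interpret gauss_field P Y by fact
  interpret M2: finite_measure \<mu> by fact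
  interpret pair_sigma_finite P \<mu> ..
  let ?N = "P \<Otimes>\<^sub>M \<mu>"
  interpret N: finite_measure ?N by (rule finite_measure_pair_measure) (rule finite_measure_axioms M2.finite_measure_axioms)+
  note Xm[measurable]
  have Xm'[measurable]: "(\<lambda>(t, x). X t x) \<in> borel_measurable (\<mu> \<Otimes>\<^sub>M P)"
    using Xm by (subst measurable_pair_swap_iff) (simp add: case_prod_unfold)
  define XX where "XX = (\<lambda>(x, t). X t x)"
  have XXm[measurable]: "XX \<in> borel_measurable ?N" unfolding XX_def by (rule Xm)
  have XX: "sq_integrable ?N XX"
  proof -
    have "(\<integral>\<^sup>+z. ennreal ((XX z)\<^sup>2) \<partial>?N) = (\<integral>\<^sup>+t. (\<integral>\<^sup>+x. ennreal ((X t x)\<^sup>2) \<partial>P) \<partial>\<mu>)"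
      by (subst nn_integral_snd[symmetric]) (simp_all add: XX_def)
    with fin have "integrable ?N (\<lambda>z. (XX z)\<^sup>2)" by (intro integrableI_bounded) auto
    then show ?thesis by (simp add: sq_integrable_def)
  qed
  define a where "a w t = (\<integral>x. X t x * Y w x \<partial>P)" for w t
  have [measurable]: "a w \<in> borel_measurable \<mu>" for w
    unfolding a_def by measurable
  have q: "integrable \<mu> (\<lambda>t. \<integral>x. (X t x)\<^sup>2 \<partial>P)"
    using integrable_snd[of "\<lambda>x t. (X t x)\<^sup>2"] XX by (simp add: sq_integrable_def XX_def case_prod_unfold)
  have sa: "sq_integrable \<mu> (a w)" for w
  proof -
    have "integrable \<mu> (\<lambda>t. (norm (a w t))\<^sup>2)"
    proof (rule Bochner_Integration.integrable_bound)
      show "integrable \<mu> (\<lambda>t. (norm w)\<^sup>2 * (\<integral>x. (X t x)\<^sup>2 \<partial>P))" using q by simp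
      have "(a w t)\<^sup>2 \<le> (norm w)\<^sup>2 * (\<integral>x. (X t x)\<^sup>2 \<partial>P)" if "t \<in> space \<mu>" for t
      proof -
        have "\<bar>a w t\<bar> \<le> sqrt (\<integral>x. (X t x)\<^sup>2 \<partial>P) * norm w"
          using sq_integrable_Cauchy_Schwarz[OF Xt[OF that] Y_sq_integrable[of w]] by (simp add: a_def second_moment)
        from power_mono[OF this, of 2] show ?thesis
          by (simp add: power_mult_distrib mult.commute)
      qed
      then show "AE t in \<mu>. norm ((norm (a w t))\<^sup>2) \<le> norm ((norm w)\<^sup>2 * (\<integral>x. (X t x)\<^sup>2 \<partial>P))"
        by (intro AE_I2) auto
    qed simp
    then show ?thesis by (simp add: sq_integrable_def)
  qed
  \<comment> \<open>Orthogonal bases of increasing spans with dense union; zero is left out because the projection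
    divides by \<open>inner c c\<close>.\<close>
  obtain D :: "'h set" where D: "countable D" "\<And>U. open U \<Longrightarrow> U \<noteq> {} \<Longrightarrow> \<exists>d\<in>D. d \<in> U"
    by (rule countable_dense_setE) blast
  define d where "d = from_nat_into D"
  have "\<exists>C. finite C \<and> pairwise orthogonal C \<and> 0 \<notin> C \<and> span C = span (d ` {..<n})" for n
  proof -
    obtain C where C: "finite C" "span C = span (d ` {..<n})" "pairwise orthogonal C"
      using basis_orthogonal[of "d ` {..<n}"] by auto
    show ?thesis
      by (rule exI[of _ "C - {0}"]) (use C in \<open>auto simp: span_delete_0 intro: pairwise_subset\<close>)
  qed
  then obtain C where C: "\<And>n. finite (C n)" "\<And>n. pairwise orthogonal (C n)" "\<And>n. 0 \<notin> C n"
    "\<And>n. span (C n) = span (d ` {..<n})" by metis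
  define p where "p n x = (\<Sum>c\<in>C n. (inner x c / inner c c) *\<^sub>R c)" for n x
  note proj = finite_orthogonal_projection[OF C(1-3), folded p_def]
  have p_lim: "(\<lambda>n. norm (x - p n x)) \<longlonglongrightarrow> 0" for x
  proof (rule LIMSEQ_I)
    fix e :: real assume "0 < e"
    then obtain y where y: "y \<in> D" "y \<in> ball x e" using D(2)[of "ball x e"] by auto
    then obtain m where m: "d m = y" using from_nat_into_surj[OF D(1)] by (auto simp: d_def)
    show "\<exists>no. \<forall>n\<ge>no. norm (norm (x - p n x) - 0) < e"
    proof (intro exI allI impI)
      fix n assume "n \<ge> Suc m"
      then have "y \<in> span (C n)" unfolding C(4) m[symmetric] by (intro span_base) auto
      from proj(2)[OF this, of x] show "norm (norm (x - p n x) - 0) < e" using y(2) by (simp add: dist_norm)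
    qed
  qed
  define R where "R n = (\<lambda>(x, t). X t x - (\<Sum>c\<in>C n. (a c t / inner c c) * Y c x))" for n
  define e where "e c = (\<lambda>(x, t). (a c t / inner c c) * Y c x)" for c
  have st: "sq_integrable ?N (e c)" for c
    using sa[of c] unfolding e_def
    by (intro sq_integrable_tensor Y_sq_integrable) (auto simp: sq_integrable_def power_divide)
  have sR: "sq_integrable ?N (R n)" for n
    using sq_integrable_diff[OF XX sq_integrable_sum[of "C n", OF st]]
    by (simp add: R_def XX_def e_def case_prod_unfold)
  have Rm[measurable]: "R n \<in> borel_measurable ?N" for n using sR by (simp add: sq_integrable_def)
  have orth: "(\<integral>x. R n (x, t) * Y c x \<partial>P) = 0" if c: "c \<in> C n" and t: "t \<in> space \<mu>" for n c t
  proof -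
    have "(\<integral>x. R n (x, t) * Y c x \<partial>P) = (\<integral>x. X t x * Y c x - (\<Sum>b\<in>C n. (a b t / inner b b) * (Y b x * Y c x)) \<partial>P)"
      by (simp add: R_def left_diff_distrib sum_distrib_right mult.assoc)
    also have "\<dots> = a c t - (\<Sum>b\<in>C n. (a b t / inner b b) * inner b c)"
      using sq_integrable_mult_integrable[OF Xt[OF t] Y_sq_integrable] sq_integrable_mult_integrable[OF Y_sq_integrable Y_sq_integrable]
      by (subst Bochner_Integration.integral_diff) (auto simp: a_def covariance_inner Bochner_Integration.integral_sum)
    also have "(\<Sum>b\<in>C n. (a b t / inner b b) * inner b c) = (\<Sum>b\<in>C n. if b = c then a c t else 0)"
      using C(2,3)[of n] c by (intro sum.cong refl) (auto simp: pairwise_def orthogonal_def)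
    also have "\<dots> = a c t" using C(1) c by (simp add: sum.delta)
    finally show ?thesis by simp
  qed
  have RX: "(\<integral>z. (R n z)\<^sup>2 \<partial>?N) = (\<integral>z. R n z * XX z \<partial>?N)" for n
  proof -
    have i: "integrable ?N (\<lambda>z. R n z * e c z)" for c
      by (rule sq_integrable_mult_integrable[OF sR st])
    have z: "(\<integral>z. R n z * e c z \<partial>?N) = 0" if c: "c \<in> C n" for c
    proof -
      have "(\<integral>z. R n z * e c z \<partial>?N)
          = (\<integral>t. (\<integral>x. R n (x, t) * ((a c t / inner c c) * Y c x) \<partial>P) \<partial>\<mu>)"
        using integral_snd[of "\<lambda>x t. R n (x, t) * ((a c t / inner c c) * Y c x)"] i[of c]
        by (auto simp add: e_def case_prod_unfold)
      also have "\<dots> = (\<integral>t. (a c t / inner c c) * (\<integral>x. R n (x, t) * Y c x \<partial>P) \<partial>\<mu>)"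
        by (subst integral_mult_right_zero[symmetric]) (simp add: mult_ac)
      also have "\<dots> = (\<integral>t. 0 \<partial>\<mu>)"
        by (intro Bochner_Integration.integral_cong refl) (simp add: orth[OF c])
      finally show ?thesis by simp
    qed
    have "(\<integral>z. R n z * XX z \<partial>?N) = (\<integral>z. (R n z)\<^sup>2 + (\<Sum>c\<in>C n. R n z * e c z) \<partial>?N)"
    proof (intro Bochner_Integration.integral_cong refl)
      fix z
      let ?S = "\<Sum>c\<in>C n. e c z"
      have "XX z = R n z + ?S" by (cases z) (simp add: R_def XX_def e_def)
      then show "R n z * XX z = (R n z)\<^sup>2 + (\<Sum>c\<in>C n. R n z * e c z)"
        by (simp add: sum_distrib_left[symmetric] power2_eq_square distrib_left)
    qed
    also have "\<dots> = (\<integral>z. (R n z)\<^sup>2 \<partial>?N) + (\<Sum>c\<in>C n. 0)"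
      using sR[of n] i z by (subst Bochner_Integration.integral_add) (auto simp: sq_integrable_def)
    finally show ?thesis by simp
  qed
  have K: "(\<integral>z. (R n z)\<^sup>2 \<partial>?N) \<le> (\<integral>z. (XX z)\<^sup>2 \<partial>?N)" for n
  proof -
    let ?r = "\<integral>z. (R n z)\<^sup>2 \<partial>?N" and ?x = "\<integral>z. (XX z)\<^sup>2 \<partial>?N"
    have r0: "0 \<le> ?r" by simp
    have le: "sqrt ?r * sqrt ?r \<le> sqrt ?r * sqrt ?x"
      using sq_integrable_Cauchy_Schwarz[OF sR XX, of n] RX[of n] r0 by simp
    show ?thesis
    proof (cases "?r = 0")
      case False
      then have "0 < ?r" using r0(1) by linarith
      then have "0 < sqrt ?r" by (rule iffD2[OF real_sqrt_gt_0_iff])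
      from mult_left_le_imp_le[OF le this] show ?thesis by simp
    qed (use r0 in simp)
  qed
  have rect: "(\<lambda>n. \<integral>z. R n z * indicator (A \<times> B) z \<partial>?N) \<longlonglongrightarrow> 0" if A[measurable]: "A \<in> sets P" and B[measurable]: "B \<in> sets \<mu>" for A B
  proof -
    obtain k where k: "AE x in P. (\<integral>t. X t x * indicator B t \<partial>\<mu>) = Y k x" using rep[OF B] by auto
    have sind: "sq_integrable ?N (indicator (A \<times> B) :: _ \<Rightarrow> real)" if "A \<in> sets P" for A
      using that by (intro sq_integrable_indicator N.finite_measure_axioms) simp
    note sB = sq_integrable_indicator[OF M2.finite_measure_axioms B]
    have ab: "(\<integral>t. a c t * indicator B t \<partial>\<mu>) = inner k c" for c
    proof -
      have i: "integrable ?N (\<lambda>(x, t). X t x * Y c x * indicator B t)"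
      proof -
        have "sq_integrable ?N (\<lambda>(x, t). indicator B t * Y c x)"
          by (rule sq_integrable_tensor[OF Y_sq_integrable sB])
        from sq_integrable_mult_integrable[OF XX this] show ?thesis
          by (simp add: XX_def case_prod_unfold mult_ac)
      qed
      have "(\<integral>t. a c t * indicator B t \<partial>\<mu>) = (\<integral>t. (\<integral>x. X t x * Y c x * indicator B t \<partial>P) \<partial>\<mu>)"
        by (simp add: a_def)
      also have "\<dots> = (\<integral>x. (\<integral>t. X t x * Y c x * indicator B t \<partial>\<mu>) \<partial>P)"
        by (rule Fubini_integral) (use i in simp)
      also have "\<dots> = (\<integral>x. (\<integral>t. X t x * indicator B t \<partial>\<mu>) * Y c x \<partial>P)"
        by (subst integral_mult_left_zero[symmetric]) (simp add: mult_ac)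
      also have "\<dots> = (\<integral>x. Y k x * Y c x \<partial>P)"
      proof (rule integral_cong_AE)
        show "AE x in P. (\<integral>t. X t x * indicator B t \<partial>\<mu>) * Y c x = Y k x * Y c x"
          using k by eventually_elim simp
      qed measurable
      finally show ?thesis by (simp add: covariance_inner)
    qed
    have le: "\<bar>\<integral>z. R n z * indicator (A \<times> B) z \<partial>?N\<bar> \<le> norm (k - p n k)" for n
    proof -
      have iA: "integrable ?N (\<lambda>z. R n z * indicator (A \<times> B) z)"
        by (rule sq_integrable_mult_integrable[OF sR sind[OF A]])
      have "AE x in P. integrable \<mu> (\<lambda>t. XX (x, t) * indicator (space P \<times> B) (x, t))"
        by (rule AE_integrable_fst'[OF sq_integrable_mult_integrable[OF XX sind]]) simp
      moreover have "AE x in P. Y (k - p n k) x = Y k x - (\<Sum>c\<in>C n. (inner k c / inner c c) * Y c x)"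
        using Y_diff[of k "p n k"] Y_sum[OF C(1)[of n], of "\<lambda>c. inner k c / inner c c" "\<lambda>c. c"]
        by eventually_elim (simp add: p_def)
      ultimately have AE: "AE x in P. (\<integral>t. R n (x, t) * indicator (A \<times> B) (x, t) \<partial>\<mu>) = indicator A x * Y (k - p n k) x"
        using k AE_space
      proof eventually_elim
        case (elim x)
        have iX: "integrable \<mu> (\<lambda>t. X t x * indicator B t)"
          using elim(1) elim(4) by (simp add: XX_def indicator_times)
        have ic: "integrable \<mu> (\<lambda>t. a c t * indicator B t)" for c
          by (rule sq_integrable_mult_integrable[OF sa sB])
        have "(\<integral>t. R n (x, t) * indicator (A \<times> B) (x, t) \<partial>\<mu>) =
           (\<integral>t. indicator A x * (X t x * indicator B t - (\<Sum>c\<in>C n. (Y c x / inner c c) * (a c t * indicator B t))) \<partial>\<mu>)"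
          by (intro Bochner_Integration.integral_cong refl)
             (simp add: R_def indicator_times left_diff_distrib right_diff_distrib sum_distrib_left sum_distrib_right mult_ac)
        also have "\<dots> = indicator A x * (Y k x - (\<Sum>c\<in>C n. (Y c x / inner c c) * inner k c))"
          using iX ic by (simp add: elim(3) ab Bochner_Integration.integral_sum)
        finally show ?case unfolding elim(2) by (simp add: mult_ac)
      qed
      have "(\<integral>z. R n z * indicator (A \<times> B) z \<partial>?N) = (\<integral>x. (\<integral>t. R n (x, t) * indicator (A \<times> B) (x, t) \<partial>\<mu>) \<partial>P)"
        by (rule integral_fst'[OF iA, symmetric])
      also have "\<dots> = (\<integral>x. indicator A x * Y (k - p n k) x \<partial>P)"
        by (rule integral_cong_AE) (use AE in \<open>auto intro!: M2.borel_measurable_lebesgue_integral\<close>)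
      finally have "\<bar>\<integral>z. R n z * indicator (A \<times> B) z \<partial>?N\<bar> \<le> sqrt (\<integral>x. (indicator A x)\<^sup>2 \<partial>P) * sqrt (\<integral>x. (Y (k - p n k) x)\<^sup>2 \<partial>P)"
        using sq_integrable_Cauchy_Schwarz[of P "indicator A" "Y (k - p n k)"] Y_sq_integrable
        by (simp add: sq_integrable_indicator finite_measure_axioms)
      also have "\<dots> \<le> 1 * norm (k - p n k)"
      proof (intro mult_mono)
        have "(\<integral>x. (indicator A x)\<^sup>2 \<partial>P) = (\<integral>x. indicator A x \<partial>P :: real)"
          by (intro Bochner_Integration.integral_cong) (auto simp: indicator_def)
        also have "\<dots> = prob A" by simp
        finally show "sqrt (\<integral>x. (indicator A x)\<^sup>2 \<partial>P) \<le> 1" by (simp only: real_sqrt_le_1_iff prob_le_1)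
      qed (simp_all add: second_moment)
      finally show ?thesis by simp
    qed
    then show ?thesis by (intro Lim_null_comparison[OF _ p_lim[of k]]) simp
  qed
  have "(\<lambda>n. \<integral>z. R n z * XX z \<partial>?N) \<longlonglongrightarrow> 0"
  proof (rule weak_null_from_generator[OF N.finite_measure_axioms _ _ _ _ sR K _ XX])
    let ?G = "{A \<times> B |A B. A \<in> sets P \<and> B \<in> sets \<mu>}"
    show "sets ?N = sigma_sets (space ?N) ?G" by (simp add: sets_pair_measure space_pair_measure)
    show "Int_stable ?G" by (rule Int_stable_pair_measure_generator)
    show "?G \<subseteq> Pow (space ?N)" by (auto simp: space_pair_measure dest: sets.sets_into_space)
    show "space ?N \<in> ?G" by (auto simp: space_pair_measure)
    show "(\<lambda>n. \<integral>z. R n z * indicator A z \<partial>?N) \<longlonglongrightarrow> 0" if "A \<in> ?G" for A using that rect by auto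
  qed
  then have "(\<lambda>n. \<integral>z. (R n z)\<^sup>2 \<partial>?N) \<longlonglongrightarrow> 0" by (simp add: RX)
  moreover have iR: "integrable ?N (\<lambda>(x, t). (R n (x, t))\<^sup>2)" for n
    using sR[of n] by (simp add: sq_integrable_def case_prod_unfold)
  moreover have "(\<integral>z. (R n z)\<^sup>2 \<partial>?N) = (\<integral>t. norm (\<integral>x. (R n (x, t))\<^sup>2 \<partial>P) \<partial>\<mu>)" for n
    using integral_snd[OF iR[of n]] by (simp add: case_prod_unfold)
  ultimately have "\<exists>r::nat \<Rightarrow> nat. strict_mono r \<and> (AE t in \<mu>. (\<lambda>n. \<integral>x. (R (r n) (x, t))\<^sup>2 \<partial>P) \<longlonglongrightarrow> 0)"
    by (intro tendsto_L1_AE_subseq integrable_snd) simp_all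
  then obtain r :: "nat \<Rightarrow> nat" where "AE t in \<mu>. (\<lambda>n. \<integral>x. (R (r n) (x, t))\<^sup>2 \<partial>P) \<longlonglongrightarrow> 0" by auto
  then show ?thesis
    using AE_space
  proof eventually_elim
    case (elim t)
    define w where "w n = (\<Sum>c\<in>C (r n). (a c t / inner c c) *\<^sub>R c)" for n
    have "(\<integral>x. (R (r n) (x, t))\<^sup>2 \<partial>P) = (\<integral>x. (X t x - Y (w n) x)\<^sup>2 \<partial>P)" for n
    proof (rule integral_cong_AE)
      show "AE x in P. (R (r n) (x, t))\<^sup>2 = (X t x - Y (w n) x)\<^sup>2"
        using Y_sum[OF C(1)[of "r n"], of "\<lambda>c. a c t / inner c c" "\<lambda>c. c"]
        by eventually_elim (simp add: R_def w_def)
      show "(\<lambda>x. (R (r n) (x, t))\<^sup>2) \<in> borel_measurable P" using elim(2) by simp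
      show "(\<lambda>x. (X t x - Y (w n) x)\<^sup>2) \<in> borel_measurable P"
        using Xt[OF elim(2)] by (intro borel_measurable_power borel_measurable_diff Y_measurable) (simp add: sq_integrable_def)
    qed
    with elim(1) have "(\<lambda>n. \<integral>x. (X t x - Y (w n) x)\<^sup>2 \<partial>P) \<longlonglongrightarrow> 0" by simp
    then show ?case by (rule range_closed_L2[OF Y Xt[OF elim(2)]])
  qed
qed

lemma process_in_gaussian_space:
  fixes W :: "'h::{real_inner, banach, second_countable_topology} \<Rightarrow> 'a \<Rightarrow> real"
  assumes "prob_space M" and X: "centered_gaussian_family M {0..T} X"
    and "finite_measure \<mu>" and sp: "space \<mu> = {0..T}"
    and Xm: "(\<lambda>(x, t). X t x) \<in> borel_measurable (M \<Otimes>\<^sub>M \<mu>)"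
    and cov: "(\<integral>\<^sup>+t. ennreal (covariance M X t t) \<partial>\<mu>) < \<infinity>"
    and W: "isonormal M W"
    and rep: "(\<exists>K chi. paley_wiener M T X W K chi) \<or> (\<exists>J. karhunen_loeve M X W \<mu> J)"
  shows "AE t in \<mu>. \<exists>g. AE x in M. X t x = W g x"
  using rep
proof (elim disjE exE)
  fix K chi assume "paley_wiener M T X W K chi"
  then have chi: "\<forall>t\<in>{0..T}. AE x in M. W (chi t) x = X t x" by (simp add: paley_wiener_def)
  have "AE x in M. X t x = W (chi t) x" if "t \<in> space \<mu>" for t
  proof -
    have "AE x in M. W (chi t) x = X t x" using chi that sp by blast
    then show ?thesis by eventually_elim simp
  qed
  then show ?thesis by (intro AE_I2) blast
next
  interpret prob_space M by fact
  interpret M2: finite_measure \<mu> by fact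
  fix J assume J: "karhunen_loeve M X W \<mu> J"
  have sqX: "sq_integrable M (X t)" if t: "t \<in> space \<mu>" for t
  proof -
    have "centered_gaussian M (X t)"
      using X[unfolded centered_gaussian_family_def, rule_format, of "{t}" "\<lambda>_. 1"] t sp by simp
    then show ?thesis
      using centered_gaussian_moments(1) by (auto simp: sq_integrable_def centered_gaussian_def)
  qed
  show ?thesis
  proof (rule measurable_process_in_range[OF isonormal_gauss_field[OF \<open>prob_space M\<close> W] \<open>finite_measure \<mu>\<close> Xm _ sqX])
    have "(\<integral>\<^sup>+x. ennreal ((X t x)\<^sup>2) \<partial>M) = ennreal (covariance M X t t)" if "t \<in> space \<mu>" for t
      using sqX[OF that] by (subst nn_integral_eq_integral) (auto simp: sq_integrable_def covariance_def power2_eq_square)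
    then have "(\<integral>\<^sup>+t. (\<integral>\<^sup>+x. ennreal ((X t x)\<^sup>2) \<partial>M) \<partial>\<mu>) = (\<integral>\<^sup>+t. ennreal (covariance M X t t) \<partial>\<mu>)"
      by (rule nn_integral_cong)
    with cov show "(\<integral>\<^sup>+t. (\<integral>\<^sup>+x. ennreal ((X t x)\<^sup>2) \<partial>M) \<partial>\<mu>) < \<infinity>" by simp
    fix B assume "B \<in> sets \<mu>"
    then have "sq_integrable \<mu> (indicator B :: real \<Rightarrow> real)"
      by (rule sq_integrable_indicator[OF M2.finite_measure_axioms])
    then have "AE x in M. W (J (indicator B)) x = (\<integral>s. X s x * indicator B s \<partial>\<mu>)"
      using J by (simp add: karhunen_loeve_def)
    then have "AE x in M. (\<integral>t. X t x * indicator B t \<partial>\<mu>) = W (J (indicator B)) x" by eventually_elim simp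
    then show "\<exists>k. AE x in M. (\<integral>t. X t x * indicator B t \<partial>\<mu>) = W k x" by blast
  qed
qed

section \<open>Strict reduction of the risk\<close>

lemma grad_sobolev_pair:
  fixes Y :: "'h::{real_inner, banach, second_countable_topology} \<Rightarrow> 'a \<Rightarrow> real"
  assumes "gauss_field P Y" "F \<in> Dom_grad P Y h"
  shows "sobolev_pair P Y h F (grad P Y h F)"
proof -
  have "\<exists>G. is_grad P Y h F G" using assms(2) by (simp add: Dom_grad_def)
  then have "is_grad P Y h F (grad P Y h F)" unfolding grad_def by (rule someI_ex)
  with assms(1) show ?thesis by (rule is_grad_sobolev_pair)
qed

text \<open>With \<open>S = sqrt F\<close>, the product rule for \<open>S S = F\<close> shows that \<open>\<xi> = \<langle>g, F'\<rangle> / F\<close> equals \<open>2 \<langle>g, S'\<rangle> / S\<close>.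
  The product rule for \<open>\<xi> S = 2 \<langle>g, S'\<rangle>\<close> then computes \<open>\<langle>g, \<xi>'\<rangle>\<close> without differentiating the quotient.\<close>

lemma log_derivative_sqrt_identity:
  fixes Y :: "'h::{real_inner, banach, second_countable_topology} \<Rightarrow> 'a \<Rightarrow> real"
  assumes Y: "gauss_field P Y" and dense: "closure (span (range h)) = UNIV"
    and F: "sobolev_pair P Y h F F'" and S: "sobolev_pair P Y h (\<lambda>x. sqrt (F x)) S'"
    and pos: "AE x in P. 0 < F x"
    and \<eta>: "sobolev_pair P Y h (\<lambda>x. inner g (S' x)) \<eta>'"
    and \<xi>: "sobolev_pair P Y h (\<lambda>x. inner g (F' x) / F x) \<xi>'"
  shows "AE x in P. 2 * inner g (\<xi>' x) + (inner g (F' x) / F x)\<^sup>2 = 4 * (inner g (\<eta>' x) / sqrt (F x))"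
proof -
  have "AE x in P. 1 * F x = sqrt (F x) * sqrt (F x)" using pos by eventually_elim simp
  from sobolev_product_rule[OF Y dense S S F this]
  have F': "AE x in P. F' x = (2 * sqrt (F x)) *\<^sub>R S' x"
    by eventually_elim (simp add: scaleR_2[symmetric])
  have \<xi>S: "AE x in P. 2 * inner g (S' x) = inner g (F' x) / F x * sqrt (F x)"
    using F' pos
  proof eventually_elim
    case (elim x)
    then have "inner g (F' x) / F x * sqrt (F x) = 2 * (sqrt (F x) * sqrt (F x)) / F x * inner g (S' x)"
      by (simp add: field_simps del: real_sqrt_mult_self)
    then show ?case using elim(2) by simp
  qed
  from sobolev_product_rule[OF Y dense \<xi> S \<eta> this] this pos show ?thesis
  proof eventually_elim
    case (elim x)
    define s where "s = sqrt (F x)"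
    have s: "0 < s" using elim(3) by (simp add: s_def)
    define z where "z = inner g (F' x) / F x"
    have "inner g (2 *\<^sub>R \<eta>' x) = inner g (z *\<^sub>R S' x + s *\<^sub>R \<xi>' x)"
      using elim(1) by (simp add: z_def s_def)
    then have 1: "2 * inner g (\<eta>' x) = z * inner g (S' x) + s * inner g (\<xi>' x)"
      by (simp add: inner_add_right)
    have 2: "2 * inner g (S' x) = z * s" using elim(2) by (simp add: z_def s_def)
    have "s * (2 * inner g (\<xi>' x) + z\<^sup>2) = 2 * (s * inner g (\<xi>' x)) + z * (z * s)"
      by (simp add: power2_eq_square algebra_simps)
    also have "z * (z * s) = 2 * (z * inner g (S' x))" unfolding 2[symmetric] by simp
    also have "2 * (s * inner g (\<xi>' x)) + 2 * (z * inner g (S' x)) = 4 * inner g (\<eta>' x)" using 1 by linarith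
    finally have "2 * inner g (\<xi>' x) + z\<^sup>2 = 4 * (inner g (\<eta>' x) / s)" using s by (simp add: field_simps)
    then show ?case by (simp add: z_def s_def)
  qed
qed

theorem mainTheorem7:
  fixes M :: "'a measure" and T :: real and X :: "real \<Rightarrow> 'a \<Rightarrow> real"
    and \<mu> :: "real measure"
    and W :: "'h::{real_inner, banach, second_countable_topology} \<Rightarrow> 'a \<Rightarrow> real"
    and h :: "nat \<Rightarrow> 'h" and u :: "real \<Rightarrow> real" and v :: 'h
    and P\<^sub>u :: "'a measure" and X\<^sub>u :: "'h \<Rightarrow> 'a \<Rightarrow> real" and \<Gamma> :: "'h \<Rightarrow> real \<Rightarrow> real"
    and D :: "('a \<Rightarrow> real) \<Rightarrow> real \<Rightarrow> 'a \<Rightarrow> real"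
    and F :: "'a \<Rightarrow> real" and \<xi> :: "real \<Rightarrow> 'a \<Rightarrow> real"
  assumes "0 < T"
    and "prob_space M"
    and "centered_gaussian_family M {0..T} X"
    and "sets M = generated_sets (space M) {0..T} X"
    and "finite_measure \<mu>" and "sets \<mu> = sets (restrict_space borel {0..T})"
    and "(\<lambda>(\<omega>, t). X t \<omega>) \<in> borel_measurable (M \<Otimes>\<^sub>M \<mu>)"
    and "(\<integral>\<^sup>+t. ennreal (covariance M X t t) \<partial>\<mu>) < \<infinity>"
    and "isonormal M W"
    and "\<Gamma> = gam_op M X W"
    and "(\<exists>K chi. paley_wiener M T X W K chi \<and> (\<exists>g. pw_element T chi u g)) \<or>
         (\<exists>J. karhunen_loeve M X W \<mu> J \<and> sq_integrable \<mu> u)"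
    and "\<forall>t\<in>{0..T}. u t = \<Gamma> v t"
    and "P\<^sub>u = shifted_measure M W v" and "X\<^sub>u = shifted_process W v"
    and "closure (span (range h)) = UNIV"
    and "D = mderiv P\<^sub>u X\<^sub>u h \<Gamma>"
    and "F \<in> Dom_grad P\<^sub>u X\<^sub>u h"
    and "AE \<omega> in M. 0 < F \<omega>"
    and "\<forall>t\<in>{0..T}. D F t \<in> Dom_grad P\<^sub>u X\<^sub>u h"
    and "process_L1 P\<^sub>u \<mu> (\<lambda>t. D (D F t) t)"
    and "(\<lambda>\<omega>. sqrt (F \<omega>)) \<in> Dom_laplacian P\<^sub>u X\<^sub>u h \<Gamma> \<mu>"
    and "\<xi> = (\<lambda>t \<omega>. D F t \<omega> / F \<omega>)"
    and "sq_integrable (P\<^sub>u \<Otimes>\<^sub>M \<mu>) (\<lambda>(\<omega>, t). \<xi> t \<omega>)"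
    and "\<forall>t\<in>{0..T}. \<xi> t \<in> Dom_grad P\<^sub>u X\<^sub>u h"
    and "process_L1 P\<^sub>u \<mu> (\<lambda>t. D (\<xi> t) t)"
    and "AE \<omega> in M. laplacian P\<^sub>u X\<^sub>u h \<Gamma> \<mu> (\<lambda>\<omega>. sqrt (F \<omega>)) \<omega> \<le> 0"
    and "0 < measure M {\<omega> \<in> space M. laplacian P\<^sub>u X\<^sub>u h \<Gamma> \<mu> (\<lambda>\<omega>. sqrt (F \<omega>)) \<omega> < 0}"
  shows "risk P\<^sub>u \<mu> (\<lambda>t \<omega>. X t \<omega> + \<xi> t \<omega>) u < (\<integral>\<^sup>+t. ennreal (covariance M X t t) \<partial>\<mu>) \<and>
    (\<integral>\<^sup>+t. ennreal (covariance M X t t) \<partial>\<mu>) = risk P\<^sub>u \<mu> X u"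
proof -
  note P_def = assms(13) and Y_def = assms(14) and dense = assms(15) and D_def = assms(16)
    and G_def = assms(10) and \<xi>_def = assms(22)
  interpret GM: gauss_field M W by (rule isonormal_gauss_field[OF assms(2,9)])
  have GP: "gauss_field P\<^sub>u X\<^sub>u" unfolding P_def Y_def by (rule GM.shifted_gauss_field)
  interpret GP: gauss_field P\<^sub>u X\<^sub>u by (rule GP)
  interpret M2: finite_measure \<mu> by fact
  interpret PM: pair_sigma_finite P\<^sub>u \<mu> ..
  have AEP: "(AE x in P\<^sub>u. Q x) \<longleftrightarrow> (AE x in M. Q x)" for Q
    unfolding P_def by (rule GM.AE_shifted_measure)
  have setsP[measurable_cong]: "sets P\<^sub>u = sets M" by (simp add: P_def shifted_measure_def)
  have sp: "space \<mu> = {0..T}"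
    using sets_eq_imp_space_eq[OF assms(6)] by (simp add: space_restrict_space)
  note Xm[measurable] = assms(7)
  have Xm'[measurable]: "(\<lambda>(t, x). X t x) \<in> borel_measurable (\<mu> \<Otimes>\<^sub>M M)"
    using Xm by (subst measurable_pair_swap_iff) (simp add: case_prod_unfold)
  have um[measurable]: "u \<in> borel_measurable \<mu>"
  proof -
    have "u \<in> borel_measurable \<mu> \<longleftrightarrow> (\<lambda>t. \<integral>x. X t x * W v x \<partial>M) \<in> borel_measurable \<mu>"
      by (rule measurable_cong) (use assms(12) sp G_def in \<open>auto simp: gam_op_def\<close>)
    then show ?thesis by simp
  qed
  let ?N = "P\<^sub>u \<Otimes>\<^sub>M \<mu>"
  define S where "S x = sqrt (F x)" for x
  have SL: "S \<in> Dom_laplacian P\<^sub>u X\<^sub>u h \<Gamma> \<mu>" using assms(21) by (simp add: S_def[abs_def])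
  have SD: "S \<in> Dom_grad P\<^sub>u X\<^sub>u h" using SL by (simp add: Dom_laplacian_def)
  have pos: "AE x in P\<^sub>u. 0 < F x" using assms(18) by (simp add: AEP)
  obtain V where V: "is_version P\<^sub>u \<mu> (\<lambda>t. D (\<xi> t) t) V" and iV: "integrable ?N (\<lambda>(x, t). V t x)"
    using assms(25) unfolding process_L1_def by blast
  define L where "L = (SOME V. is_version P\<^sub>u \<mu> (\<lambda>t. D (D S t) t) V)"
  have "\<exists>V. is_version P\<^sub>u \<mu> (\<lambda>t. D (D S t) t) V" using SL by (auto simp: Dom_laplacian_def D_def)
  then have L: "is_version P\<^sub>u \<mu> (\<lambda>t. D (D S t) t) L" unfolding L_def by (rule someI_ex)
  have lap: "laplacian P\<^sub>u X\<^sub>u h \<Gamma> \<mu> (\<lambda>x. sqrt (F x)) x = (\<integral>t. L t x \<partial>\<mu>)" for x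
    unfolding laplacian_def L_def D_def S_def[abs_def] ..
  have Vm[measurable]: "(\<lambda>(x, t). V t x) \<in> borel_measurable ?N" and Lm[measurable]: "(\<lambda>(x, t). L t x) \<in> borel_measurable ?N"
    using V L by (auto simp: is_version_def)
  have \<xi>m[measurable]: "(\<lambda>(x, t). \<xi> t x) \<in> borel_measurable ?N" using assms(23) by (simp add: sq_integrable_def)
  have [measurable]: "S \<in> borel_measurable P\<^sub>u"
    using sobolev_pair_sq_integrable(1)[OF grad_sobolev_pair[OF GP SD]] by (simp add: sq_integrable_def)
  have XmP[measurable]: "(\<lambda>(x, t). X t x) \<in> borel_measurable ?N"
    using Xm by (simp cong: measurable_cong_sets sets_pair_measure_cong add: setsP)
  define b where "b = (\<lambda>(x, t). X t x - u t)"
  have bm[measurable]: "b \<in> borel_measurable ?N" unfolding b_def by measurable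
  have chaos: "AE t in \<mu>. \<exists>g. AE x in M. X t x = W g x"
    by (rule process_in_gaussian_space[OF assms(2,3,5) sp assms(7,8,9)]) (use assms(11) in blast)
  \<comment> \<open>All four properties hold at each time \<open>t\<close> for which \<open>X t\<close> is \<open>W g\<close> for some \<open>g\<close>.\<close>
  have good: "AE t in \<mu>. t \<in> space \<mu> \<and> (\<integral>\<^sup>+x. ennreal ((b (x, t))\<^sup>2) \<partial>P\<^sub>u) = ennreal (covariance M X t t)
      \<and> (\<integral>x. b (x, t) * \<xi> t x \<partial>P\<^sub>u) = (\<integral>x. V t x \<partial>P\<^sub>u)
      \<and> (AE x in P\<^sub>u. 2 * V t x + (\<xi> t x)\<^sup>2 = 4 * (L t x / S x))"
    using chaos AE_space
  proof eventually_elim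
    case (elim t)
    then obtain g where g: "AE x in M. X t x = W g x" by auto
    have t: "t \<in> space \<mu>" "t \<in> {0..T}" using elim(2) sp by auto
    have [measurable]: "X t \<in> borel_measurable M" using Xm t(1) by measurable
    have \<Gamma>: "\<Gamma> k t = inner g k" for k
    proof -
      have "\<Gamma> k t = (\<integral>x. W g x * W k x \<partial>M)"
        unfolding G_def gam_op_def by (rule integral_cong_AE) (use g in auto)
      then show ?thesis by (simp add: GM.covariance_inner)
    qed
    have bY: "AE x in P\<^sub>u. b (x, t) = X\<^sub>u g x"
      unfolding AEP using g
    proof eventually_elim
      case (elim x)
      then show ?case using assms(12) t(2) by (simp add: b_def Y_def shifted_process_def \<Gamma>)
    qed
    have "covariance M X t t = (\<integral>x. W g x * W g x \<partial>M)"
      unfolding covariance_def by (rule integral_cong_AE) (use g in auto)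
    then have cov: "covariance M X t t = (norm g)\<^sup>2" by (simp add: GM.covariance_inner power2_norm_eq_inner)
    have "(\<integral>\<^sup>+x. ennreal ((b (x, t))\<^sup>2) \<partial>P\<^sub>u) = (\<integral>\<^sup>+x. ennreal ((X\<^sub>u g x)\<^sup>2) \<partial>P\<^sub>u)"
      by (rule nn_integral_cong_AE) (use bY in auto)
    also have "\<dots> = ennreal ((norm g)\<^sup>2)"
      using GP.second_moment[of g] by (subst nn_integral_eq_integral) auto
    finally have 1: "(\<integral>\<^sup>+x. ennreal ((b (x, t))\<^sup>2) \<partial>P\<^sub>u) = ennreal (covariance M X t t)" by (simp add: cov)
    have DI: "D A t x = inner g (grad P\<^sub>u X\<^sub>u h A x)" for A x by (simp add: D_def mderiv_def \<Gamma>)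
    have \<xi>D: "\<xi> t \<in> Dom_grad P\<^sub>u X\<^sub>u h" using assms(24) t(2) by blast
    note \<xi>pair = grad_sobolev_pair[OF GP \<xi>D]
    have [measurable]: "\<xi> t \<in> borel_measurable P\<^sub>u" "V t \<in> borel_measurable P\<^sub>u"
      "grad P\<^sub>u X\<^sub>u h (\<xi> t) \<in> borel_measurable P\<^sub>u"
      using sobolev_pair_sq_integrable[OF \<xi>pair] Vm t(1) by (auto simp: sq_integrable_def)
    have Vt: "AE x in P\<^sub>u. V t x = D (\<xi> t) t x" and Lt: "AE x in P\<^sub>u. L t x = D (D S t) t x"
      using V L t(1) by (auto simp: is_version_def)
    have "(\<integral>x. b (x, t) * \<xi> t x \<partial>P\<^sub>u) = (\<integral>x. X\<^sub>u g x * \<xi> t x \<partial>P\<^sub>u)"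
      by (rule integral_cong_AE) (use bY t(1) in auto)
    also have "\<dots> = (\<integral>x. inner (grad P\<^sub>u X\<^sub>u h (\<xi> t) x) g \<partial>P\<^sub>u)"
      by (rule sobolev_ibp[OF GP \<xi>pair])
    also have "\<dots> = (\<integral>x. V t x \<partial>P\<^sub>u)"
      by (rule integral_cong_AE) (use Vt in \<open>auto simp: DI inner_commute\<close>)
    finally have 2: "(\<integral>x. b (x, t) * \<xi> t x \<partial>P\<^sub>u) = (\<integral>x. V t x \<partial>P\<^sub>u)" .
    have DSt: "D S t \<in> Dom_grad P\<^sub>u X\<^sub>u h" using SL t(1) unfolding Dom_laplacian_def D_def by blast
    have "AE x in P\<^sub>u. 2 * inner g (grad P\<^sub>u X\<^sub>u h (\<xi> t) x) + (inner g (grad P\<^sub>u X\<^sub>u h F x) / F x)\<^sup>2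
        = 4 * (inner g (grad P\<^sub>u X\<^sub>u h (D S t) x) / sqrt (F x))"
    proof (rule log_derivative_sqrt_identity[OF GP dense grad_sobolev_pair[OF GP assms(17)] _ pos])
      show "sobolev_pair P\<^sub>u X\<^sub>u h (\<lambda>w. sqrt (F w)) (grad P\<^sub>u X\<^sub>u h S)"
        using grad_sobolev_pair[OF GP SD] by (simp add: S_def[abs_def])
      show "sobolev_pair P\<^sub>u X\<^sub>u h (\<lambda>w. inner g (grad P\<^sub>u X\<^sub>u h S w)) (grad P\<^sub>u X\<^sub>u h (D S t))"
        using grad_sobolev_pair[OF GP DSt] by (simp add: DI[abs_def])
      show "sobolev_pair P\<^sub>u X\<^sub>u h (\<lambda>w. inner g (grad P\<^sub>u X\<^sub>u h F w) / F w) (grad P\<^sub>u X\<^sub>u h (\<xi> t))"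
        using \<xi>pair by (simp add: \<xi>_def DI)
    qed
    then have "AE x in P\<^sub>u. 2 * V t x + (\<xi> t x)\<^sup>2 = 4 * (L t x / S x)"
      using Vt Lt by eventually_elim (simp add: DI \<xi>_def S_def)
    with t 1 2 show ?case by blast
  qed
  have nn_b: "(\<integral>\<^sup>+z. ennreal ((b z)\<^sup>2) \<partial>?N) = (\<integral>\<^sup>+t. ennreal (covariance M X t t) \<partial>\<mu>)"
    by (subst PM.nn_integral_snd[symmetric]) (use good in \<open>auto intro!: nn_integral_cong_AE elim: eventually_mono\<close>)
  have risk_X: "risk P\<^sub>u \<mu> X u = (\<integral>\<^sup>+z. ennreal ((b z)\<^sup>2) \<partial>?N)"
    unfolding risk_def by (subst M2.nn_integral_fst[symmetric]) (auto simp: b_def)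
  have ib: "integrable ?N (\<lambda>z. (b z)\<^sup>2)"
    using nn_b assms(8) by (intro integrableI_bounded) auto
  then have sb: "sq_integrable ?N b" by (simp add: sq_integrable_def)
  define w where "w = (\<lambda>(x, t). \<xi> t x)"
  have sx: "sq_integrable ?N w" using assms(23) by (simp add: w_def)
  then have xm[measurable]: "w \<in> borel_measurable ?N" and ix: "integrable ?N (\<lambda>z. (w z)\<^sup>2)" by (auto simp: sq_integrable_def)
  have ibx: "integrable ?N (\<lambda>z. b z * w z)" by (rule sq_integrable_mult_integrable[OF sb sx])
  define y where "y = (\<lambda>(x, t). V t x)"
  have iy: "integrable ?N y" using iV by (simp add: y_def)
  have cross: "(\<integral>z. b z * w z \<partial>?N) = (\<integral>z. y z \<partial>?N)"
  proof -
    have "(\<integral>z. b z * w z \<partial>?N) = (\<integral>t. (\<integral>x. b (x, t) * \<xi> t x \<partial>P\<^sub>u) \<partial>\<mu>)"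
      using PM.integral_snd[of "\<lambda>x t. b (x, t) * w (x, t)"] ibx by (simp add: case_prod_unfold w_def)
    also have "\<dots> = (\<integral>t. (\<integral>x. V t x \<partial>P\<^sub>u) \<partial>\<mu>)"
    proof (rule integral_cong_AE)
      show "AE t in \<mu>. (\<integral>x. b (x, t) * \<xi> t x \<partial>P\<^sub>u) = (\<integral>x. V t x \<partial>P\<^sub>u)"
        using good by eventually_elim simp
      show "(\<lambda>t. \<integral>x. b (x, t) * \<xi> t x \<partial>P\<^sub>u) \<in> borel_measurable \<mu>"
        using borel_measurable_integrable[OF PM.integrable_snd[of "\<lambda>x t. b (x, t) * w (x, t)"]] ibx by (simp add: case_prod_unfold w_def)
      show "(\<lambda>t. \<integral>x. V t x \<partial>P\<^sub>u) \<in> borel_measurable \<mu>"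
        using borel_measurable_integrable[OF PM.integrable_snd[OF iV]] by simp
    qed
    also have "\<dots> = (\<integral>z. y z \<partial>?N)" unfolding y_def using PM.integral_snd[OF iV] by simp
    finally show ?thesis .
  qed
  define H where "H z = 2 * y z + (w z)\<^sup>2" for z
  have iH: "integrable ?N H" unfolding H_def using iy ix by simp
  have ibx2: "integrable ?N (\<lambda>z. (b z + w z)\<^sup>2)"
    using sq_integrable_add[OF sb sx] by (simp add: sq_integrable_def)
  have expand: "(\<integral>z. (b z + w z)\<^sup>2 \<partial>?N) = (\<integral>z. (b z)\<^sup>2 \<partial>?N) + (\<integral>z. H z \<partial>?N)"
  proof -
    have "(\<integral>z. (b z + w z)\<^sup>2 \<partial>?N) = (\<integral>z. (b z)\<^sup>2 + (2 * (b z * w z) + (w z)\<^sup>2) \<partial>?N)"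
      by (intro Bochner_Integration.integral_cong refl) (simp add: power2_sum)
    also have "\<dots> = (\<integral>z. (b z)\<^sup>2 \<partial>?N) + (2 * (\<integral>z. y z \<partial>?N) + (\<integral>z. (w z)\<^sup>2 \<partial>?N))"
      using ib ibx ix cross by simp
    also have "2 * (\<integral>z. y z \<partial>?N) + (\<integral>z. (w z)\<^sup>2 \<partial>?N) = (\<integral>z. H z \<partial>?N)"
      unfolding H_def using iy ix by simp
    finally show ?thesis .
  qed
  \<comment> \<open>Integrated in time, \<open>H\<close> is four times the Laplacian of \<open>S\<close> divided by \<open>S\<close>.\<close>
  define q where "q x = (\<integral>t. H (x, t) \<partial>\<mu>)" for x
  have iq: "integrable P\<^sub>u q" unfolding q_def by (rule PM.integrable_fst'[OF iH])
  have "AE x in P\<^sub>u. AE t in \<mu>. H (x, t) = 4 * (L t x / S x)"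
  proof (subst PM.AE_commute)
    show "AE t in \<mu>. AE x in P\<^sub>u. H (x, t) = 4 * (L t x / S x)"
      using good by eventually_elim (simp add: H_def w_def y_def)
    have "(\<lambda>z. case z of (x, t) \<Rightarrow> H (x, t) - 4 * (L t x / S x)) \<in> borel_measurable ?N"
      using iH by measurable
    then have "{z \<in> space ?N. (case z of (x, t) \<Rightarrow> H (x, t) - 4 * (L t x / S x)) = 0} \<in> sets ?N" by measurable
    then show "{z \<in> space ?N. H (fst z, snd z) = 4 * (L (snd z) (fst z) / S (fst z))} \<in> sets ?N"
      by (simp add: case_prod_unfold)
  qed
  then have q_eq: "AE x in P\<^sub>u. q x = 4 * ((\<integral>t. L t x \<partial>\<mu>) / S x)"
    using AE_space
  proof eventually_elim
    case (elim x)
    have m1: "(\<lambda>t. H (x, t)) \<in> borel_measurable \<mu>" using iH elim(2) by measurable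
    have m2: "(\<lambda>t. L t x) \<in> borel_measurable \<mu>" using Lm elim(2) by measurable
    have "q x = (\<integral>t. 4 * (L t x / S x) \<partial>\<mu>)"
      unfolding q_def by (rule integral_cong_AE) (use elim(1) m1 m2 in auto)
    then show ?case by simp
  qed
  have Lle: "AE x in P\<^sub>u. (\<integral>t. L t x \<partial>\<mu>) \<le> 0" using assms(26) by (simp add: AEP lap)
  have q_le: "AE x in P\<^sub>u. q x \<le> 0"
    using q_eq Lle pos by eventually_elim (simp add: S_def divide_le_0_iff)
  have "(\<integral>x. q x \<partial>P\<^sub>u) \<noteq> 0"
  proof
    assume "(\<integral>x. q x \<partial>P\<^sub>u) = 0"
    then have "AE x in P\<^sub>u. - q x = 0"
      using q_le iq integral_nonneg_eq_0_iff_AE[of P\<^sub>u "\<lambda>x. - q x"] by simp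
    then have "AE x in P\<^sub>u. \<not> (\<integral>t. L t x \<partial>\<mu>) < 0"
      using q_eq pos by eventually_elim (simp add: S_def)
    then have AE: "AE x in M. x \<notin> {x \<in> space M. (\<integral>t. L t x \<partial>\<mu>) < 0}"
      unfolding AEP by eventually_elim simp
    have "0 < measure M {x \<in> space M. (\<integral>t. L t x \<partial>\<mu>) < 0}" using assms(27) by (simp only: lap)
    moreover from this have "{x \<in> space M. (\<integral>t. L t x \<partial>\<mu>) < 0} \<in> sets M"
      using measure_notin_sets by fastforce
    ultimately show False using iffD2[OF GM.prob_eq_0 AE] by simp
  qed
  moreover have "(\<integral>x. q x \<partial>P\<^sub>u) \<le> 0"
    using integral_mono_AE[OF iq _ q_le] by simp
  moreover have "(\<integral>x. q x \<partial>P\<^sub>u) = (\<integral>z. H z \<partial>?N)" unfolding q_def by (rule PM.integral_fst'[OF iH])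
  ultimately have less: "(\<integral>z. (b z + w z)\<^sup>2 \<partial>?N) < (\<integral>z. (b z)\<^sup>2 \<partial>?N)" unfolding expand by linarith
  have "risk P\<^sub>u \<mu> (\<lambda>t x. X t x + \<xi> t x) u = (\<integral>\<^sup>+z. ennreal ((b z + w z)\<^sup>2) \<partial>?N)"
    unfolding risk_def by (subst M2.nn_integral_fst[symmetric]) (auto simp: b_def w_def algebra_simps)
  also have "\<dots> = ennreal (\<integral>z. (b z + w z)\<^sup>2 \<partial>?N)"
    using ibx2 by (intro nn_integral_eq_integral) auto
  also have "\<dots> < ennreal (\<integral>z. (b z)\<^sup>2 \<partial>?N)"
    using less by (subst ennreal_less_iff) auto
  also have "\<dots> = (\<integral>\<^sup>+z. ennreal ((b z)\<^sup>2) \<partial>?N)"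
    using ib by (intro nn_integral_eq_integral[symmetric]) auto
  finally show ?thesis using nn_b risk_X by simp
qed

end
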